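(* Let $\mathcal{C}$ be a small category and let $\hat{\mathcal{C}} = [\mathcal{C}^{op},\mathbf{Set}]$ be its presheaf topos. Then there is an equivalence of categories $$\mathbf{KRegFrm}_{\hat{\mathcal{C}}} \simeq [\mathcal{C}^{op},\mathbf{KRegFrm}],$$ where $\mathbf{KRegFrm}_{\hat{\mathcal{C}}}$ is the category of internal compact regular frames in the topos $\hat{\mathcal{C}}$ (and internal frame homomorphisms), and $[\mathcal{C}^{op},\mathbf{KRegFrm}]$ is the category of functors $\mathcal{C}^{op}\to\mathbf{KRegFrm}$ and natural transformations.
   Context: A frame is a complete lattice in which finite meets distribute over arbitrary joins; frame homomorphisms preserve finite meets and arbitrary joins. In a distributive lattice write $a \triangleleft b$ if there exists $c$ with $a\wedge c = 0$ and $b \vee c = 1$. A frame $L$ is regular if $b = \bigvee\{b' \mid b' \triangleleft b\}$ for every $b \in L$. It is compact if every directed (in particular inhabited) subset of $L$ whose join is $1$ contains $1$. $\mathbf{KRegFrm}$ is the category of compact regular frames (in $\mathbf{Set}$) and frame homomorphisms. For a topos $\mathcal{T}$, $\mathbf{KRegFrm}_{\mathcal{T}}$ denotes the category obtained by interpreting these definitions in the internal logic of $\mathcal{T}$. Its objects are the internal posets $L$ of $\mathcal{T}$ which, internally, are frames (in particular the order-embedding of $L$ into its power object $P_{\mathcal{T}}L$, sending $a$ to its down-set, has an internal left adjoint $\bigvee : P_{\mathcal{T}}L \to L$) and which internally are compact (every directed, in particular inhabited, subset of $L$ whose join is $1$ contains $1$) and regular ($b = \bigvee\{b' \mid b' \triangleleft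 b\}$ for every $b \in L$). Its morphisms are the morphisms of $\mathcal{T}$ that internally preserve finite meets and arbitrary joins. For $\mathcal{T}=\hat{\mathcal{C}}$, an internal poset is the same as a functor from $\mathcal{C}^{op}$ to posets, and the internal logic is Kripke–Joyal semantics in the presheaf topos. *)

theory Defs
  imports "HOL-Algebra.Complete_Lattice" "HOL-Library.Equipollence" "HOL-Library.FuncSet"
begin

section \<open>Categories\<close>

text \<open>\<open>Cmp C g f\<close> is the composite \<open>g \<circ> f\<close>; it is only meaningful for \<open>Cod C f = Dom C g\<close>.\<close>

record ('o, 'a) category =
  Obj :: "'o set"
  Arr :: "'a set"
  Dom :: "'a \<Rightarrow> 'o"
  Cod :: "'a \<Rightarrow> 'o"
  Idt :: "'o \<Rightarrow> 'a"
  Cmp :: "'a \<Rightarrow> 'a \<Rightarrow> 'a"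

definition Hom :: "('o, 'a) category \<Rightarrow> 'o \<Rightarrow> 'o \<Rightarrow> 'a set" where
  "Hom C a b = {f \<in> Arr C. Dom C f = a \<and> Cod C f = b}"

definition is_category :: "('o, 'a) category \<Rightarrow> bool" where
  "is_category C \<longleftrightarrow>
     (\<forall>f\<in>Arr C. Dom C f \<in> Obj C \<and> Cod C f \<in> Obj C) \<and>
     (\<forall>a\<in>Obj C. Idt C a \<in> Hom C a a) \<and>
     (\<forall>f\<in>Arr C. \<forall>g\<in>Arr C. Cod C f = Dom C g \<longrightarrow> Cmp C g f \<in> Hom C (Dom C f) (Cod C g)) \<and>
     (\<forall>f\<in>Arr C. Cmp C f (Idt C (Dom C f)) = f \<and> Cmp C (Idt C (Cod C f)) f = f) \<and>
     (\<forall>f\<in>Arr C. \<forall>g\<in>Arr C. \<forall>h\<in>Arr C. Cod C f = Dom C g \<longrightarrow> Cod C g = Dom C h \<longrightarrow>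
        Cmp C h (Cmp C g f) = Cmp C (Cmp C h g) f)"

definition op_cat :: "('o, 'a) category \<Rightarrow> ('o, 'a) category" where
  "op_cat C = \<lparr>Obj = Obj C, Arr = Arr C, Dom = Cod C, Cod = Dom C, Idt = Idt C,
     Cmp = (\<lambda>g f. Cmp C f g)\<rparr>"

definition is_iso :: "('o, 'a) category \<Rightarrow> 'a \<Rightarrow> bool" where
  "is_iso C f \<longleftrightarrow> f \<in> Arr C \<and>
     (\<exists>g \<in> Hom C (Cod C f) (Dom C f).
        Cmp C g f = Idt C (Dom C f) \<and> Cmp C f g = Idt C (Cod C f))"

record ('o, 'a, 'p, 'b) fctr =
  FObj :: "'o \<Rightarrow> 'p"
  FArr :: "'a \<Rightarrow> 'b"

definition is_functor ::
  "('o, 'a) category \<Rightarrow> ('p, 'b) category \<Rightarrow> ('o, 'a, 'p, 'b) fctr \<Rightarrow> bool" where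
  "is_functor C D F \<longleftrightarrow>
     (\<forall>a\<in>Obj C. FObj F a \<in> Obj D) \<and>
     (\<forall>f\<in>Arr C. FArr F f \<in> Hom D (FObj F (Dom C f)) (FObj F (Cod C f))) \<and>
     (\<forall>a\<in>Obj C. FArr F (Idt C a) = Idt D (FObj F a)) \<and>
     (\<forall>f\<in>Arr C. \<forall>g\<in>Arr C. Cod C f = Dom C g \<longrightarrow>
        FArr F (Cmp C g f) = Cmp D (FArr F g) (FArr F f))"

definition id_fctr :: "('o, 'a, 'o, 'a) fctr" where
  "id_fctr = \<lparr>FObj = (\<lambda>a. a), FArr = (\<lambda>f. f)\<rparr>"

definition comp_fctr ::
  "('p, 'b, 'q, 'c) fctr \<Rightarrow> ('o, 'a, 'p, 'b) fctr \<Rightarrow> ('o, 'a, 'q, 'c) fctr" where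
  "comp_fctr G F = \<lparr>FObj = FObj G \<circ> FObj F, FArr = FArr G \<circ> FArr F\<rparr>"

definition is_nat_trans ::
  "('o, 'a) category \<Rightarrow> ('p, 'b) category \<Rightarrow> ('o, 'a, 'p, 'b) fctr \<Rightarrow>
     ('o, 'a, 'p, 'b) fctr \<Rightarrow> ('o \<Rightarrow> 'b) \<Rightarrow> bool" where
  "is_nat_trans C D F G \<eta> \<longleftrightarrow>
     (\<forall>a\<in>Obj C. \<eta> a \<in> Hom D (FObj F a) (FObj G a)) \<and>
     (\<forall>f\<in>Arr C. Cmp D (\<eta> (Cod C f)) (FArr F f) = Cmp D (FArr G f) (\<eta> (Dom C f)))"

definition naturally_isomorphic ::
  "('o, 'a) category \<Rightarrow> ('p, 'b) category \<Rightarrow> ('o, 'a, 'p, 'b) fctr \<Rightarrow>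
     ('o, 'a, 'p, 'b) fctr \<Rightarrow> bool" where
  "naturally_isomorphic C D F G \<longleftrightarrow>
     (\<exists>\<eta>. is_nat_trans C D F G \<eta> \<and> (\<forall>a\<in>Obj C. is_iso D (\<eta> a)))"

definition equivalent_categories :: "('o, 'a) category \<Rightarrow> ('p, 'b) category \<Rightarrow> bool" where
  "equivalent_categories C D \<longleftrightarrow>
     is_category C \<and> is_category D \<and>
     (\<exists>F G. is_functor C D F \<and> is_functor D C G \<and>
        naturally_isomorphic C C id_fctr (comp_fctr G F) \<and>
        naturally_isomorphic D D (comp_fctr F G) id_fctr)"

text \<open>Functors and natural transformations are made extensional, so that equality of arrows in
  the functor category is equality of natural transformations.\<close>

definition functor_category ::
  "('o, 'a) category \<Rightarrow> ('p, 'b) category \<Rightarrow>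
     (('o, 'a, 'p, 'b) fctr,
      ('o, 'a, 'p, 'b) fctr \<times> ('o \<Rightarrow> 'b) \<times> ('o, 'a, 'p, 'b) fctr) category" where
  "functor_category C D =
    (let Fun = {F. is_functor C D F \<and> FObj F \<in> extensional (Obj C) \<and> FArr F \<in> extensional (Arr C)}
     in \<lparr>Obj = Fun,
         Arr = {(F, \<eta>, G). F \<in> Fun \<and> G \<in> Fun \<and> is_nat_trans C D F G \<eta> \<and> \<eta> \<in> extensional (Obj C)},
         Dom = (\<lambda>(F, \<eta>, G). F),
         Cod = (\<lambda>(F, \<eta>, G). G),
         Idt = (\<lambda>F. (F, \<lambda>a\<in>Obj C. Idt D (FObj F a), F)),
         Cmp = (\<lambda>(G', \<beta>, H) (F, \<alpha>, G). (F, \<lambda>a\<in>Obj C. Cmp D (\<beta> a) (\<alpha> a), H))\<rparr>)"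


section \<open>Sets, smallness and presheaves\<close>

text \<open>
  ``Set'' is the category of members of a universe \<open>U\<close>. The closure conditions are those of a
  Grothendieck universe, read up to bijection because the members of \<open>U\<close> are sets over one type
  \<open>'u\<close>: if \<open>'u\<close> is a model of set theory, \<open>U\<close> may consist of the extensions of all its elements.
\<close>

definition set_universe :: "'u set set \<Rightarrow> bool" where
  "set_universe U \<longleftrightarrow>
     (\<forall>X\<in>U. \<forall>Y. Y \<subseteq> X \<longrightarrow> Y \<in> U) \<and>
     (\<forall>X\<in>U. \<exists>Y\<in>U. Y \<approx> Pow X) \<and>
     (\<forall>I\<in>U. \<forall>X. (\<forall>i\<in>I. X i \<in> U) \<longrightarrow> (\<exists>Y\<in>U. Y \<approx> Sigma I X))"

definition small_category :: "'u set set \<Rightarrow> ('o, 'a) category \<Rightarrow> bool" where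
  "small_category U C \<longleftrightarrow> is_category C \<and> (\<exists>X\<in>U. X \<approx> Obj C) \<and> (\<exists>X\<in>U. X \<approx> Arr C)"

type_synonym 'u set_arr = "'u set \<times> ('u \<Rightarrow> 'u) \<times> 'u set"

definition set_cat :: "'u set set \<Rightarrow> ('u set, 'u set_arr) category" where
  "set_cat U = \<lparr>Obj = U,
     Arr = {(A, f, B). A \<in> U \<and> B \<in> U \<and> f \<in> A \<rightarrow>\<^sub>E B},
     Dom = (\<lambda>(A, f, B). A),
     Cod = (\<lambda>(A, f, B). B),
     Idt = (\<lambda>A. (A, \<lambda>x\<in>A. x, A)),
     Cmp = (\<lambda>(B', g, D) (A, f, B). (A, compose A g f, D))\<rparr>"

definition set_arr_fun :: "'u set_arr \<Rightarrow> 'u \<Rightarrow> 'u" where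
  "set_arr_fun = (\<lambda>(A, f, B). f)"

type_synonym ('o, 'a, 'u) presheaf = "('o, 'a, 'u set, 'u set_arr) fctr"

type_synonym ('o, 'a, 'u) presheaf_arr =
  "('o, 'a, 'u) presheaf \<times> ('o \<Rightarrow> 'u set_arr) \<times> ('o, 'a, 'u) presheaf"

definition presheaf_topos ::
  "'u set set \<Rightarrow> ('o, 'a) category \<Rightarrow> (('o, 'a, 'u) presheaf, ('o, 'a, 'u) presheaf_arr) category"
  where "presheaf_topos U C = functor_category (op_cat C) (set_cat U)"

definition psh_restrict :: "('o, 'a, 'u) presheaf \<Rightarrow> 'a \<Rightarrow> 'u \<Rightarrow> 'u" where
  "psh_restrict X f = set_arr_fun (FArr X f)"

definition psh_map :: "('o, 'a, 'u) presheaf_arr \<Rightarrow> 'o \<Rightarrow> 'u \<Rightarrow> 'u" where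
  "psh_map = (\<lambda>(X, \<eta>, Y) c. set_arr_fun (\<eta> c))"

text \<open>The value at \<open>c\<close> of the power object of \<open>X\<close>: subpresheaves of \<open>y(c) \<times> X\<close>.\<close>

definition psh_power :: "('o, 'a) category \<Rightarrow> ('o, 'a, 'u) presheaf \<Rightarrow> 'o \<Rightarrow> ('a \<times> 'u) set set" where
  "psh_power C X c = {S.
     (\<forall>(f, x)\<in>S. f \<in> Arr C \<and> Cod C f = c \<and> x \<in> FObj X (Dom C f)) \<and>
     (\<forall>(f, x)\<in>S. \<forall>g\<in>Arr C. Cod C g = Dom C f \<longrightarrow> (Cmp C f g, psh_restrict X g x) \<in> S)}"

definition power_restrict ::
  "('o, 'a) category \<Rightarrow> 'a \<Rightarrow> ('a \<times> 'u) set \<Rightarrow> ('a \<times> 'u) set" where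
  "power_restrict C f S = {(g, x). g \<in> Arr C \<and> Cod C g = Dom C f \<and> (Cmp C f g, x) \<in> S}"


section \<open>The internal language of a presheaf with a binary relation\<close>

text \<open>
  Formulas about an object \<open>L\<close> of the presheaf topos with an internal relation \<open>\<le>\<close>. There are
  variables of sort \<open>L\<close> and, in a separate name space, variables of sort \<open>P L\<close> (the power object);
  both are named by natural numbers. \<open>FAllP\<close> quantifies over \<open>P L\<close>.
\<close>

datatype fm =
    FLe nat nat  (infix \<open>\<^bold>\<le>\<close> 60)
  | FEq nat nat  (infix \<open>\<^bold>=\<close> 60)
  | FMem nat nat  (infix \<open>\<^bold>\<in>\<close> 60)
  | FAnd fm fm  (infixr \<open>\<^bold>\<and>\<close> 45)
  | FImp fm fm  (infixr \<open>\<^bold>\<longrightarrow>\<close> 40)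
  | FAll nat fm
  | FEx nat fm
  | FAllP nat fm

definition FIff :: "fm \<Rightarrow> fm \<Rightarrow> fm"  (infix \<open>\<^bold>\<longleftrightarrow>\<close> 40) where
  "FIff p q = ((p \<^bold>\<longrightarrow> q) \<^bold>\<and> (q \<^bold>\<longrightarrow> p))"

type_synonym ('o, 'a, 'u) psh_rel = "('o, 'a, 'u) presheaf \<times> ('o \<Rightarrow> ('u \<times> 'u) set)"

text \<open>Kripke--Joyal semantics: \<open>forces C L c \<rho> \<sigma> p\<close> says that \<open>p\<close> holds at stage \<open>c\<close> for the
  generalized elements \<open>\<rho> n \<in> L(c)\<close> and \<open>\<sigma> n \<in> (P L)(c)\<close>.\<close>

fun forces ::
  "('o, 'a) category \<Rightarrow> ('o, 'a, 'u) psh_rel \<Rightarrow> 'o \<Rightarrow> (nat \<Rightarrow> 'u) \<Rightarrow> (nat \<Rightarrow> ('a \<times> 'u) set) \<Rightarrow>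
     fm \<Rightarrow> bool" where
  "forces C L c \<rho> \<sigma> (FLe x y) \<longleftrightarrow> (\<rho> x, \<rho> y) \<in> snd L c"
| "forces C L c \<rho> \<sigma> (FEq x y) \<longleftrightarrow> \<rho> x = \<rho> y"
| "forces C L c \<rho> \<sigma> (FMem x A) \<longleftrightarrow> (Idt C c, \<rho> x) \<in> \<sigma> A"
| "forces C L c \<rho> \<sigma> (FAnd p q) \<longleftrightarrow> forces C L c \<rho> \<sigma> p \<and> forces C L c \<rho> \<sigma> q"
| "forces C L c \<rho> \<sigma> (FImp p q) \<longleftrightarrow>
     (\<forall>f\<in>Arr C. Cod C f = c \<longrightarrow>
        forces C L (Dom C f) (psh_restrict (fst L) f \<circ> \<rho>) (power_restrict C f \<circ> \<sigma>) p \<longrightarrow>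
        forces C L (Dom C f) (psh_restrict (fst L) f \<circ> \<rho>) (power_restrict C f \<circ> \<sigma>) q)"
| "forces C L c \<rho> \<sigma> (FAll x p) \<longleftrightarrow>
     (\<forall>f\<in>Arr C. Cod C f = c \<longrightarrow> (\<forall>a\<in>FObj (fst L) (Dom C f).
        forces C L (Dom C f) ((psh_restrict (fst L) f \<circ> \<rho>)(x := a)) (power_restrict C f \<circ> \<sigma>) p))"
| "forces C L c \<rho> \<sigma> (FEx x p) \<longleftrightarrow>
     (\<exists>a\<in>FObj (fst L) c. forces C L c (\<rho>(x := a)) \<sigma> p)"
| "forces C L c \<rho> \<sigma> (FAllP A p) \<longleftrightarrow>
     (\<forall>f\<in>Arr C. Cod C f = c \<longrightarrow> (\<forall>S\<in>psh_power C (fst L) (Dom C f).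
        forces C L (Dom C f) (psh_restrict (fst L) f \<circ> \<rho>) ((power_restrict C f \<circ> \<sigma>)(A := S)) p))"

text \<open>Validity of a closed formula; the valuations \<open>\<rho>\<close>, \<open>\<sigma>\<close> are then irrelevant.\<close>

definition valid :: "('o, 'a) category \<Rightarrow> ('o, 'a, 'u) psh_rel \<Rightarrow> fm \<Rightarrow> bool" where
  "valid C L p \<longleftrightarrow> (\<forall>c\<in>Obj C. \<forall>\<rho> \<sigma>. forces C L c \<rho> \<sigma> p)"

text \<open>In the following formulas the parameters are variable names, and the bound variables are
  chosen different from the parameters. Operations are expressed by their graphs:
  \<open>fm_meet a b m\<close> says \<open>m = a \<and> b\<close>, and \<open>fm_Join A s\<close> says \<open>s = \<Or>A\<close>.\<close>

definition fm_top :: "nat \<Rightarrow> fm" where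
  "fm_top t = (let x = t + 1 in FAll x (x \<^bold>\<le> t))"

definition fm_bot :: "nat \<Rightarrow> fm" where
  "fm_bot z = (let x = z + 1 in FAll x (z \<^bold>\<le> x))"

definition fm_meet :: "nat \<Rightarrow> nat \<Rightarrow> nat \<Rightarrow> fm" where
  "fm_meet a b m = (let x = a + b + m + 1 in
     m \<^bold>\<le> a \<^bold>\<and> m \<^bold>\<le> b \<^bold>\<and> FAll x (x \<^bold>\<le> a \<^bold>\<and> x \<^bold>\<le> b \<^bold>\<longrightarrow> x \<^bold>\<le> m))"

definition fm_join :: "nat \<Rightarrow> nat \<Rightarrow> nat \<Rightarrow> fm" where
  "fm_join a b j = (let x = a + b + j + 1 in
     a \<^bold>\<le> j \<^bold>\<and> b \<^bold>\<le> j \<^bold>\<and> FAll x (a \<^bold>\<le> x \<^bold>\<and> b \<^bold>\<le> x \<^bold>\<longrightarrow> j \<^bold>\<le> x))"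

definition fm_Join :: "nat \<Rightarrow> nat \<Rightarrow> fm" where
  "fm_Join A s = (let x = s + 1; u = s + 2 in
     FAll x (x \<^bold>\<in> A \<^bold>\<longrightarrow> x \<^bold>\<le> s) \<^bold>\<and>
     FAll u (FAll x (x \<^bold>\<in> A \<^bold>\<longrightarrow> x \<^bold>\<le> u) \<^bold>\<longrightarrow> s \<^bold>\<le> u))"

definition fm_well_inside :: "nat \<Rightarrow> nat \<Rightarrow> fm" where
  "fm_well_inside a b = (let c = a + b + 1; z = a + b + 2; t = a + b + 3 in
     FEx c (FEx z (FEx t (fm_bot z \<^bold>\<and> fm_top t \<^bold>\<and> fm_meet a c z \<^bold>\<and> fm_join b c t))))"

definition fm_directed :: "nat \<Rightarrow> fm" where
  "fm_directed A =
     (FEx 0 (0 \<^bold>\<in> A) \<^bold>\<and>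
      FAll 0 (FAll 1 (0 \<^bold>\<in> A \<^bold>\<and> 1 \<^bold>\<in> A \<^bold>\<longrightarrow> FEx 2 (2 \<^bold>\<in> A \<^bold>\<and> 0 \<^bold>\<le> 2 \<^bold>\<and> 1 \<^bold>\<le> 2))))"

definition fm_poset :: fm where
  "fm_poset =
     (FAll 0 (0 \<^bold>\<le> 0) \<^bold>\<and>
      FAll 0 (FAll 1 (0 \<^bold>\<le> 1 \<^bold>\<and> 1 \<^bold>\<le> 0 \<^bold>\<longrightarrow> 0 \<^bold>= 1)) \<^bold>\<and>
      FAll 0 (FAll 1 (FAll 2 (0 \<^bold>\<le> 1 \<^bold>\<and> 1 \<^bold>\<le> 2 \<^bold>\<longrightarrow> 0 \<^bold>\<le> 2))))"

definition fm_complete :: fm where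
  "fm_complete = FAllP 0 (FEx 0 (fm_Join 0 0))"

text \<open>With \<open>A = 0\<close>, \<open>B = 1\<close> (sort \<open>P L\<close>) and \<open>a = 0\<close>, \<open>s = 1\<close>, \<open>m = 2\<close> (sort \<open>L\<close>):
  if \<open>s = \<Or>A\<close>, \<open>m = a \<and> s\<close> and \<open>B = {a \<and> x | x \<in> A}\<close>, then \<open>m = \<Or>B\<close>.\<close>

definition fm_distrib :: fm where
  "fm_distrib = FAllP 0 (FAll 0 (FAll 1 (FAll 2 (fm_Join 0 1 \<^bold>\<and> fm_meet 0 1 2 \<^bold>\<longrightarrow>
     FAllP 1 (FAll 3 (3 \<^bold>\<in> 1 \<^bold>\<longleftrightarrow> FEx 4 (4 \<^bold>\<in> 0 \<^bold>\<and> fm_meet 0 4 3)) \<^bold>\<longrightarrow> fm_Join 1 2)))))"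

definition fm_frame :: fm where
  "fm_frame = (fm_poset \<^bold>\<and> fm_complete \<^bold>\<and> fm_distrib)"

definition fm_compact :: fm where
  "fm_compact = FAllP 0 (FAll 0 (fm_directed 0 \<^bold>\<and> fm_top 0 \<^bold>\<and> fm_Join 0 0 \<^bold>\<longrightarrow> 0 \<^bold>\<in> 0))"

definition fm_regular :: fm where
  "fm_regular = FAll 0 (FAllP 0 (FAll 1 (1 \<^bold>\<in> 0 \<^bold>\<longleftrightarrow> fm_well_inside 1 0) \<^bold>\<longrightarrow> fm_Join 0 0))"


section \<open>Internal compact regular frames in the presheaf topos\<close>

definition internal_kreg_frame ::
  "'u set set \<Rightarrow> ('o, 'a) category \<Rightarrow> ('o, 'a, 'u) psh_rel \<Rightarrow> bool" where
  "internal_kreg_frame U C L \<longleftrightarrow>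
     fst L \<in> Obj (presheaf_topos U C) \<and>
     (\<forall>c\<in>Obj C. snd L c \<subseteq> FObj (fst L) c \<times> FObj (fst L) c) \<and>
     (\<forall>f\<in>Arr C. \<forall>(x, y)\<in>snd L (Cod C f).
        (psh_restrict (fst L) f x, psh_restrict (fst L) f y) \<in> snd L (Dom C f)) \<and>
     valid C L fm_frame \<and> valid C L fm_compact \<and> valid C L fm_regular"

text \<open>The internal statements \<open>\<forall>x. p(x) \<longrightarrow> q(\<alpha> x)\<close> that \<open>\<alpha>\<close> preserves the top element, binary
  meets and joins, spelled out by Kripke--Joyal; such a statement is valid iff at every stage each
  generalized element satisfying \<open>p\<close> satisfies \<open>q \<circ> \<alpha>\<close>. The direct image of \<open>S \<in> (P L)(c)\<close> is
  \<open>{(f, \<alpha> x) | (f, x) \<in> S}\<close>.\<close>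

definition internal_frame_hom ::
  "('o, 'a) category \<Rightarrow> ('o, 'a, 'u) psh_rel \<Rightarrow> ('o, 'a, 'u) psh_rel \<Rightarrow>
     ('o, 'a, 'u) presheaf_arr \<Rightarrow> bool" where
  "internal_frame_hom C L M \<alpha> \<longleftrightarrow>
     (\<forall>c\<in>Obj C. \<forall>\<rho> \<sigma>. (\<forall>n. \<rho> n \<in> FObj (fst L) c) \<longrightarrow> (\<forall>n. \<sigma> n \<in> psh_power C (fst L) c) \<longrightarrow>
       (let \<rho>' = psh_map \<alpha> c \<circ> \<rho>;
            \<sigma>' = (\<lambda>n. (\<lambda>(f, x). (f, psh_map \<alpha> (Dom C f) x)) ` \<sigma> n)
        in (forces C L c \<rho> \<sigma> (fm_top 0) \<longrightarrow> forces C M c \<rho>' \<sigma>' (fm_top 0)) \<and>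
           (forces C L c \<rho> \<sigma> (fm_meet 0 1 2) \<longrightarrow> forces C M c \<rho>' \<sigma>' (fm_meet 0 1 2)) \<and>
           (forces C L c \<rho> \<sigma> (fm_Join 0 0) \<longrightarrow> forces C M c \<rho>' \<sigma>' (fm_Join 0 0))))"

definition internal_kreg_frm ::
  "'u set set \<Rightarrow> ('o, 'a) category \<Rightarrow>
     (('o, 'a, 'u) psh_rel,
      ('o, 'a, 'u) psh_rel \<times> ('o, 'a, 'u) presheaf_arr \<times> ('o, 'a, 'u) psh_rel) category" where
  "internal_kreg_frm U C =
     \<lparr>Obj = {L. internal_kreg_frame U C L},
      Arr = {(L, \<alpha>, M). internal_kreg_frame U C L \<and> internal_kreg_frame U C M \<and>
               \<alpha> \<in> Hom (presheaf_topos U C) (fst L) (fst M) \<and> internal_frame_hom C L M \<alpha>},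
      Dom = (\<lambda>(L, \<alpha>, M). L),
      Cod = (\<lambda>(L, \<alpha>, M). M),
      Idt = (\<lambda>L. (L, Idt (presheaf_topos U C) (fst L), L)),
      Cmp = (\<lambda>(M', \<beta>, N) (L, \<alpha>, M). (L, Cmp (presheaf_topos U C) \<beta> \<alpha>, N))\<rparr>"


section \<open>Compact regular frames\<close>

definition is_frame :: "'u gorder \<Rightarrow> bool" where
  "is_frame L \<longleftrightarrow> complete_lattice L \<and>
     (\<forall>a\<in>carrier L. \<forall>A. A \<subseteq> carrier L \<longrightarrow> a \<sqinter>\<^bsub>L\<^esub> (\<Squnion>\<^bsub>L\<^esub> A) = \<Squnion>\<^bsub>L\<^esub> ((\<lambda>x. a \<sqinter>\<^bsub>L\<^esub> x) ` A))"

definition well_inside :: "'u gorder \<Rightarrow> 'u \<Rightarrow> 'u \<Rightarrow> bool" where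
  "well_inside L a b \<longleftrightarrow> (\<exists>c\<in>carrier L. a \<sqinter>\<^bsub>L\<^esub> c = \<bottom>\<^bsub>L\<^esub> \<and> b \<squnion>\<^bsub>L\<^esub> c = \<top>\<^bsub>L\<^esub>)"

definition regular_frame :: "'u gorder \<Rightarrow> bool" where
  "regular_frame L \<longleftrightarrow> (\<forall>b\<in>carrier L. b = \<Squnion>\<^bsub>L\<^esub> {b' \<in> carrier L. well_inside L b' b})"

definition directed_in :: "'u gorder \<Rightarrow> 'u set \<Rightarrow> bool" where
  "directed_in L A \<longleftrightarrow> A \<noteq> {} \<and> (\<forall>a\<in>A. \<forall>b\<in>A. \<exists>d\<in>A. a \<sqsubseteq>\<^bsub>L\<^esub> d \<and> b \<sqsubseteq>\<^bsub>L\<^esub> d)"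

definition compact_frame :: "'u gorder \<Rightarrow> bool" where
  "compact_frame L \<longleftrightarrow>
     (\<forall>A. A \<subseteq> carrier L \<longrightarrow> directed_in L A \<longrightarrow> \<Squnion>\<^bsub>L\<^esub> A = \<top>\<^bsub>L\<^esub> \<longrightarrow> \<top>\<^bsub>L\<^esub> \<in> A)"

definition frame_hom :: "'u gorder \<Rightarrow> 'u gorder \<Rightarrow> ('u \<Rightarrow> 'u) \<Rightarrow> bool" where
  "frame_hom L M h \<longleftrightarrow>
     h \<top>\<^bsub>L\<^esub> = \<top>\<^bsub>M\<^esub> \<and>
     (\<forall>a\<in>carrier L. \<forall>b\<in>carrier L. h (a \<sqinter>\<^bsub>L\<^esub> b) = h a \<sqinter>\<^bsub>M\<^esub> h b) \<and>
     (\<forall>A. A \<subseteq> carrier L \<longrightarrow> h (\<Squnion>\<^bsub>L\<^esub> A) = \<Squnion>\<^bsub>M\<^esub> (h ` A))"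

definition kreg_frm :: "'u set set \<Rightarrow> ('u gorder, 'u gorder \<times> ('u \<Rightarrow> 'u) \<times> 'u gorder) category" where
  "kreg_frm U =
    (let KReg = {L. carrier L \<in> U \<and> is_frame L \<and> compact_frame L \<and> regular_frame L}
     in \<lparr>Obj = KReg,
         Arr = {(L, h, M). L \<in> KReg \<and> M \<in> KReg \<and> h \<in> carrier L \<rightarrow>\<^sub>E carrier M \<and> frame_hom L M h},
         Dom = (\<lambda>(L, h, M). L),
         Cod = (\<lambda>(L, h, M). M),
         Idt = (\<lambda>L. (L, \<lambda>x\<in>carrier L. x, L)),
         Cmp = (\<lambda>(M', k, N) (L, h, M). (L, compose (carrier L) k h, N))\<rparr>)"

end

theory Submission
  imports Defs
begin

text \<open>
  The equivalence is not computed stagewise: for an internal compact regular frame \<open>L\<close> the stage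
  \<open>L(c)\<close> is a compact frame but in general not a regular one, because the internal join
  \<open>b = \<Or>{x | x \<triangleleft> b}\<close> runs over elements at all stages above \<open>c\<close>. Compactness, applied
  to the internally directed set \<open>{x \<or> w | x \<triangleleft> u}\<close>, shows that \<open>L(c)\<close> is normal, and hence
  that its elements of the form \<open>u = \<Or>{v \<in> L(c) | v \<triangleleft> u}\<close> make up a compact regular
  subframe \<open>K(c)\<close>. The functor \<open>L \<mapsto> K\<close> is the equivalence.

  \<open>L\<close> is recovered from \<open>K\<close> as the presheaf of lax families: \<open>u \<in> L(c)\<close> is determined by the
  regular interiors of all its restrictions, and every family \<open>(u\<^sub>f)\<close> with \<open>g\<^sup>* u\<^sub>f \<le> u\<^bsub>fg\<^esub>\<close>
  arises from its internal join. Here compactness enters again: if that join \<open>u\<close> satisfies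
  \<open>u \<or> w = 1\<close>, then the directed set \<open>{y | y \<le> u\<^sub>f \<or> f\<^sup>* w}\<close> has join \<open>1\<close>, so already
  \<open>u\<^bsub>id\<^esub> \<or> w = 1\<close>. Internal joins of lax families are computed pointwise in \<open>K\<close>,
  so that homomorphisms and the frame axioms transfer in both directions.
\<close>

section \<open>Categories\<close>

text \<open>The subobject classifier is the guiding example. If \<open>K\<close> is constantly the
  two-element frame, the lax families over \<open>c\<close> are the sieves on \<open>c\<close>. For
  a category with a single non-identity arrow 0 -> 1, the sieves on 1 form a three-element chain.
  Its middle element is an internal join of a top element living at stage 0, but only the bottom is
  well inside it at stage 1. Laxness has the same origin in general. The restriction of a regular
  interior is regular and lies below the restricted element, hence below the interior of that
  element. The restricted element may acquire further approximants at the later stage, so equality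
  fails. Everything in regularity except the join is stagewise: internal existence in a presheaf
  topos is witnessed at the stage itself, so top, bottom, finite meets and joins and the well-inside
  relation can be computed at one stage. The locale \<open>lax_rep\<close> isolates what two
  directions share. With regular interiors of a given frame it yields fullness; with evaluation of
  coded families at the identity it yields essential surjectivity. No inverse functor is written
  down.\<close>

lemma HomI: "f \<in> Arr C \<Longrightarrow> Dom C f = a \<Longrightarrow> Cod C f = b \<Longrightarrow> f \<in> Hom C a b"
  by (simp add: Hom_def)

lemma HomD:
  assumes "f \<in> Hom C a b"
  shows "f \<in> Arr C" "Dom C f = a" "Cod C f = b"
  using assms by (auto simp: Hom_def)

locale cat =
  fixes C :: "('o, 'a) category"
  assumes is_category: "is_category C"
begin

lemma dom_obj [simp, intro]: "f \<in> Arr C \<Longrightarrow> Dom C f \<in> Obj C"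
  and cod_obj [simp, intro]: "f \<in> Arr C \<Longrightarrow> Cod C f \<in> Obj C"
  using is_category by (auto simp: is_category_def)

lemma id_hom [intro]: "a \<in> Obj C \<Longrightarrow> Idt C a \<in> Hom C a a"
  using is_category by (auto simp: is_category_def)

lemma id_arr [simp]:
  assumes "a \<in> Obj C"
  shows "Idt C a \<in> Arr C" "Dom C (Idt C a) = a" "Cod C (Idt C a) = a"
  using id_hom[OF assms] by (auto simp: Hom_def)

lemma comp_hom [intro]:
  assumes "f \<in> Hom C a b" "g \<in> Hom C b c"
  shows "Cmp C g f \<in> Hom C a c"
  using is_category assms by (auto simp: is_category_def Hom_def)

lemma comp_arr [simp]:
  assumes "f \<in> Arr C" "g \<in> Arr C" "Cod C f = Dom C g"
  shows "Cmp C g f \<in> Arr C" "Dom C (Cmp C g f) = Dom C f" "Cod C (Cmp C g f) = Cod C g"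
  using comp_hom[of f "Dom C f" "Dom C g" g "Cod C g"] assms by (auto simp: Hom_def)

lemma comp_id_right [simp]: "f \<in> Arr C \<Longrightarrow> a = Dom C f \<Longrightarrow> Cmp C f (Idt C a) = f"
  and comp_id_left [simp]: "f \<in> Arr C \<Longrightarrow> a = Cod C f \<Longrightarrow> Cmp C (Idt C a) f = f"
  using is_category by (auto simp: is_category_def)

lemma comp_assoc:
  assumes "f \<in> Arr C" "g \<in> Arr C" "h \<in> Arr C" "Cod C f = Dom C g" "Cod C g = Dom C h"
  shows "Cmp C (Cmp C h g) f = Cmp C h (Cmp C g f)"
  using is_category assms by (auto simp: is_category_def)

lemma comp_assoc_hom:
  assumes "f \<in> Hom C a b" "g \<in> Hom C b c" "h \<in> Hom C c d"
  shows "Cmp C (Cmp C h g) f = Cmp C h (Cmp C g f)"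
  using comp_assoc assms by (auto simp: Hom_def)

lemma is_isoI:
  assumes "f \<in> Hom C a b" "g \<in> Hom C b a" "Cmp C g f = Idt C a" "Cmp C f g = Idt C b"
  shows "is_iso C f"
  using assms by (auto simp: is_iso_def Hom_def)

end

lemma is_isoE:
  assumes "is_iso C f" "f \<in> Hom C a b"
  obtains g where "g \<in> Hom C b a" "Cmp C g f = Idt C a" "Cmp C f g = Idt C b"
  using assms by (auto simp: is_iso_def Hom_def)

lemma is_functorD:
  assumes "is_functor C D F"
  shows "a \<in> Obj C \<Longrightarrow> FObj F a \<in> Obj D"
    and "f \<in> Hom C a b \<Longrightarrow> FArr F f \<in> Hom D (FObj F a) (FObj F b)"
    and "a \<in> Obj C \<Longrightarrow> FArr F (Idt C a) = Idt D (FObj F a)"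
    and "f \<in> Hom C a b \<Longrightarrow> g \<in> Hom C b c \<Longrightarrow> FArr F (Cmp C g f) = Cmp D (FArr F g) (FArr F f)"
  using assms by (auto simp: is_functor_def Hom_def)

lemma is_categoryI:
  assumes "\<And>f. f \<in> Arr C \<Longrightarrow> Dom C f \<in> Obj C \<and> Cod C f \<in> Obj C"
    and "\<And>a. a \<in> Obj C \<Longrightarrow> Idt C a \<in> Hom C a a"
    and "\<And>f g. f \<in> Arr C \<Longrightarrow> g \<in> Arr C \<Longrightarrow> Cod C f = Dom C g \<Longrightarrow>
           Cmp C g f \<in> Hom C (Dom C f) (Cod C g)"
    and "\<And>f. f \<in> Arr C \<Longrightarrow> Cmp C f (Idt C (Dom C f)) = f \<and> Cmp C (Idt C (Cod C f)) f = f"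
    and "\<And>f g h. f \<in> Arr C \<Longrightarrow> g \<in> Arr C \<Longrightarrow> h \<in> Arr C \<Longrightarrow> Cod C f = Dom C g \<Longrightarrow>
           Cod C g = Dom C h \<Longrightarrow> Cmp C h (Cmp C g f) = Cmp C (Cmp C h g) f"
  shows "is_category C"
  unfolding is_category_def using assms by blast

lemma op_cat_simps [simp]:
  "Obj (op_cat C) = Obj C" "Arr (op_cat C) = Arr C" "Dom (op_cat C) = Cod C"
  "Cod (op_cat C) = Dom C" "Idt (op_cat C) = Idt C" "Cmp (op_cat C) g f = Cmp C f g"
  by (simp_all add: op_cat_def)

lemma is_category_op_cat: "is_category C \<Longrightarrow> is_category (op_cat C)"
  by (auto simp: is_category_def Hom_def)

lemma is_category_set_cat: "is_category (set_cat U)"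
  by (rule is_categoryI)
    (auto simp: set_cat_def Hom_def compose_def restrict_def PiE_def extensional_def fun_eq_iff)

lemma Obj_functor_category:
  "F \<in> Obj (functor_category C D) \<longleftrightarrow>
     is_functor C D F \<and> FObj F \<in> extensional (Obj C) \<and> FArr F \<in> extensional (Arr C)"
  by (simp add: functor_category_def Let_def)

lemma Arr_functor_category:
  "(F, \<eta>, G) \<in> Arr (functor_category C D) \<longleftrightarrow>
     F \<in> Obj (functor_category C D) \<and> G \<in> Obj (functor_category C D) \<and>
     is_nat_trans C D F G \<eta> \<and> \<eta> \<in> extensional (Obj C)"
  by (simp add: functor_category_def Let_def)

lemma functor_category_simps [simp]:
  "Dom (functor_category C D) (F, \<eta>, G) = F"
  "Cod (functor_category C D) (F, \<eta>, G) = G"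
  "Idt (functor_category C D) F = (F, \<lambda>a\<in>Obj C. Idt D (FObj F a), F)"
  "Cmp (functor_category C D) (G', \<beta>, H) (F, \<alpha>, G) = (F, \<lambda>a\<in>Obj C. Cmp D (\<beta> a) (\<alpha> a), H)"
  by (simp_all add: functor_category_def Let_def)

lemma Hom_functor_category:
  "t \<in> Hom (functor_category C D) F G \<longleftrightarrow>
     (\<exists>\<eta>. t = (F, \<eta>, G) \<and> F \<in> Obj (functor_category C D) \<and> G \<in> Obj (functor_category C D) \<and>
        is_nat_trans C D F G \<eta> \<and> \<eta> \<in> extensional (Obj C))"
  by (cases t) (auto simp: Hom_def Arr_functor_category)

lemma nat_trans_comp:
  assumes "is_category C" "is_category D" "is_functor C D F" "is_functor C D G" "is_functor C D H"
    and "is_nat_trans C D F G \<alpha>" "is_nat_trans C D G H \<beta>"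
  shows "is_nat_trans C D F H (\<lambda>a\<in>Obj C. Cmp D (\<beta> a) (\<alpha> a))"
proof -
  interpret C: cat C by standard fact
  interpret D: cat D by standard fact
  have a: "\<alpha> x \<in> Hom D (FObj F x) (FObj G x)" "\<beta> x \<in> Hom D (FObj G x) (FObj H x)"
    if "x \<in> Obj C" for x
    using assms(6,7) that by (auto simp: is_nat_trans_def)
  show ?thesis unfolding is_nat_trans_def
  proof (intro conjI ballI)
    fix x assume "x \<in> Obj C"
    then show "(\<lambda>a\<in>Obj C. Cmp D (\<beta> a) (\<alpha> a)) x \<in> Hom D (FObj F x) (FObj H x)"
      using a by (auto intro: D.comp_hom)
  next
    fix f assume f: "f \<in> Arr C"
    then have o: "Dom C f \<in> Obj C" "Cod C f \<in> Obj C" by auto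
    have fh: "f \<in> Hom C (Dom C f) (Cod C f)" using f by (simp add: Hom_def)
    note F = is_functorD(2)[OF assms(3) fh] is_functorD(2)[OF assms(4) fh] is_functorD(2)[OF assms(5) fh]
    have n1: "Cmp D (\<alpha> (Cod C f)) (FArr F f) = Cmp D (FArr G f) (\<alpha> (Dom C f))"
      and n2: "Cmp D (\<beta> (Cod C f)) (FArr G f) = Cmp D (FArr H f) (\<beta> (Dom C f))"
      using assms(6,7) f by (auto simp: is_nat_trans_def)
    show "Cmp D ((\<lambda>a\<in>Obj C. Cmp D (\<beta> a) (\<alpha> a)) (Cod C f)) (FArr F f) =
          Cmp D (FArr H f) ((\<lambda>a\<in>Obj C. Cmp D (\<beta> a) (\<alpha> a)) (Dom C f))"
      using o n1 n2 D.comp_assoc_hom[OF F(1) a(1)[OF o(2)] a(2)[OF o(2)]]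
        D.comp_assoc_hom[OF a(1)[OF o(1)] F(2) a(2)[OF o(2)]]
        D.comp_assoc_hom[OF a(1)[OF o(1)] a(2)[OF o(1)] F(3)] by simp
  qed
qed

lemma nat_trans_id:
  assumes "is_category C" "is_category D" "is_functor C D F"
  shows "is_nat_trans C D F F (\<lambda>a\<in>Obj C. Idt D (FObj F a))"
proof -
  interpret C: cat C by standard fact
  interpret D: cat D by standard fact
  have "FArr F f \<in> Hom D (FObj F (Dom C f)) (FObj F (Cod C f))" if "f \<in> Arr C" for f
    using is_functorD(2)[OF assms(3)] that by (simp add: Hom_def)
  then show ?thesis
    using is_functorD(1)[OF assms(3)] by (auto simp: is_nat_trans_def Hom_def)
qed

lemma is_category_functor_category:
  assumes "is_category C" "is_category D"
  shows "is_category (functor_category C D)"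
proof -
  interpret C: cat C by standard fact
  interpret D: cat D by standard fact
  let ?FC = "functor_category C D"
  have nt: "\<eta> a \<in> Hom D (FObj F a) (FObj G a)" if "is_nat_trans C D F G \<eta>" "a \<in> Obj C" for F G \<eta> a
    using that by (auto simp: is_nat_trans_def)
  show ?thesis
  proof (rule is_categoryI)
    fix f assume "f \<in> Arr ?FC"
    then show "Dom ?FC f \<in> Obj ?FC \<and> Cod ?FC f \<in> Obj ?FC"
      by (cases f) (auto simp: Arr_functor_category)
  next
    fix F assume "F \<in> Obj ?FC"
    then show "Idt ?FC F \<in> Hom ?FC F F"
      using nat_trans_id[OF assms, of F]
      by (auto simp: Hom_functor_category Obj_functor_category)
  next
    fix f g assume "f \<in> Arr ?FC" "g \<in> Arr ?FC" "Cod ?FC f = Dom ?FC g"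
    then show "Cmp ?FC g f \<in> Hom ?FC (Dom ?FC f) (Cod ?FC g)"
      by (cases f, cases g)
        (auto simp: Arr_functor_category Hom_functor_category Obj_functor_category
          intro: nat_trans_comp[OF assms])
  next
    fix f assume "f \<in> Arr ?FC"
    then show "Cmp ?FC f (Idt ?FC (Dom ?FC f)) = f \<and> Cmp ?FC (Idt ?FC (Cod ?FC f)) f = f"
      using nt by (cases f) (fastforce simp: Arr_functor_category extensional_def fun_eq_iff Hom_def)
  next
    fix f g h assume *: "f \<in> Arr ?FC" "g \<in> Arr ?FC" "h \<in> Arr ?FC" "Cod ?FC f = Dom ?FC g"
      "Cod ?FC g = Dom ?FC h"
    obtain F \<alpha> G \<beta> H \<gamma> I where e: "f = (F, \<alpha>, G)" "g = (G, \<beta>, H)" "h = (H, \<gamma>, I)"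
      using * by (cases f, cases g, cases h) auto
    have "Cmp D (\<gamma> a) (Cmp D (\<beta> a) (\<alpha> a)) = Cmp D (Cmp D (\<gamma> a) (\<beta> a)) (\<alpha> a)" if "a \<in> Obj C" for a
      using * e nt[OF _ that] D.comp_assoc_hom by (metis (no_types, lifting) Arr_functor_category)
    then show "Cmp ?FC h (Cmp ?FC g f) = Cmp ?FC (Cmp ?FC h g) f"
      by (auto simp: e restrict_def fun_eq_iff)
  qed
qed

text \<open>Naturality of the inverse is automatic: the square of \<open>\<eta>\<close> at
  \<open>f\<close>, composed with the inverse components on both sides, is the square of the
  inverse.\<close>

lemma is_iso_functor_categoryI:
  assumes "is_category C" "is_category D"
    and t: "(F, \<eta>, G) \<in> Arr (functor_category C D)"
    and iso: "\<And>a. a \<in> Obj C \<Longrightarrow> is_iso D (\<eta> a)"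
  shows "is_iso (functor_category C D) (F, \<eta>, G)"
proof -
  interpret C: cat C by standard fact
  interpret D: cat D by standard fact
  interpret FC: cat "functor_category C D"
    by standard (rule is_category_functor_category[OF assms(1,2)])
  have FG: "is_functor C D F" "is_functor C D G" "is_nat_trans C D F G \<eta>" "\<eta> \<in> extensional (Obj C)"
    using t by (auto simp: Arr_functor_category Obj_functor_category)
  have \<eta>: "\<eta> a \<in> Hom D (FObj F a) (FObj G a)" if "a \<in> Obj C" for a
    using FG(3) that by (simp add: is_nat_trans_def)
  have "\<forall>a. \<exists>g. a \<in> Obj C \<longrightarrow> g \<in> Hom D (FObj G a) (FObj F a) \<and>
      Cmp D g (\<eta> a) = Idt D (FObj F a) \<and> Cmp D (\<eta> a) g = Idt D (FObj G a)"
    using is_isoE[OF iso \<eta>] by blast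
  then obtain \<theta>0 where th0: "\<And>a. a \<in> Obj C \<Longrightarrow> \<theta>0 a \<in> Hom D (FObj G a) (FObj F a) \<and>
      Cmp D (\<theta>0 a) (\<eta> a) = Idt D (FObj F a) \<and> Cmp D (\<eta> a) (\<theta>0 a) = Idt D (FObj G a)"
    by metis
  \<comment> \<open>Arrows of the functor category carry extensional families.\<close>
  define \<theta> where "\<theta> = restrict \<theta>0 (Obj C)"
  have \<theta>: "\<theta> a \<in> Hom D (FObj G a) (FObj F a)" "Cmp D (\<theta> a) (\<eta> a) = Idt D (FObj F a)"
      "Cmp D (\<eta> a) (\<theta> a) = Idt D (FObj G a)" if "a \<in> Obj C" for a
    using th0[OF that] that by (auto simp: \<theta>_def)
  have "is_nat_trans C D G F \<theta>" unfolding is_nat_trans_def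
  proof (intro conjI ballI \<theta>(1))
    fix f assume f: "f \<in> Arr C"
    let ?a = "Dom C f" and ?b = "Cod C f"
    have o: "?a \<in> Obj C" "?b \<in> Obj C" using f by auto
    have fh: "f \<in> Hom C ?a ?b" using f by (simp add: Hom_def)
    note Ff = is_functorD(2)[OF FG(1) fh] and Gf = is_functorD(2)[OF FG(2) fh]
    have "Cmp D (\<theta> ?b) (FArr G f) = Cmp D (\<theta> ?b) (Cmp D (FArr G f) (Cmp D (\<eta> ?a) (\<theta> ?a)))"
      using \<theta>(3)[OF o(1)] Gf by (simp add: HomD)
    also have "\<dots> = Cmp D (\<theta> ?b) (Cmp D (Cmp D (FArr G f) (\<eta> ?a)) (\<theta> ?a))"
      using D.comp_assoc_hom[OF \<theta>(1)[OF o(1)] \<eta>[OF o(1)] Gf] by simp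
    also have "Cmp D (FArr G f) (\<eta> ?a) = Cmp D (\<eta> ?b) (FArr F f)"
      using FG(3) f by (simp add: is_nat_trans_def)
    also have "Cmp D (Cmp D (\<eta> ?b) (FArr F f)) (\<theta> ?a) = Cmp D (\<eta> ?b) (Cmp D (FArr F f) (\<theta> ?a))"
      by (rule D.comp_assoc_hom[OF \<theta>(1)[OF o(1)] Ff \<eta>[OF o(2)]])
    also have "Cmp D (\<theta> ?b) \<dots> = Cmp D (Cmp D (\<theta> ?b) (\<eta> ?b)) (Cmp D (FArr F f) (\<theta> ?a))"
      by (rule D.comp_assoc_hom[OF D.comp_hom[OF \<theta>(1)[OF o(1)] Ff] \<eta>[OF o(2)] \<theta>(1)[OF o(2)], symmetric])
    also have "\<dots> = Cmp D (FArr F f) (\<theta> ?a)"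
      using \<theta>(2)[OF o(2)] HomD[OF D.comp_hom[OF \<theta>(1)[OF o(1)] Ff]] by simp
    finally show "Cmp D (\<theta> ?b) (FArr G f) = Cmp D (FArr F f) (\<theta> ?a)" .
  qed
  then have "(G, \<theta>, F) \<in> Arr (functor_category C D)"
    using t by (auto simp: Arr_functor_category \<theta>_def)
  then show ?thesis
    using t \<theta> by (intro FC.is_isoI[of _ F G "(G, \<theta>, F)"]) (auto simp: Hom_def intro!: restrict_ext)
qed

text \<open>Essential surjectivity supplies isomorphisms \<open>e d\<close> onto \<open>d\<close>,
  and full faithfulness turns each arrow between the chosen objects into a unique arrow of
  \<open>C\<close>; functoriality and naturality are then checked after applying the faithful
  \<open>F\<close>. In the application this means that the presheaf of lax families has to be built
  on objects only.\<close>

lemma equivalent_categoriesI: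
  assumes C: "is_category C" and D: "is_category D" and F: "is_functor C D F"
    and faithful: "\<And>a b f g. f \<in> Hom C a b \<Longrightarrow> g \<in> Hom C a b \<Longrightarrow> FArr F f = FArr F g \<Longrightarrow> f = g"
    and full: "\<And>a b h. a \<in> Obj C \<Longrightarrow> b \<in> Obj C \<Longrightarrow> h \<in> Hom D (FObj F a) (FObj F b) \<Longrightarrow>
                 \<exists>f\<in>Hom C a b. FArr F f = h"
    and dense: "\<And>d. d \<in> Obj D \<Longrightarrow> \<exists>a\<in>Obj C. \<exists>h\<in>Hom D (FObj F a) d. is_iso D h"
  shows "equivalent_categories C D"
proof -
  interpret C: cat C by standard fact
  interpret D: cat D by standard fact
  note F_obj = is_functorD(1)[OF F] and F_hom = is_functorD(2)[OF F] and F_id = is_functorD(3)[OF F]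
    and F_comp = is_functorD(4)[OF F]
  obtain G0 e where G0: "\<And>d. d \<in> Obj D \<Longrightarrow> G0 d \<in> Obj C"
    and e: "\<And>d. d \<in> Obj D \<Longrightarrow> e d \<in> Hom D (FObj F (G0 d)) d"
    and e_iso: "\<And>d. d \<in> Obj D \<Longrightarrow> is_iso D (e d)"
    using dense by metis
  have "\<forall>d. \<exists>i. d \<in> Obj D \<longrightarrow> i \<in> Hom D d (FObj F (G0 d)) \<and>
      Cmp D i (e d) = Idt D (FObj F (G0 d)) \<and> Cmp D (e d) i = Idt D d"
    using is_isoE[OF e_iso e] by blast
  then obtain i where "\<And>d. d \<in> Obj D \<Longrightarrow> i d \<in> Hom D d (FObj F (G0 d)) \<and>
      Cmp D (i d) (e d) = Idt D (FObj F (G0 d)) \<and> Cmp D (e d) (i d) = Idt D d"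
    by metis
  then have i: "\<And>d. d \<in> Obj D \<Longrightarrow> i d \<in> Hom D d (FObj F (G0 d))"
    and ie: "\<And>d. d \<in> Obj D \<Longrightarrow> Cmp D (i d) (e d) = Idt D (FObj F (G0 d))"
    and ei: "\<And>d. d \<in> Obj D \<Longrightarrow> Cmp D (e d) (i d) = Idt D d" by auto
  \<comment> \<open>The conjugate of \<open>h\<close> by the chosen isomorphisms; the action of
    \<open>G\<close> on \<open>h\<close> will be a preimage of it under \<open>F\<close>.\<close>
  define T where "T h = Cmp D (i (Cod D h)) (Cmp D h (e (Dom D h)))" for h
  have T: "T h \<in> Hom D (FObj F (G0 a)) (FObj F (G0 b))" if "h \<in> Hom D a b" for h a b
  proof -
    have "a \<in> Obj D" "b \<in> Obj D" using that by (auto simp: Hom_def)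
    then show ?thesis unfolding T_def using that e i HomD[OF that] by (auto intro!: D.comp_hom)
  qed
  have "\<forall>h. \<exists>f. h \<in> Arr D \<longrightarrow> f \<in> Hom C (G0 (Dom D h)) (G0 (Cod D h)) \<and> FArr F f = T h"
    using full[OF G0 G0 T] by (auto simp: Hom_def)
  then obtain G1 where "\<And>h. h \<in> Arr D \<Longrightarrow> G1 h \<in> Hom C (G0 (Dom D h)) (G0 (Cod D h)) \<and> FArr F (G1 h) = T h"
    by metis
  then have G1: "\<And>h a b. h \<in> Hom D a b \<Longrightarrow> G1 h \<in> Hom C (G0 a) (G0 b)"
    and FG1: "\<And>h a b. h \<in> Hom D a b \<Longrightarrow> FArr F (G1 h) = T h" by (auto simp: Hom_def)
  define G where "G = \<lparr>FObj = G0, FArr = G1\<rparr>"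
  have eT: "Cmp D (e b) (T h) = Cmp D h (e a)" if h: "h \<in> Hom D a b" for h a b
  proof -
    have o: "a \<in> Obj D" "b \<in> Obj D" using h by (auto simp: Hom_def)
    have c: "Cmp D h (e a) \<in> Hom D (FObj F (G0 a)) b" using e[OF o(1)] h by (rule D.comp_hom)
    show ?thesis
      using D.comp_assoc_hom[OF c i[OF o(2)] e[OF o(2)]] ei[OF o(2)] HomD[OF h] HomD[OF c]
      by (simp add: T_def)
  qed
  \<comment> \<open>\<open>e b\<close> has the left inverse \<open>i b\<close>, so equations between
    arrows into \<open>FObj F (G0 b)\<close> may be tested after composition with
    \<open>e b\<close>, where \<open>eT\<close> eliminates \<open>T\<close>.\<close>
  have uniq: "x = y" if x: "x \<in> Hom D z (FObj F (G0 b))" "y \<in> Hom D z (FObj F (G0 b))" "b \<in> Obj D"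
    "Cmp D (e b) x = Cmp D (e b) y" for x y z b
    using D.comp_assoc_hom[OF x(1) e[OF x(3)] i[OF x(3)]] D.comp_assoc_hom[OF x(2) e[OF x(3)] i[OF x(3)]]
      ie[OF x(3)] x HomD[OF x(1)] HomD[OF x(2)] by auto
  have GF: "is_functor D C G" unfolding is_functor_def
  proof (intro conjI ballI impI)
    fix a assume a: "a \<in> Obj D"
    then show "FObj G a \<in> Obj C" using G0 by (simp add: G_def)
    have "T (Idt D a) = Idt D (FObj F (G0 a))"
      by (rule uniq[OF T[OF D.id_hom[OF a]] _ a]) (use a G0 F_obj e eT[OF D.id_hom[OF a]] HomD[OF e[OF a]] in auto)
    then have "FArr F (G1 (Idt D a)) = FArr F (Idt C (G0 a))"
      using FG1[OF D.id_hom[OF a]] F_id[OF G0[OF a]] by simp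
    then show "FArr G (Idt D a) = Idt C (FObj G a)"
      using faithful[OF G1[OF D.id_hom[OF a]] C.id_hom[OF G0[OF a]]] by (simp add: G_def)
  next
    fix h assume "h \<in> Arr D"
    then show "FArr G h \<in> Hom C (FObj G (Dom D h)) (FObj G (Cod D h))"
      using G1[OF HomI] by (simp add: G_def)
  next
    fix f g assume "f \<in> Arr D" "g \<in> Arr D" "Cod D f = Dom D g"
    then obtain a b c where f: "f \<in> Hom D a b" and g: "g \<in> Hom D b c" by (auto simp: Hom_def)
    note gf = D.comp_hom[OF f g]
    have o: "a \<in> Obj D" "b \<in> Obj D" "c \<in> Obj D" using f g by (auto simp: Hom_def)
    have "T (Cmp D g f) = Cmp D (T g) (T f)"
    proof (rule uniq[OF T[OF gf] D.comp_hom[OF T[OF f] T[OF g]] o(3)])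
      show "Cmp D (e c) (T (Cmp D g f)) = Cmp D (e c) (Cmp D (T g) (T f))"
        using eT[OF gf] eT[OF g] eT[OF f] D.comp_assoc_hom[OF T[OF f] T[OF g] e[OF o(3)]]
          D.comp_assoc_hom[OF T[OF f] e[OF o(2)] g] D.comp_assoc_hom[OF e[OF o(1)] f g] by simp
    qed
    then have "FArr F (G1 (Cmp D g f)) = FArr F (Cmp C (G1 g) (G1 f))"
      using FG1[OF gf] FG1[OF f] FG1[OF g] F_comp[OF G1[OF f] G1[OF g]] by simp
    then show "FArr G (Cmp D g f) = Cmp C (FArr G g) (FArr G f)"
      using faithful[OF G1[OF gf] C.comp_hom[OF G1[OF f] G1[OF g]]] by (simp add: G_def)
  qed
  have n2: "naturally_isomorphic D D (comp_fctr F G) id_fctr"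
    unfolding naturally_isomorphic_def is_nat_trans_def
    by (rule exI[of _ e]) (use e e_iso eT[OF HomI] FG1[OF HomI] in \<open>auto simp: comp_fctr_def id_fctr_def G_def\<close>)
  \<comment> \<open>The unit at \<open>a\<close> is found as a preimage of the inverse of
    \<open>e (FObj F a)\<close>.\<close>
  have "\<forall>a. \<exists>f. a \<in> Obj C \<longrightarrow> f \<in> Hom C a (G0 (FObj F a)) \<and> FArr F f = i (FObj F a)"
    using full[OF _ G0[OF F_obj] i[OF F_obj]] by blast
  then obtain n where "\<And>a. a \<in> Obj C \<Longrightarrow> n a \<in> Hom C a (G0 (FObj F a)) \<and> FArr F (n a) = i (FObj F a)"
    by metis
  then have n: "\<And>a. a \<in> Obj C \<Longrightarrow> n a \<in> Hom C a (G0 (FObj F a))"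
    and Fn: "\<And>a. a \<in> Obj C \<Longrightarrow> FArr F (n a) = i (FObj F a)" by auto
  have nat: "Cmp C (n b) f = Cmp C (G1 (FArr F f)) (n a)" if f: "f \<in> Hom C a b" for f a b
  proof -
    have o: "a \<in> Obj C" "b \<in> Obj C" using f by (auto simp: Hom_def)
    note o' = F_obj[OF o(1)] F_obj[OF o(2)]
    note Ff = F_hom[OF f]
    show ?thesis
    proof (rule faithful[OF C.comp_hom[OF f n[OF o(2)]] C.comp_hom[OF n[OF o(1)] G1[OF Ff]]])
      have "Cmp D (i (FObj F b)) (FArr F f) = Cmp D (T (FArr F f)) (i (FObj F a))"
      proof (rule uniq[OF D.comp_hom[OF Ff i[OF o'(2)]] D.comp_hom[OF i[OF o'(1)] T[OF Ff]] o'(2)])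
        show "Cmp D (e (FObj F b)) (Cmp D (i (FObj F b)) (FArr F f)) =
          Cmp D (e (FObj F b)) (Cmp D (T (FArr F f)) (i (FObj F a)))"
          using D.comp_assoc_hom[OF Ff i[OF o'(2)] e[OF o'(2)]] ei[OF o'(2)] HomD[OF Ff]
            D.comp_assoc_hom[OF i[OF o'(1)] T[OF Ff] e[OF o'(2)]] eT[OF Ff]
            D.comp_assoc_hom[OF i[OF o'(1)] e[OF o'(1)] Ff] ei[OF o'(1)] by simp
      qed
      then show "FArr F (Cmp C (n b) f) = FArr F (Cmp C (G1 (FArr F f)) (n a))"
        using F_comp[OF f n[OF o(2)]] F_comp[OF n[OF o(1)] G1[OF Ff]] Fn o FG1[OF Ff] by simp
    qed
  qed
  \<comment> \<open>The inverse is a preimage of \<open>e (FObj F a)\<close> itself; both composites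
    are identities because \<open>F\<close> is faithful.\<close>
  have n_iso: "is_iso C (n a)" if a: "a \<in> Obj C" for a
  proof -
    note Fa = F_obj[OF a]
    obtain m where m: "m \<in> Hom C (G0 (FObj F a)) a" "FArr F m = e (FObj F a)"
      using full[OF G0[OF Fa] a e[OF Fa]] by blast
    have "Cmp C m (n a) = Idt C a"
      by (rule faithful[OF C.comp_hom[OF n[OF a] m(1)] C.id_hom[OF a]])
        (use F_comp[OF n[OF a] m(1)] F_id[OF a] Fn[OF a] m(2) ei[OF Fa] in simp)
    moreover have "Cmp C (n a) m = Idt C (G0 (FObj F a))"
      by (rule faithful[OF C.comp_hom[OF m(1) n[OF a]] C.id_hom[OF G0[OF Fa]]])
        (use F_comp[OF m(1) n[OF a]] F_id[OF G0[OF Fa]] Fn[OF a] m(2) ie[OF Fa] in simp)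
    ultimately show ?thesis by (rule C.is_isoI[OF n[OF a] m(1)])
  qed
  have n1: "naturally_isomorphic C C id_fctr (comp_fctr G F)"
    unfolding naturally_isomorphic_def is_nat_trans_def
    by (rule exI[of _ n]) (use n n_iso nat[OF HomI] in \<open>auto simp: comp_fctr_def id_fctr_def G_def\<close>)
  show ?thesis unfolding equivalent_categories_def using C D F GF n1 n2 by blast
qed

section \<open>Frames\<close>

context complete_lattice
begin

lemma Sup_eqI:
  assumes "A \<subseteq> carrier L" "s \<in> carrier L" "\<And>x. x \<in> A \<Longrightarrow> x \<sqsubseteq> s"
    and "\<And>u. u \<in> carrier L \<Longrightarrow> (\<And>x. x \<in> A \<Longrightarrow> x \<sqsubseteq> u) \<Longrightarrow> s \<sqsubseteq> u"
  shows "\<Squnion>A = s"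
  using assms by (intro le_antisym sup_least assms(4)[OF sup_closed sup_upper]) auto

lemma meet_eqI:
  assumes "a \<in> carrier L" "b \<in> carrier L" "m \<in> carrier L" "m \<sqsubseteq> a" "m \<sqsubseteq> b"
    and "\<And>x. x \<in> carrier L \<Longrightarrow> x \<sqsubseteq> a \<Longrightarrow> x \<sqsubseteq> b \<Longrightarrow> x \<sqsubseteq> m"
  shows "a \<sqinter> b = m"
  using assms by (intro le_antisym) (auto intro!: meet_le simp: meet_left meet_right)

lemma join_eqI:
  assumes "a \<in> carrier L" "b \<in> carrier L" "j \<in> carrier L" "a \<sqsubseteq> j" "b \<sqsubseteq> j"
    and "\<And>x. x \<in> carrier L \<Longrightarrow> a \<sqsubseteq> x \<Longrightarrow> b \<sqsubseteq> x \<Longrightarrow> j \<sqsubseteq> x"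
  shows "a \<squnion> b = j"
  using assms by (intro le_antisym) (auto intro!: join_le simp: join_left join_right)

lemma top_eqI: "t \<in> carrier L \<Longrightarrow> (\<And>x. x \<in> carrier L \<Longrightarrow> x \<sqsubseteq> t) \<Longrightarrow> \<top> = t"
  by (intro le_antisym) auto

lemma bottom_eqI: "b \<in> carrier L \<Longrightarrow> (\<And>x. x \<in> carrier L \<Longrightarrow> b \<sqsubseteq> x) \<Longrightarrow> \<bottom> = b"
  by (intro le_antisym) auto

lemma top_le: "t \<in> carrier L \<Longrightarrow> \<top> \<sqsubseteq> t \<Longrightarrow> t = \<top>"
  by (intro le_antisym) auto

lemma le_bottom: "t \<in> carrier L \<Longrightarrow> t \<sqsubseteq> \<bottom> \<Longrightarrow> t = \<bottom>"
  by (intro le_antisym) auto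

lemma Sup_empty: "\<Squnion>{} = \<bottom>"
  by (rule Sup_eqI) auto

lemma le_meet_eq: "a \<in> carrier L \<Longrightarrow> b \<in> carrier L \<Longrightarrow> a \<sqsubseteq> b \<Longrightarrow> a \<sqinter> b = a"
  by (rule meet_eqI) auto

lemma le_join_eq: "a \<in> carrier L \<Longrightarrow> b \<in> carrier L \<Longrightarrow> a \<sqsubseteq> b \<Longrightarrow> a \<squnion> b = b"
  by (rule join_eqI) auto

lemma join_mono:
  assumes "a \<in> carrier L" "b \<in> carrier L" "a' \<in> carrier L" "b' \<in> carrier L" "a \<sqsubseteq> a'" "b \<sqsubseteq> b'"
  shows "a \<squnion> b \<sqsubseteq> a' \<squnion> b'"
proof (rule join_le)
  show "a \<sqsubseteq> a' \<squnion> b'" by (rule le_trans[of _ a']) (use assms in \<open>auto simp: join_left\<close>)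
  show "b \<sqsubseteq> a' \<squnion> b'" by (rule le_trans[of _ b']) (use assms in \<open>auto simp: join_right\<close>)
qed (use assms in auto)

lemma meet_mono:
  assumes "a \<in> carrier L" "b \<in> carrier L" "a' \<in> carrier L" "b' \<in> carrier L" "a \<sqsubseteq> a'" "b \<sqsubseteq> b'"
  shows "a \<sqinter> b \<sqsubseteq> a' \<sqinter> b'"
proof (rule meet_le)
  show "a \<sqinter> b \<sqsubseteq> a'" by (rule le_trans[of _ a]) (use assms in \<open>auto simp: meet_left\<close>)
  show "a \<sqinter> b \<sqsubseteq> b'" by (rule le_trans[of _ b]) (use assms in \<open>auto simp: meet_right\<close>)
qed (use assms in auto)

lemma Sup_mono:
  assumes "A \<subseteq> carrier L" "B \<subseteq> carrier L" "\<And>x. x \<in> A \<Longrightarrow> \<exists>y\<in>B. x \<sqsubseteq> y"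
  shows "\<Squnion>A \<sqsubseteq> \<Squnion>B"
proof (rule sup_least[OF assms(1)])
  fix x assume "x \<in> A"
  then obtain y where y: "y \<in> B" "x \<sqsubseteq> y" using assms(3) by blast
  show "x \<sqsubseteq> \<Squnion>B"
    by (rule le_trans[OF y(2) sup_upper[OF assms(2) y(1)]]) (use assms \<open>x \<in> A\<close> y in auto)
qed (use assms in auto)

end

text \<open>Infima come as suprema of the sets of lower bounds.\<close>

lemma complete_latticeI_Sup:
  assumes "partial_order L"
    and lub: "\<And>A. A \<subseteq> carrier L \<Longrightarrow> \<exists>s\<in>carrier L. (\<forall>x\<in>A. x \<sqsubseteq>\<^bsub>L\<^esub> s) \<and>
           (\<forall>u\<in>carrier L. (\<forall>x\<in>A. x \<sqsubseteq>\<^bsub>L\<^esub> u) \<longrightarrow> s \<sqsubseteq>\<^bsub>L\<^esub> u)"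
  shows "complete_lattice L"
proof -
  interpret partial_order L by fact
  show ?thesis
  proof (rule complete_latticeI)
    fix A assume A: "A \<subseteq> carrier L"
    then show "\<exists>s. least L s (Upper L A)"
      using lub[OF A] by (force simp: least_def Upper_def)
    obtain s where "s\<in>carrier L" "\<forall>x\<in>Lower L A. x \<sqsubseteq>\<^bsub>L\<^esub> s"
           "\<forall>u\<in>carrier L. (\<forall>x\<in>Lower L A. x \<sqsubseteq>\<^bsub>L\<^esub> u) \<longrightarrow> s \<sqsubseteq>\<^bsub>L\<^esub> u"
      using lub[of "Lower L A"] by auto
    then show "\<exists>i. greatest L i (Lower L A)"
      using A by (intro exI[of _ s]) (auto simp: greatest_def Lower_def)
  qed
qed

locale frm = complete_lattice L for L :: "'u gorder" (structure) +
  assumes frame_distrib: "a \<in> carrier L \<Longrightarrow> A \<subseteq> carrier L \<Longrightarrow> a \<sqinter> \<Squnion>A = \<Squnion>((\<lambda>x. a \<sqinter> x) ` A)"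

lemma is_frame_iff: "is_frame L \<longleftrightarrow> frm L"
  by (auto simp: is_frame_def frm_def frm_axioms_def)

section \<open>Distributivity and the well-inside relation\<close>

context frm
begin

lemma meet_join_distrib:
  assumes "a \<in> carrier L" "b \<in> carrier L" "c \<in> carrier L"
  shows "a \<sqinter> (b \<squnion> c) = (a \<sqinter> b) \<squnion> (a \<sqinter> c)"
  using frame_distrib[of a "{b, c}"] assms by (simp add: join_def)

text \<open>Distributing \<open>x\<close> over \<open>u \<squnion> w\<close> kills the second term.
  This cancellation is used below with a \<open>u\<close> other than the element for which the
  complement \<open>w\<close> was found: any \<open>u\<close> that still covers together with
  \<open>w\<close> will do.\<close>

lemma le_if_meet_bottom_join_top:
  assumes "x \<in> carrier L" "u \<in> carrier L" "w \<in> carrier L" "x \<sqinter> w = \<bottom>" "u \<squnion> w = \<top>"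
  shows "x \<sqsubseteq> u"
proof -
  have "x = x \<sqinter> (u \<squnion> w)" using assms le_meet_eq by simp
  also have "\<dots> = (x \<sqinter> u) \<squnion> \<bottom>" using assms meet_join_distrib[of x u w] by simp
  also have "\<dots> \<sqsubseteq> u" using assms by (intro join_le) (auto simp: meet_right)
  finally show ?thesis .
qed

text \<open>An instance of the dual distributive law, obtained by meeting \<open>x'\<close> with
  \<open>x \<squnion> y = \<top>\<close>.\<close>

lemma meet_join_top:
  assumes c: "x \<in> carrier L" "x' \<in> carrier L" "y \<in> carrier L" and "x \<squnion> y = \<top>" "x' \<squnion> y = \<top>"
  shows "(x \<sqinter> x') \<squnion> y = \<top>"
proof -
  have "x' = x' \<sqinter> (x \<squnion> y)" using assms le_meet_eq by simp
  also have "\<dots> = (x' \<sqinter> x) \<squnion> (x' \<sqinter> y)" using c meet_join_distrib by simp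
  also have "\<dots> \<sqsubseteq> (x \<sqinter> x') \<squnion> y"
    using c by (intro join_mono) (auto simp: meet_right meet_comm)
  finally have "x' \<squnion> y \<sqsubseteq> (x \<sqinter> x') \<squnion> y" using c by (intro join_le) (auto simp: join_right)
  then show ?thesis using assms by (intro top_le) auto
qed

lemma meet_join_bottom:
  assumes "a \<in> carrier L" "b \<in> carrier L" "c \<in> carrier L" "a \<sqinter> b = \<bottom>" "a \<sqinter> c = \<bottom>"
  shows "a \<sqinter> (b \<squnion> c) = \<bottom>"
  using assms le_join_eq[of \<bottom> \<bottom>] by (simp add: meet_join_distrib)

lemma meet_bottom_mono:
  assumes "a \<in> carrier L" "b \<in> carrier L" "a' \<in> carrier L" "b' \<in> carrier L" "a \<sqsubseteq> a'" "b \<sqsubseteq> b'"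
    and "a' \<sqinter> b' = \<bottom>"
  shows "a \<sqinter> b = \<bottom>"
  using meet_mono[OF assms(1-6)] assms by (intro le_bottom) auto

lemma join_top_mono:
  assumes "a \<in> carrier L" "b \<in> carrier L" "a' \<in> carrier L" "b' \<in> carrier L" "a \<sqsubseteq> a'" "b \<sqsubseteq> b'"
    and "a \<squnion> b = \<top>"
  shows "a' \<squnion> b' = \<top>"
  using join_mono[OF assms(1-6)] assms by (intro top_le) auto

lemma well_insideI:
  "c \<in> carrier L \<Longrightarrow> a \<sqinter> c = \<bottom> \<Longrightarrow> b \<squnion> c = \<top> \<Longrightarrow> well_inside L a b"
  by (auto simp: well_inside_def)

lemma well_insideE:
  assumes "well_inside L a b"
  obtains c where "c \<in> carrier L" "a \<sqinter> c = \<bottom>" "b \<squnion> c = \<top>"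
  using assms by (auto simp: well_inside_def)

lemma well_inside_le: "a \<in> carrier L \<Longrightarrow> b \<in> carrier L \<Longrightarrow> well_inside L a b \<Longrightarrow> a \<sqsubseteq> b"
  by (auto simp: well_inside_def intro: le_if_meet_bottom_join_top)

lemma well_inside_mono:
  assumes "a' \<in> carrier L" "a \<in> carrier L" "b \<in> carrier L" "b' \<in> carrier L"
    and "a' \<sqsubseteq> a" "b \<sqsubseteq> b'" "well_inside L a b"
  shows "well_inside L a' b'"
proof -
  obtain c where c: "c \<in> carrier L" "a \<sqinter> c = \<bottom>" "b \<squnion> c = \<top>" by (rule well_insideE[OF assms(7)])
  show ?thesis
    using meet_bottom_mono[of a' c a c] join_top_mono[of b c b' c] c assms by (auto intro: well_insideI)
qed

lemma well_inside_meet: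
  assumes "a \<in> carrier L" "b \<in> carrier L" "a' \<in> carrier L" "b' \<in> carrier L"
    and "well_inside L a b" "well_inside L a' b'"
  shows "well_inside L (a \<sqinter> a') (b \<sqinter> b')"
proof -
  obtain c where c: "c \<in> carrier L" "a \<sqinter> c = \<bottom>" "b \<squnion> c = \<top>" by (rule well_insideE[OF assms(5)])
  obtain d where d: "d \<in> carrier L" "a' \<sqinter> d = \<bottom>" "b' \<squnion> d = \<top>" by (rule well_insideE[OF assms(6)])
  show ?thesis
  proof (rule well_insideI[of "c \<squnion> d"])
    show "(a \<sqinter> a') \<sqinter> (c \<squnion> d) = \<bottom>"
      using meet_bottom_mono[of "a \<sqinter> a'" c a c] meet_bottom_mono[of "a \<sqinter> a'" d a' d] c d assms
      by (intro meet_join_bottom) (auto simp: meet_left meet_right)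
    show "(b \<sqinter> b') \<squnion> (c \<squnion> d) = \<top>"
      using join_top_mono[of b c b "c \<squnion> d"] join_top_mono[of b' d b' "c \<squnion> d"] c d assms
      by (intro meet_join_top) (auto simp: join_left join_right)
  qed (use c d in auto)
qed

text \<open>The two complements are met. Together with \<open>well_inside_bottom\<close> this makes
  the elements well inside \<open>b\<close> a directed set, as compactness arguments
  require.\<close>

lemma well_inside_join:
  assumes "a \<in> carrier L" "b \<in> carrier L" "a' \<in> carrier L"
    and "well_inside L a b" "well_inside L a' b"
  shows "well_inside L (a \<squnion> a') b"
proof -
  obtain c where c: "c \<in> carrier L" "a \<sqinter> c = \<bottom>" "b \<squnion> c = \<top>" by (rule well_insideE[OF assms(4)])
  obtain d where d: "d \<in> carrier L" "a' \<sqinter> d = \<bottom>" "b \<squnion> d = \<top>" by (rule well_insideE[OF assms(5)])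
  show ?thesis
  proof (rule well_insideI[of "c \<sqinter> d"])
    have "(c \<sqinter> d) \<sqinter> (a \<squnion> a') = \<bottom>"
      using meet_bottom_mono[of "c \<sqinter> d" a c a] meet_bottom_mono[of "c \<sqinter> d" a' d a'] c d assms
      by (intro meet_join_bottom) (auto simp: meet_left meet_right meet_comm[of L])
    then show "(a \<squnion> a') \<sqinter> (c \<sqinter> d) = \<bottom>" by (simp add: meet_comm[of L])
    show "b \<squnion> (c \<sqinter> d) = \<top>"
      using meet_join_top[of c d b] c d assms by (simp add: join_comm[of L])
  qed (use c d in auto)
qed

lemma well_inside_bottom: "b \<in> carrier L \<Longrightarrow> well_inside L \<bottom> b"
  by (rule well_insideI[of \<top>]) (auto simp: le_meet_eq le_join_eq)

lemma well_inside_top: "well_inside L \<top> \<top>"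
  by (rule well_insideI[of \<bottom>]) (auto simp: le_meet_eq le_join_eq meet_comm[of L] join_comm[of L])

end

section \<open>Regular elements of a frame\<close>

definition reg_interior :: "'u gorder \<Rightarrow> 'u \<Rightarrow> 'u" where
  "reg_interior L u = \<Squnion>\<^bsub>L\<^esub> {v \<in> carrier L. well_inside L v u}"

text \<open>In any frame these fixed points are closed under arbitrary joins and finite meets, so
  they form a subframe. That interiors are themselves fixed points, and that the subframe is
  regular, is derived from normality.\<close>

definition regs :: "'u gorder \<Rightarrow> 'u set" where
  "regs L = {u \<in> carrier L. reg_interior L u = u}"

definition reg_part :: "'u gorder \<Rightarrow> 'u gorder" where
  "reg_part L = L\<lparr>carrier := regs L\<rparr>"

lemma reg_part_simps [simp]:
  "carrier (reg_part L) = regs L" "x \<sqsubseteq>\<^bsub>reg_part L\<^esub> y \<longleftrightarrow> x \<sqsubseteq>\<^bsub>L\<^esub> y" "eq (reg_part L) = eq L"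
  by (simp_all add: reg_part_def)

lemma regs_subset: "regs L \<subseteq> carrier L"
  by (auto simp: regs_def)

lemma regs_carrier: "u \<in> regs L \<Longrightarrow> u \<in> carrier L"
  by (simp add: regs_def)

lemma regular_frame_iff: "regular_frame L \<longleftrightarrow> (\<forall>b\<in>carrier L. reg_interior L b = b)"
  by (auto simp: regular_frame_def reg_interior_def)

context frm
begin

lemma reg_interior_closed [simp]: "reg_interior L u \<in> carrier L"
  by (auto simp: reg_interior_def)

lemma reg_interior_le: "u \<in> carrier L \<Longrightarrow> reg_interior L u \<sqsubseteq> u"
  by (auto simp: reg_interior_def well_inside_le intro!: sup_least)

lemma le_reg_interior: "v \<in> carrier L \<Longrightarrow> well_inside L v u \<Longrightarrow> v \<sqsubseteq> reg_interior L u"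
  by (auto simp: reg_interior_def intro!: sup_upper)

lemma reg_interior_mono:
  assumes "u \<in> carrier L" "u' \<in> carrier L" "u \<sqsubseteq> u'"
  shows "reg_interior L u \<sqsubseteq> reg_interior L u'"
  unfolding reg_interior_def
  by (rule Sup_mono) (use assms in \<open>auto intro: well_inside_mono[OF _ _ assms(1,2) _ assms(3)]\<close>)

lemma regsI:
  assumes "u \<in> carrier L" "u \<sqsubseteq> reg_interior L u"
  shows "u \<in> regs L"
  using assms reg_interior_le le_antisym[of "reg_interior L u" u] by (simp add: regs_def)

lemma reg_interior_regs: "u \<in> regs L \<Longrightarrow> reg_interior L u = u"
  by (simp add: regs_def)

text \<open>The meet of the two defining joins distributes into a join of binary meets, each of them
  well inside \<open>a \<sqinter> b\<close> by \<open>well_inside_meet\<close>.\<close>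

lemma reg_interior_meet:
  assumes "a \<in> carrier L" "b \<in> carrier L"
  shows "reg_interior L (a \<sqinter> b) = reg_interior L a \<sqinter> reg_interior L b"
proof (rule le_antisym)
  show "reg_interior L (a \<sqinter> b) \<sqsubseteq> reg_interior L a \<sqinter> reg_interior L b"
    using assms by (intro meet_le reg_interior_mono) (auto simp: meet_left meet_right)
  have "reg_interior L a \<sqinter> v \<sqsubseteq> reg_interior L (a \<sqinter> b)" if v: "v \<in> carrier L" "well_inside L v b" for v
  proof -
    have "v \<sqinter> reg_interior L a \<sqsubseteq> reg_interior L (a \<sqinter> b)"
      unfolding reg_interior_def[of L a]
    proof (subst frame_distrib)
      show "\<Squnion>((\<lambda>x. v \<sqinter> x) ` {u \<in> carrier L. well_inside L u a}) \<sqsubseteq> reg_interior L (a \<sqinter> b)"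
        by (rule sup_least)
          (use assms v in \<open>auto intro!: le_reg_interior well_inside_meet simp: meet_comm[of L v]\<close>)
    qed (use v in auto)
    then show ?thesis by (simp add: meet_comm)
  qed
  then show "reg_interior L a \<sqinter> reg_interior L b \<sqsubseteq> reg_interior L (a \<sqinter> b)"
    unfolding reg_interior_def[of L b] by (subst frame_distrib) (auto intro!: sup_least)
qed (use assms in auto)

lemma Sup_regs:
  assumes "A \<subseteq> regs L"
  shows "\<Squnion>A \<in> regs L"
proof (rule regsI)
  have A: "A \<subseteq> carrier L" using assms regs_subset by (rule subset_trans)
  then show "\<Squnion>A \<in> carrier L" by simp
  have "x \<sqsubseteq> reg_interior L (\<Squnion>A)" if "x \<in> A" for x
    using reg_interior_mono[of x "\<Squnion>A"] reg_interior_regs[of x] sup_upper[OF A that]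
      subsetD[OF A that] subsetD[OF assms that] A by simp
  then show "\<Squnion>A \<sqsubseteq> reg_interior L (\<Squnion>A)" using A by (auto intro: sup_least)
qed

lemma meet_regs: "a \<in> regs L \<Longrightarrow> b \<in> regs L \<Longrightarrow> a \<sqinter> b \<in> regs L"
  by (auto simp: regs_def reg_interior_meet)

lemma top_regs: "\<top> \<in> regs L"
  using le_reg_interior[OF _ well_inside_top] by (auto intro: regsI)

lemma bottom_regs: "\<bottom> \<in> regs L"
  by (auto intro: regsI)

lemma complete_lattice_reg_part: "complete_lattice (reg_part L)"
proof (rule complete_latticeI_Sup)
  show "partial_order (reg_part L)"
    by standard (auto dest!: regs_carrier simp: eq_is_equal intro: le_antisym elim: le_trans)
next
  fix A assume "A \<subseteq> carrier (reg_part L)"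
  then have A: "A \<subseteq> regs L" "A \<subseteq> carrier L" using regs_subset[of L] by auto
  show "\<exists>s\<in>carrier (reg_part L). (\<forall>x\<in>A. x \<sqsubseteq>\<^bsub>reg_part L\<^esub> s) \<and>
           (\<forall>u\<in>carrier (reg_part L). (\<forall>x\<in>A. x \<sqsubseteq>\<^bsub>reg_part L\<^esub> u) \<longrightarrow> s \<sqsubseteq>\<^bsub>reg_part L\<^esub> u)"
    by (rule bexI[of _ "\<Squnion>A"])
      (use A Sup_regs[OF A(1)] in \<open>auto dest: regs_carrier intro!: sup_upper sup_least\<close>)
qed

interpretation R: complete_lattice "reg_part L"
  by (rule complete_lattice_reg_part)

text \<open>\<open>regs L\<close> is closed under the joins of \<open>L\<close>, so these are also
  the joins of the smaller poset. The same argument for finite meets lets the frame law and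
  compactness pass to \<open>reg_part L\<close>.\<close>

lemma Sup_reg_part: "A \<subseteq> regs L \<Longrightarrow> \<Squnion>\<^bsub>reg_part L\<^esub> A = \<Squnion>A"
  by (rule R.Sup_eqI) (use Sup_regs[of A] regs_subset[of L] in \<open>auto intro!: sup_upper sup_least\<close>)

lemma meet_reg_part: "a \<in> regs L \<Longrightarrow> b \<in> regs L \<Longrightarrow> a \<sqinter>\<^bsub>reg_part L\<^esub> b = a \<sqinter> b"
  by (rule R.meet_eqI)
    (use meet_regs regs_carrier[of _ L] in \<open>auto intro!: meet_le simp: meet_left meet_right\<close>)

lemma join_reg_part: "a \<in> regs L \<Longrightarrow> b \<in> regs L \<Longrightarrow> a \<squnion>\<^bsub>reg_part L\<^esub> b = a \<squnion> b"
  by (simp add: join_def Sup_reg_part)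

lemma top_reg_part: "\<top>\<^bsub>reg_part L\<^esub> = \<top>"
  by (rule R.top_eqI) (use top_regs regs_carrier[of _ L] in auto)

lemma bottom_reg_part: "\<bottom>\<^bsub>reg_part L\<^esub> = \<bottom>"
  by (rule R.bottom_eqI) (use bottom_regs regs_carrier[of _ L] in auto)

lemma frm_reg_part: "frm (reg_part L)"
proof -
  have "a \<sqinter>\<^bsub>reg_part L\<^esub> \<Squnion>\<^bsub>reg_part L\<^esub> A = \<Squnion>\<^bsub>reg_part L\<^esub> ((\<lambda>x. a \<sqinter>\<^bsub>reg_part L\<^esub> x) ` A)"
    if "a \<in> regs L" "A \<subseteq> regs L" for a A
  proof -
    have *: "(\<lambda>x. a \<sqinter>\<^bsub>reg_part L\<^esub> x) ` A = (\<lambda>x. a \<sqinter> x) ` A"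
      using that meet_reg_part by (intro image_cong) auto
    have c: "a \<in> carrier L" "A \<subseteq> carrier L" using that regs_subset[of L] by auto
    have "(\<lambda>x. a \<sqinter> x) ` A \<subseteq> regs L" using that meet_regs by blast
    then show ?thesis unfolding * using that
      by (simp add: Sup_reg_part meet_reg_part Sup_regs frame_distrib[OF c])
  qed
  then show ?thesis by unfold_locales auto
qed

lemma compact_frame_reg_part:
  assumes "compact_frame L"
  shows "compact_frame (reg_part L)"
  unfolding compact_frame_def
proof (intro allI impI)
  fix A assume A: "A \<subseteq> carrier (reg_part L)" "directed_in (reg_part L) A"
    "\<Squnion>\<^bsub>reg_part L\<^esub> A = \<top>\<^bsub>reg_part L\<^esub>"
  then have "A \<subseteq> carrier L" "directed_in L A" "\<Squnion>A = \<top>"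
    using regs_subset[of L] by (auto simp: directed_in_def Sup_reg_part top_reg_part)
  then show "\<top>\<^bsub>reg_part L\<^esub> \<in> A" using assms by (simp add: compact_frame_def top_reg_part)
qed

end

text \<open>Normality is what regularity of an internal frame leaves behind at each stage.\<close>

locale normal_frm = frm +
  assumes normal: "u \<in> carrier L \<Longrightarrow> w \<in> carrier L \<Longrightarrow> u \<squnion> w = \<top> \<Longrightarrow>
    \<exists>v\<in>carrier L. well_inside L v u \<and> v \<squnion> w = \<top>"
begin

text \<open>The complement \<open>w\<close> that witnesses \<open>v\<close> well inside
  \<open>u\<close> covers together with \<open>u\<close>. Normality for this pair yields a
  \<open>v'\<close> that still covers together with \<open>w\<close>, and then the same
  \<open>w\<close> witnesses \<open>v\<close> well inside \<open>v'\<close>.\<close>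

lemma interpolate:
  assumes "v \<in> carrier L" "u \<in> carrier L" "well_inside L v u"
  obtains v' where "v' \<in> carrier L" "well_inside L v v'" "well_inside L v' u"
proof -
  obtain w where w: "w \<in> carrier L" "v \<sqinter> w = \<bottom>" "u \<squnion> w = \<top>" by (rule well_insideE[OF assms(3)])
  then obtain v' where "v' \<in> carrier L" "well_inside L v' u" "v' \<squnion> w = \<top>"
    using normal[OF assms(2)] by blast
  then show ?thesis using that well_insideI w by blast
qed

text \<open>An interpolant between \<open>v\<close> and \<open>u\<close> lies below the interior of
  \<open>u\<close>, so \<open>v\<close> is well inside that interior and not only well inside
  \<open>u\<close>.\<close>

lemma reg_interior_in_regs:
  assumes "u \<in> carrier L"
  shows "reg_interior L u \<in> regs L"
proof (rule regsI)
  have "v \<sqsubseteq> reg_interior L (reg_interior L u)" if v: "v \<in> carrier L" "well_inside L v u" for v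
  proof -
    obtain v' where v': "v' \<in> carrier L" "well_inside L v v'" "well_inside L v' u"
      using interpolate[OF v(1) assms v(2)] by blast
    have "v' \<sqsubseteq> reg_interior L u" by (rule le_reg_interior[OF v'(1,3)])
    then have "well_inside L v (reg_interior L u)"
      using well_inside_mono[of v v v' "reg_interior L u"] v v' by auto
    then show ?thesis by (rule le_reg_interior[OF v(1)])
  qed
  then show "reg_interior L u \<sqsubseteq> reg_interior L (reg_interior L u)"
    unfolding reg_interior_def[of L u] by (intro sup_least) auto
qed auto

text \<open>The well-inside relation of \<open>reg_part L\<close> asks for a complement in
  \<open>regs L\<close>. Interpolation makes room to replace both the approximant \<open>v'\<close>
  and its complement \<open>w\<close> by their interiors.\<close>

lemma regular_frame_reg_part: "regular_frame (reg_part L)"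
  unfolding regular_frame_iff
proof
  fix u assume "u \<in> carrier (reg_part L)"
  then have u: "u \<in> regs L" "u \<in> carrier L" using regs_carrier[of u] by auto
  let ?A = "{v \<in> regs L. well_inside (reg_part L) v u}"
  have A: "?A \<subseteq> carrier L" using regs_carrier[of _ L] by auto
  have "v \<sqsubseteq> \<Squnion>?A" if v: "v \<in> carrier L" "well_inside L v u" for v
  proof -
    obtain v' where v': "v' \<in> carrier L" "well_inside L v v'" "well_inside L v' u"
      using interpolate[OF v(1) u(2) v(2)] by blast
    obtain w where w: "w \<in> carrier L" "v' \<sqinter> w = \<bottom>" "u \<squnion> w = \<top>" by (rule well_insideE[OF v'(3)])
    have "w \<squnion> u = \<top>" using w(3) by (simp add: join_comm[of L])
    \<comment> \<open>The interior of \<open>w\<close> might be too small to cover together with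
      \<open>u\<close>; but a \<open>w'\<close> that is well inside \<open>w\<close> and still
      covers lies below that interior.\<close>
    from normal[OF w(1) u(2) this] obtain w' where w': "w' \<in> carrier L" "well_inside L w' w" "w' \<squnion> u = \<top>"
      by blast
    let ?v = "reg_interior L v'" and ?w = "reg_interior L w"
    have r: "?v \<in> regs L" "?w \<in> regs L" using v' w by (auto simp: reg_interior_in_regs)
    have "u \<squnion> w' = \<top>" using w'(3) by (simp add: join_comm[of L])
    then have "u \<squnion> ?w = \<top>"
      using join_top_mono[of u w' u ?w] le_reg_interior[OF w'(1,2)] u w' by auto
    moreover have "?v \<sqinter> ?w = \<bottom>"
      using meet_bottom_mono[of ?v ?w v' w] v' w by (auto simp: reg_interior_le)
    ultimately have "?v \<in> ?A"
      using r u by (auto simp: well_inside_def meet_reg_part join_reg_part top_reg_part bottom_reg_part)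
    then have "?v \<sqsubseteq> \<Squnion>?A" using A by (intro sup_upper) auto
    moreover have "v \<sqsubseteq> ?v" by (rule le_reg_interior[OF v(1) v'(2)])
    ultimately show ?thesis using le_trans[of v ?v "\<Squnion>?A"] v A by auto
  qed
  then have "reg_interior L u \<sqsubseteq> \<Squnion>?A"
    unfolding reg_interior_def using A by (intro sup_least) auto
  then have "u \<sqsubseteq> \<Squnion>?A" by (simp add: reg_interior_regs[OF u(1)])
  moreover have "\<Squnion>?A \<sqsubseteq> u"
    using A u frm.well_inside_le[OF frm_reg_part, of _ u] by (intro sup_least) auto
  ultimately show "reg_interior (reg_part L) u = u"
    using A u le_antisym[of "\<Squnion>?A" u] by (simp add: reg_interior_def Sup_reg_part)
qed

end

text \<open>Joins and finite meets are determined by the order, so isomorphisms in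
  \<open>kreg_frm\<close> can be checked on the order alone.\<close>

lemma order_iso_frame_hom:
  assumes "complete_lattice L" "complete_lattice M" and bij: "bij_betw h (carrier L) (carrier M)"
    and le: "\<And>x y. x \<in> carrier L \<Longrightarrow> y \<in> carrier L \<Longrightarrow> h x \<sqsubseteq>\<^bsub>M\<^esub> h y \<longleftrightarrow> x \<sqsubseteq>\<^bsub>L\<^esub> y"
  shows "frame_hom L M h"
proof -
  interpret L: complete_lattice L by fact
  interpret M: complete_lattice M by fact
  have h: "h x \<in> carrier M" if "x \<in> carrier L" for x using bij that by (auto simp: bij_betw_def)
  have hE: "\<exists>x\<in>carrier L. y = h x" if "y \<in> carrier M" for y using bij that by (auto simp: bij_betw_def)
  have "\<top>\<^bsub>M\<^esub> = h \<top>\<^bsub>L\<^esub>"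
    by (rule M.top_eqI) (auto simp: h le dest!: hE)
  moreover have "h a \<sqinter>\<^bsub>M\<^esub> h b = h (a \<sqinter>\<^bsub>L\<^esub> b)" if "a \<in> carrier L" "b \<in> carrier L" for a b
    by (rule M.meet_eqI) (use that in \<open>auto simp: h le L.meet_left L.meet_right dest!: hE intro!: L.meet_le\<close>)
  moreover have "\<Squnion>\<^bsub>M\<^esub> (h ` A) = h (\<Squnion>\<^bsub>L\<^esub> A)" if A: "A \<subseteq> carrier L" for A
  proof (rule M.Sup_eqI)
    fix u assume u: "u \<in> carrier M" "\<And>x. x \<in> h ` A \<Longrightarrow> x \<sqsubseteq>\<^bsub>M\<^esub> u"
    then obtain v where v: "v \<in> carrier L" "u = h v" using hE by blast
    then have "x \<sqsubseteq>\<^bsub>L\<^esub> v" if "x \<in> A" for x using u(2)[of "h x"] that A le by auto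
    then have "\<Squnion>\<^bsub>L\<^esub> A \<sqsubseteq>\<^bsub>L\<^esub> v" using A v by (auto intro: L.sup_least)
    then show "h (\<Squnion>\<^bsub>L\<^esub> A) \<sqsubseteq>\<^bsub>M\<^esub> u" using A v by (simp add: le)
  next
    fix y assume "y \<in> h ` A"
    then obtain x where x: "x \<in> A" "y = h x" by auto
    then show "y \<sqsubseteq>\<^bsub>M\<^esub> h (\<Squnion>\<^bsub>L\<^esub> A)" using A le[of x "\<Squnion>\<^bsub>L\<^esub> A"] L.sup_upper[OF A, of x] by auto
  qed (use A h in auto)
  ultimately show ?thesis unfolding frame_hom_def by simp
qed

section \<open>Frame homomorphisms and their action on regular elements\<close>

locale frm_hom = L: frm L + M: frm M for L M :: "'u gorder" +
  fixes h :: "'u \<Rightarrow> 'u"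
  assumes h: "x \<in> carrier L \<Longrightarrow> h x \<in> carrier M"
    and frame_hom: "frame_hom L M h"
begin

lemma h_top: "h \<top>\<^bsub>L\<^esub> = \<top>\<^bsub>M\<^esub>"
  and h_meet: "a \<in> carrier L \<Longrightarrow> b \<in> carrier L \<Longrightarrow> h (a \<sqinter>\<^bsub>L\<^esub> b) = h a \<sqinter>\<^bsub>M\<^esub> h b"
  and h_Sup: "A \<subseteq> carrier L \<Longrightarrow> h (\<Squnion>\<^bsub>L\<^esub> A) = \<Squnion>\<^bsub>M\<^esub> (h ` A)"
  using frame_hom by (auto simp: frame_hom_def)

lemma h_join: "a \<in> carrier L \<Longrightarrow> b \<in> carrier L \<Longrightarrow> h (a \<squnion>\<^bsub>L\<^esub> b) = h a \<squnion>\<^bsub>M\<^esub> h b"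
  by (simp add: join_def h_Sup)

lemma h_bottom: "h \<bottom>\<^bsub>L\<^esub> = \<bottom>\<^bsub>M\<^esub>"
  using h_Sup[of "{}"] by (simp add: L.Sup_empty M.Sup_empty)

lemma h_mono: "a \<in> carrier L \<Longrightarrow> b \<in> carrier L \<Longrightarrow> a \<sqsubseteq>\<^bsub>L\<^esub> b \<Longrightarrow> h a \<sqsubseteq>\<^bsub>M\<^esub> h b"
  using h_join[of a b] L.le_join_eq[of a b] M.join_left[of "h a" "h b"] h by simp

lemma h_well_inside:
  assumes "a \<in> carrier L" "b \<in> carrier L" "well_inside L a b"
  shows "well_inside M (h a) (h b)"
proof -
  obtain c where c: "c \<in> carrier L" "a \<sqinter>\<^bsub>L\<^esub> c = \<bottom>\<^bsub>L\<^esub>" "b \<squnion>\<^bsub>L\<^esub> c = \<top>\<^bsub>L\<^esub>"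
    by (rule L.well_insideE[OF assms(3)])
  show ?thesis
    using h_meet[of a c] h_join[of b c] c assms h_top h_bottom h by (auto intro: M.well_insideI[of "h c"])
qed

text \<open>Frame homomorphisms preserve joins and the well-inside relation. Applied to restriction
  maps and to the stages of an internal homomorphism, this makes the passage to regular elements
  functorial.\<close>

lemma h_regs:
  assumes "u \<in> regs L"
  shows "h u \<in> regs M"
proof (rule M.regsI)
  have u: "u \<in> carrier L" using assms by (rule regs_carrier)
  then show "h u \<in> carrier M" by (rule h)
  have "h u = h (reg_interior L u)" using assms by (simp add: L.reg_interior_regs)
  also have "\<dots> = \<Squnion>\<^bsub>M\<^esub> (h ` {v \<in> carrier L. well_inside L v u})"
    unfolding reg_interior_def by (rule h_Sup) auto
  also have "\<dots> \<sqsubseteq>\<^bsub>M\<^esub> reg_interior M (h u)"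
    by (rule M.sup_least) (auto intro!: M.le_reg_interior h_well_inside h u)
  finally show "h u \<sqsubseteq>\<^bsub>M\<^esub> reg_interior M (h u)" .
qed

lemma frame_hom_reg_part: "frame_hom (reg_part L) (reg_part M) (restrict h (regs L))"
proof -
  have "\<Squnion>\<^bsub>M\<^esub> (restrict h (regs L) ` A) = h (\<Squnion>\<^bsub>L\<^esub> A)" if "A \<subseteq> regs L" for A
  proof -
    have "restrict h (regs L) ` A = h ` A" using that by (intro image_cong) auto
    then show ?thesis using that regs_subset[of L] h_Sup[of A] by simp
  qed
  moreover have "restrict h (regs L) ` A \<subseteq> regs M" if "A \<subseteq> regs L" for A
    using that h_regs by auto
  ultimately show ?thesis
    unfolding frame_hom_def
    by (auto simp: L.Sup_reg_part M.Sup_reg_part L.meet_reg_part M.meet_reg_part L.top_reg_part M.top_reg_part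
        L.top_regs h_top h_meet h_regs L.meet_regs L.Sup_regs regs_carrier)
qed

end

lemma frame_hom_comp:
  assumes "frm L" "frm M" "frame_hom L M h" "frame_hom M N k" "h \<in> carrier L \<rightarrow> carrier M"
  shows "frame_hom L N (compose (carrier L) k h)"
proof -
  interpret L: frm L by fact
  interpret M: frm M by fact
  have "compose (carrier L) k h ` A = k ` h ` A" if "A \<subseteq> carrier L" for A
    unfolding image_image using that by (intro image_cong) (auto simp: compose_def)
  moreover have "h ` A \<subseteq> carrier M" if "A \<subseteq> carrier L" for A
    using that assms(5) by auto
  moreover have "h a \<in> carrier M" if "a \<in> carrier L" for a
    using that assms(5) by auto
  ultimately show ?thesis
    using assms(3,4) by (simp add: frame_hom_def compose_def)
qed

lemma frame_hom_id: "frm L \<Longrightarrow> frame_hom L L (\<lambda>x\<in>carrier L. x)"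
proof -
  assume "frm L"
  then interpret L: frm L .
  have "(\<lambda>x\<in>carrier L. x) ` A = A" if "A \<subseteq> carrier L" for A
    using that by (auto simp: image_def)
  then show ?thesis by (auto simp: frame_hom_def)
qed

section \<open>The category of compact regular frames\<close>

lemma Obj_kreg_frm:
  "L \<in> Obj (kreg_frm U) \<longleftrightarrow> carrier L \<in> U \<and> frm L \<and> compact_frame L \<and> regular_frame L"
  by (simp add: kreg_frm_def Let_def is_frame_iff)

lemma Hom_kreg_frm:
  "t \<in> Hom (kreg_frm U) L M \<longleftrightarrow> (\<exists>h. t = (L, h, M) \<and> L \<in> Obj (kreg_frm U) \<and> M \<in> Obj (kreg_frm U) \<and>
     h \<in> carrier L \<rightarrow>\<^sub>E carrier M \<and> frame_hom L M h)"
  by (cases t) (auto simp: Hom_def kreg_frm_def Let_def is_frame_iff)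

lemma kreg_frm_simps [simp]:
  "Dom (kreg_frm U) (L, h, M) = L" "Cod (kreg_frm U) (L, h, M) = M"
  "Idt (kreg_frm U) L = (L, \<lambda>x\<in>carrier L. x, L)"
  "Cmp (kreg_frm U) (M', k, N) (L, h, M) = (L, compose (carrier L) k h, N)"
  by (auto simp: kreg_frm_def Let_def)

lemma Arr_kreg_frm: "t \<in> Arr (kreg_frm U) \<longleftrightarrow> t \<in> Hom (kreg_frm U) (Dom (kreg_frm U) t) (Cod (kreg_frm U) t)"
  by (simp add: Hom_def)

lemma is_category_kreg_frm: "is_category (kreg_frm U)"
proof (rule is_categoryI)
  let ?K = "kreg_frm U"
  show "Dom ?K f \<in> Obj ?K \<and> Cod ?K f \<in> Obj ?K" if "f \<in> Arr ?K" for f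
    using that by (auto simp: Arr_kreg_frm Hom_kreg_frm)
  show "Idt ?K L \<in> Hom ?K L L" if "L \<in> Obj ?K" for L
    using that frame_hom_id[of L] by (auto simp: Hom_kreg_frm Obj_kreg_frm)
  fix f assume f: "f \<in> Arr ?K"
  obtain L h M where fe: "f = (L, h, M)" by (cases f)
  have h: "h \<in> carrier L \<rightarrow>\<^sub>E carrier M" using f fe by (auto simp: Arr_kreg_frm Hom_kreg_frm)
  then show "Cmp ?K f (Idt ?K (Dom ?K f)) = f \<and> Cmp ?K (Idt ?K (Cod ?K f)) f = f"
    by (auto simp: fe compose_def fun_eq_iff PiE_def extensional_def)
  fix g assume g: "g \<in> Arr ?K" "Cod ?K f = Dom ?K g"
  then obtain k N where ge: "g = (M, k, N)" by (cases g) (auto simp: fe)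
  have k: "k \<in> carrier M \<rightarrow>\<^sub>E carrier N" using g ge by (auto simp: Arr_kreg_frm Hom_kreg_frm)
  show "Cmp ?K g f \<in> Hom ?K (Dom ?K f) (Cod ?K g)"
    using f g h k frame_hom_comp[of L M h N k]
    by (auto simp: fe ge Arr_kreg_frm Hom_kreg_frm Obj_kreg_frm compose_def PiE_def)
  fix l assume l: "l \<in> Arr ?K" "Cod ?K g = Dom ?K l"
  then obtain j N' where le: "l = (N, j, N')" by (cases l) (auto simp: ge)
  show "Cmp ?K l (Cmp ?K g f) = Cmp ?K (Cmp ?K l g) f"
    using h k by (auto simp: fe ge le compose_def fun_eq_iff)
qed

lemma is_iso_kreg_frmI:
  assumes L: "L \<in> Obj (kreg_frm U)" and M: "M \<in> Obj (kreg_frm U)"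
    and h: "h \<in> extensional (carrier L)" and bij: "bij_betw h (carrier L) (carrier M)"
    and le: "\<And>x y. x \<in> carrier L \<Longrightarrow> y \<in> carrier L \<Longrightarrow> h x \<sqsubseteq>\<^bsub>M\<^esub> h y \<longleftrightarrow> x \<sqsubseteq>\<^bsub>L\<^esub> y"
  shows "(L, h, M) \<in> Hom (kreg_frm U) L M" "is_iso (kreg_frm U) (L, h, M)"
proof -
  interpret K: cat "kreg_frm U" by standard (rule is_category_kreg_frm)
  interpret L: frm L using L by (simp add: Obj_kreg_frm)
  interpret M: frm M using M by (simp add: Obj_kreg_frm)
  have hc: "h x \<in> carrier M" if "x \<in> carrier L" for x using bij that by (auto simp: bij_betw_def)
  have "frame_hom L M h"
    by (rule order_iso_frame_hom[OF _ _ bij le]) unfold_locales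
  then show hom: "(L, h, M) \<in> Hom (kreg_frm U) L M"
    using L M h bij hc by (auto simp: Hom_kreg_frm PiE_def)
  define k where "k = restrict (inv_into (carrier L) h) (carrier M)"
  have bk: "bij_betw k (carrier M) (carrier L)"
    using bij_betw_inv_into[OF bij] by (simp add: k_def bij_betw_restrict_eq)
  have kh: "k (h x) = x" if "x \<in> carrier L" for x
    using that hc bij by (simp add: k_def bij_betw_inv_into_left)
  have hk: "h (k y) = y" if "y \<in> carrier M" for y
    using that bij by (simp add: k_def bij_betw_inv_into_right)
  have kc: "k y \<in> carrier L" if "y \<in> carrier M" for y using bk that by (auto simp: bij_betw_def)
  have "frame_hom M L k"
  proof (rule order_iso_frame_hom[OF _ _ bk])
    show "k x \<sqsubseteq>\<^bsub>L\<^esub> k y \<longleftrightarrow> x \<sqsubseteq>\<^bsub>M\<^esub> y" if "x \<in> carrier M" "y \<in> carrier M" for x y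
      using le[of "k x" "k y"] that hk kc by simp
  qed unfold_locales
  then have "(M, k, L) \<in> Hom (kreg_frm U) M L"
    using L M kc by (auto simp: Hom_kreg_frm PiE_def k_def)
  then show "is_iso (kreg_frm U) (L, h, M)"
    by (rule K.is_isoI[OF hom])
      (use kh hk in \<open>auto simp: compose_def fun_eq_iff\<close>)
qed

section \<open>Kripke--Joyal semantics\<close>

declare forces.simps [simp del]

text \<open>The maximal sieve on \<open>c\<close>. The domains of its members are the later stages
  at which a statement made at \<open>c\<close> has to be tested.\<close>

definition into :: "('o, 'a) category \<Rightarrow> 'o \<Rightarrow> 'a set" where
  "into C c = {f \<in> Arr C. Cod C f = c}"

lemma intoD: "f \<in> into C c \<Longrightarrow> f \<in> Arr C" "f \<in> into C c \<Longrightarrow> Cod C f = c"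
  by (auto simp: into_def)

context cat
begin

lemma into_id [simp, intro]: "c \<in> Obj C \<Longrightarrow> Idt C c \<in> into C c"
  by (simp add: into_def)

lemma into_comp [intro]: "f \<in> into C c \<Longrightarrow> g \<in> into C (Dom C f) \<Longrightarrow> Cmp C f g \<in> into C c"
  by (simp add: into_def)

lemma Dom_comp_into [simp]: "f \<in> into C c \<Longrightarrow> g \<in> into C (Dom C f) \<Longrightarrow> Dom C (Cmp C f g) = Dom C g"
  by (simp add: into_def)

lemma into_dom [intro]: "f \<in> into C c \<Longrightarrow> Dom C f \<in> Obj C"
  by (auto simp: into_def)

lemma comp_assoc_into:
  "f \<in> into C c \<Longrightarrow> g \<in> into C (Dom C f) \<Longrightarrow> h \<in> into C (Dom C g) \<Longrightarrow>
    Cmp C (Cmp C f g) h = Cmp C f (Cmp C g h)"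
  by (auto simp: into_def comp_assoc)

end

section \<open>Presheaves with a relation, restriction, and elements of the power object\<close>

locale psh_relation = cat C for C :: "('o, 'a) category" +
  fixes U :: "'u set set" and L :: "('o, 'a, 'u) psh_rel"
  assumes psh: "fst L \<in> Obj (presheaf_topos U C)"
    and rel_subset: "c \<in> Obj C \<Longrightarrow> snd L c \<subseteq> FObj (fst L) c \<times> FObj (fst L) c"
    and rel_restrict: "f \<in> Arr C \<Longrightarrow> (x, y) \<in> snd L (Cod C f) \<Longrightarrow>
      (psh_restrict (fst L) f x, psh_restrict (fst L) f y) \<in> snd L (Dom C f)"
begin

abbreviation X :: "'o \<Rightarrow> 'u set" where "X c \<equiv> FObj (fst L) c"
abbreviation res :: "'a \<Rightarrow> 'u \<Rightarrow> 'u" where "res f \<equiv> psh_restrict (fst L) f"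
abbreviation le :: "'o \<Rightarrow> 'u \<Rightarrow> 'u \<Rightarrow> bool" where "le c x y \<equiv> (x, y) \<in> snd L c"
abbreviation Pw :: "'o \<Rightarrow> ('a \<times> 'u) set set" where "Pw c \<equiv> psh_power C (fst L) c"
abbreviation pres :: "'a \<Rightarrow> ('a \<times> 'u) set \<Rightarrow> ('a \<times> 'u) set" where "pres f \<equiv> power_restrict C f"

lemma is_functor_psh: "is_functor (op_cat C) (set_cat U) (fst L)"
  using psh by (simp add: presheaf_topos_def Obj_functor_category)

lemma X_in_U: "c \<in> Obj C \<Longrightarrow> X c \<in> U"
  using is_functorD(1)[OF is_functor_psh, of c] by (simp add: set_cat_def)

lemma FArr_psh:
  assumes "f \<in> Arr C"
  shows "FArr (fst L) f = (X (Cod C f), res f, X (Dom C f))" "res f \<in> X (Cod C f) \<rightarrow>\<^sub>E X (Dom C f)"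
proof -
  have "FArr (fst L) f \<in> Hom (set_cat U) (X (Cod C f)) (X (Dom C f))"
    using is_functorD(2)[OF is_functor_psh, of f] assms by (simp add: Hom_def)
  then show "FArr (fst L) f = (X (Cod C f), res f, X (Dom C f))" "res f \<in> X (Cod C f) \<rightarrow>\<^sub>E X (Dom C f)"
    by (auto simp: Hom_def set_cat_def psh_restrict_def set_arr_fun_def)
qed

lemma res_closed [simp, intro]: "f \<in> into C c \<Longrightarrow> x \<in> X c \<Longrightarrow> res f x \<in> X (Dom C f)"
  using FArr_psh(2)[of f] by (auto simp: into_def)

lemma res_id [simp]: "c \<in> Obj C \<Longrightarrow> x \<in> X c \<Longrightarrow> res (Idt C c) x = x"
  using is_functorD(3)[OF is_functor_psh, of c]
  by (simp add: set_cat_def psh_restrict_def set_arr_fun_def)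

lemma res_comp:
  assumes "f \<in> into C c" "g \<in> into C (Dom C f)" "x \<in> X c"
  shows "res (Cmp C f g) x = res g (res f x)"
proof -
  have f: "f \<in> Arr C" "Cod C f = c" "g \<in> Arr C" "Cod C g = Dom C f" using assms by (auto simp: into_def)
  have "FArr (fst L) (Cmp C f g) = Cmp (set_cat U) (FArr (fst L) g) (FArr (fst L) f)"
    using is_functorD(4)[OF is_functor_psh, of f c "Dom C f" g "Dom C g"] f by (simp add: Hom_def)
  then show ?thesis
    unfolding FArr_psh(1)[OF f(1)] FArr_psh(1)[OF f(3)] using f assms
    by (simp add: set_cat_def psh_restrict_def set_arr_fun_def compose_def)
qed

lemma le_in: "c \<in> Obj C \<Longrightarrow> le c x y \<Longrightarrow> x \<in> X c" "c \<in> Obj C \<Longrightarrow> le c x y \<Longrightarrow> y \<in> X c"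
  using rel_subset by blast+

lemma le_res: "f \<in> into C c \<Longrightarrow> le c x y \<Longrightarrow> le (Dom C f) (res f x) (res f y)"
  using rel_restrict by (auto simp: into_def)

lemma PwD:
  assumes "S \<in> Pw c" "(f, x) \<in> S"
  shows "f \<in> into C c" "x \<in> X (Dom C f)"
    "g \<in> into C (Dom C f) \<Longrightarrow> (Cmp C f g, res g x) \<in> S"
  using assms by (auto simp: psh_power_def into_def)

lemma PwI:
  assumes "\<And>f x. (f, x) \<in> S \<Longrightarrow> f \<in> into C c \<and> x \<in> X (Dom C f)"
    and "\<And>f x g. (f, x) \<in> S \<Longrightarrow> g \<in> into C (Dom C f) \<Longrightarrow> (Cmp C f g, res g x) \<in> S"
  shows "S \<in> Pw c"
  using assms by (fastforce simp: psh_power_def into_def)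

lemma mem_pres: "(g, x) \<in> pres f S \<longleftrightarrow> g \<in> into C (Dom C f) \<and> (Cmp C f g, x) \<in> S"
  by (auto simp: power_restrict_def into_def)

lemma pres_closed [simp, intro]:
  assumes "f \<in> into C c" "S \<in> Pw c"
  shows "pres f S \<in> Pw (Dom C f)"
proof (rule PwI)
  fix g x assume gx: "(g, x) \<in> pres f S"
  then have g: "g \<in> into C (Dom C f)" "(Cmp C f g, x) \<in> S" by (auto simp: mem_pres)
  then show "g \<in> into C (Dom C f) \<and> x \<in> X (Dom C g)"
    using PwD(2)[OF assms(2) g(2)] assms by simp
  fix h assume h: "h \<in> into C (Dom C g)"
  then show "(Cmp C g h, res h x) \<in> pres f S"
    using PwD(3)[OF assms(2) g(2), of h] g assms comp_assoc_into[of f c g h] by (auto simp: mem_pres)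
qed

lemma pres_id [simp]:
  assumes "c \<in> Obj C" "S \<in> Pw c"
  shows "pres (Idt C c) S = S"
proof -
  have "(g, x) \<in> pres (Idt C c) S \<longleftrightarrow> (g, x) \<in> S" for g x
    using assms PwD(1)[OF assms(2), of g x] by (auto simp: mem_pres intoD)
  then show ?thesis by auto
qed

lemma pres_comp:
  assumes "f \<in> into C c" "g \<in> into C (Dom C f)"
  shows "pres (Cmp C f g) S = pres g (pres f S)"
proof -
  have "(h, x) \<in> pres (Cmp C f g) S \<longleftrightarrow> (h, x) \<in> pres g (pres f S)" for h x
    using assms comp_assoc_into[OF assms, of h] by (auto simp: mem_pres)
  then show ?thesis by auto
qed

text \<open>The predicates with prefix \<open>i\<close> are the forcing conditions of the
  corresponding formulas in reduced form. In the formulas a quantifier followed by an implication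
  restricts twice; by functoriality one restriction is enough.\<close>

definition itop :: "'o \<Rightarrow> 'u \<Rightarrow> bool" where
  "itop c t \<longleftrightarrow> (\<forall>f\<in>into C c. \<forall>x\<in>X (Dom C f). le (Dom C f) x (res f t))"

definition ibot :: "'o \<Rightarrow> 'u \<Rightarrow> bool" where
  "ibot c z \<longleftrightarrow> (\<forall>f\<in>into C c. \<forall>x\<in>X (Dom C f). le (Dom C f) (res f z) x)"

definition imeet :: "'o \<Rightarrow> 'u \<Rightarrow> 'u \<Rightarrow> 'u \<Rightarrow> bool" where
  "imeet c a b m \<longleftrightarrow> le c m a \<and> le c m b \<and> (\<forall>f\<in>into C c. \<forall>x\<in>X (Dom C f).
     le (Dom C f) x (res f a) \<longrightarrow> le (Dom C f) x (res f b) \<longrightarrow> le (Dom C f) x (res f m))"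

definition ijoin :: "'o \<Rightarrow> 'u \<Rightarrow> 'u \<Rightarrow> 'u \<Rightarrow> bool" where
  "ijoin c a b j \<longleftrightarrow> le c a j \<and> le c b j \<and> (\<forall>f\<in>into C c. \<forall>x\<in>X (Dom C f).
     le (Dom C f) (res f a) x \<longrightarrow> le (Dom C f) (res f b) x \<longrightarrow> le (Dom C f) (res f j) x)"

definition iub :: "'o \<Rightarrow> ('a \<times> 'u) set \<Rightarrow> 'u \<Rightarrow> bool" where
  "iub c S u \<longleftrightarrow> (\<forall>f x. (f, x) \<in> S \<longrightarrow> le (Dom C f) x (res f u))"

definition iJoin :: "'o \<Rightarrow> ('a \<times> 'u) set \<Rightarrow> 'u \<Rightarrow> bool" where
  "iJoin c S s \<longleftrightarrow> iub c S s \<and>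
     (\<forall>f\<in>into C c. \<forall>u\<in>X (Dom C f). iub (Dom C f) (pres f S) u \<longrightarrow> le (Dom C f) (res f s) u)"

text \<open>All three witnesses live at the stage \<open>c\<close> itself, since covers in a
  presheaf topos are trivial. This is why the relation will turn out to be the stagewise
  one.\<close>

definition iwell_inside :: "'o \<Rightarrow> 'u \<Rightarrow> 'u \<Rightarrow> bool" where
  "iwell_inside c a b \<longleftrightarrow> (\<exists>w\<in>X c. \<exists>z\<in>X c. \<exists>t\<in>X c. ibot c z \<and> itop c t \<and> imeet c a w z \<and> ijoin c b w t)"

definition idirected :: "'o \<Rightarrow> ('a \<times> 'u) set \<Rightarrow> bool" where
  "idirected c S \<longleftrightarrow> (\<exists>x\<in>X c. (Idt C c, x) \<in> S) \<and>
     (\<forall>f x y. (f, x) \<in> S \<longrightarrow> (f, y) \<in> S \<longrightarrow>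
       (\<exists>z. (f, z) \<in> S \<and> le (Dom C f) x z \<and> le (Dom C f) y z))"

text \<open>A condition at \<open>Dom C f\<close> tests arrows \<open>g\<close> into it, and
  \<open>Cmp C f g\<close> is among those tested at \<open>c\<close>. The analogous facts for meets
  and joins are the source of the frame homomorphisms between stages.\<close>

lemma itop_res: "f \<in> into C c \<Longrightarrow> t \<in> X c \<Longrightarrow> itop c t \<Longrightarrow> itop (Dom C f) (res f t)"
  unfolding itop_def by (auto simp: res_comp[symmetric] dest!: bspec[OF _ into_comp])

lemma ibot_res: "f \<in> into C c \<Longrightarrow> t \<in> X c \<Longrightarrow> ibot c t \<Longrightarrow> ibot (Dom C f) (res f t)"
  unfolding ibot_def by (auto simp: res_comp[symmetric] dest!: bspec[OF _ into_comp])

lemma imeet_res: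
  assumes "f \<in> into C c" "a \<in> X c" "b \<in> X c" "m \<in> X c" "imeet c a b m"
  shows "imeet (Dom C f) (res f a) (res f b) (res f m)"
  unfolding imeet_def
proof (intro conjI ballI impI)
  fix g x assume g: "g \<in> into C (Dom C f)"
  note * = assms(5)[unfolded imeet_def, THEN conjunct2, THEN conjunct2, THEN bspec, OF into_comp[OF assms(1) g]]
  assume "x \<in> X (Dom C g)" "le (Dom C g) x (res g (res f a))" "le (Dom C g) x (res g (res f b))"
  then show "le (Dom C g) x (res g (res f m))"
    using * g assms by (simp add: res_comp[OF assms(1) g])
qed (use assms in \<open>auto simp: imeet_def le_res\<close>)

lemma ijoin_res:
  assumes "f \<in> into C c" "a \<in> X c" "b \<in> X c" "m \<in> X c" "ijoin c a b m"
  shows "ijoin (Dom C f) (res f a) (res f b) (res f m)"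
  unfolding ijoin_def
proof (intro conjI ballI impI)
  fix g x assume g: "g \<in> into C (Dom C f)"
  note * = assms(5)[unfolded ijoin_def, THEN conjunct2, THEN conjunct2, THEN bspec, OF into_comp[OF assms(1) g]]
  assume "x \<in> X (Dom C g)" "le (Dom C g) (res g (res f a)) x" "le (Dom C g) (res g (res f b)) x"
  then show "le (Dom C g) (res g (res f m)) x"
    using * g assms by (simp add: res_comp[OF assms(1) g])
qed (use assms in \<open>auto simp: ijoin_def le_res\<close>)

lemma iub_res:
  assumes "f \<in> into C c" "u \<in> X c" "iub c S u"
  shows "iub (Dom C f) (pres f S) (res f u)"
  unfolding iub_def
proof (intro allI impI)
  fix g x assume "(g, x) \<in> pres f S"
  then have g: "g \<in> into C (Dom C f)" "(Cmp C f g, x) \<in> S" by (auto simp: mem_pres)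
  then show "le (Dom C g) x (res g (res f u))"
    using assms(3)[unfolded iub_def, rule_format, OF g(2)] assms by (simp add: res_comp[OF assms(1) g(1)])
qed

lemma iJoin_res:
  assumes "f \<in> into C c" "s \<in> X c" "iJoin c S s"
  shows "iJoin (Dom C f) (pres f S) (res f s)"
  unfolding iJoin_def
proof (intro conjI ballI impI)
  show "iub (Dom C f) (pres f S) (res f s)"
    using iub_res[OF assms(1,2)] assms(3) by (simp add: iJoin_def)
  fix g u assume g: "g \<in> into C (Dom C f)"
  note * = assms(3)[unfolded iJoin_def, THEN conjunct2, THEN bspec, OF into_comp[OF assms(1) g]]
  assume "u \<in> X (Dom C g)" "iub (Dom C g) (pres g (pres f S)) u"
  then show "le (Dom C g) (res g (res f s)) u"
    using * g assms by (simp add: res_comp[OF assms(1) g] pres_comp[OF assms(1) g])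
qed

section \<open>Forcing of the lattice-theoretic formulas\<close>

lemma ball_into: "(\<forall>f\<in>Arr C. Cod C f = c \<longrightarrow> P f) \<longleftrightarrow> (\<forall>f\<in>into C c. P f)"
  by (auto simp: into_def)

lemma forces_FAll: "forces C L c \<rho> \<sigma> (FAll x p) \<longleftrightarrow> (\<forall>f\<in>into C c. \<forall>a\<in>X (Dom C f).
     forces C L (Dom C f) ((res f \<circ> \<rho>)(x := a)) (pres f \<circ> \<sigma>) p)"
  by (simp add: ball_into forces.simps)

lemma forces_FImp: "forces C L c \<rho> \<sigma> (FImp p q) \<longleftrightarrow> (\<forall>f\<in>into C c.
     forces C L (Dom C f) (res f \<circ> \<rho>) (pres f \<circ> \<sigma>) p \<longrightarrow>
     forces C L (Dom C f) (res f \<circ> \<rho>) (pres f \<circ> \<sigma>) q)"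
  by (simp add: ball_into forces.simps)

lemma forces_FAllP: "forces C L c \<rho> \<sigma> (FAllP A p) \<longleftrightarrow> (\<forall>f\<in>into C c. \<forall>S\<in>Pw (Dom C f).
     forces C L (Dom C f) (res f \<circ> \<rho>) ((pres f \<circ> \<sigma>)(A := S)) p)"
  by (simp add: ball_into forces.simps)

lemmas forces_simps = forces.simps(1-4,7) forces_FAll forces_FImp forces_FAllP

lemma into_trans: "f \<in> into C c \<Longrightarrow> g \<in> into C (Dom C f) \<Longrightarrow> Dom C g \<in> Obj C"
  by (auto simp: into_def)

lemma forces_top: "\<rho> t \<in> X c \<Longrightarrow> forces C L c \<rho> \<sigma> (fm_top t) \<longleftrightarrow> itop c (\<rho> t)"
  by (simp add: fm_top_def itop_def forces_simps)

lemma forces_bot: "\<rho> t \<in> X c \<Longrightarrow> forces C L c \<rho> \<sigma> (fm_bot t) \<longleftrightarrow> ibot c (\<rho> t)"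
  by (simp add: fm_bot_def ibot_def forces_simps)

text \<open>The formula tests its implication at \<open>f\<close> followed by \<open>g\<close>.
  Taking \<open>g\<close> to be an identity gives one direction, and regrouping to the single arrow
  \<open>Cmp C f g\<close> gives the other.\<close>

lemma forces_meet:
  assumes c: "c \<in> Obj C" and v: "\<rho> a \<in> X c" "\<rho> b \<in> X c" "\<rho> m \<in> X c"
  shows "forces C L c \<rho> \<sigma> (fm_meet a b m) \<longleftrightarrow> imeet c (\<rho> a) (\<rho> b) (\<rho> m)"
proof -
  have "(\<forall>f\<in>into C c. \<forall>x\<in>X (Dom C f). \<forall>g\<in>into C (Dom C f).
      le (Dom C g) (res g x) (res g (res f (\<rho> a))) \<and> le (Dom C g) (res g x) (res g (res f (\<rho> b))) \<longrightarrow>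
      le (Dom C g) (res g x) (res g (res f (\<rho> m)))) \<longleftrightarrow>
    (\<forall>f\<in>into C c. \<forall>x\<in>X (Dom C f).
      le (Dom C f) x (res f (\<rho> a)) \<longrightarrow> le (Dom C f) x (res f (\<rho> b)) \<longrightarrow> le (Dom C f) x (res f (\<rho> m)))"
    (is "?l \<longleftrightarrow> ?r")
  proof
    assume l: ?l
    show ?r
    proof (intro ballI impI)
      fix f x assume f: "f \<in> into C c" and x: "x \<in> X (Dom C f)"
        "le (Dom C f) x (res f (\<rho> a))" "le (Dom C f) x (res f (\<rho> b))"
      then show "le (Dom C f) x (res f (\<rho> m))"
        using l[rule_format, OF f x(1) into_id[OF into_dom[OF f]]] v into_dom[OF f] by simp
    qed
  next
    assume r: ?r
    show ?l
    proof (intro ballI impI)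
      fix f x g assume f: "f \<in> into C c" and x: "x \<in> X (Dom C f)" and g: "g \<in> into C (Dom C f)"
        and "le (Dom C g) (res g x) (res g (res f (\<rho> a))) \<and> le (Dom C g) (res g x) (res g (res f (\<rho> b)))"
      then show "le (Dom C g) (res g x) (res g (res f (\<rho> m)))"
        using r[rule_format, OF into_comp[OF f g], of "res g x"] v
        by (simp add: res_comp[OF f g])
    qed
  qed
  then show ?thesis
    by (simp add: fm_meet_def imeet_def Let_def forces_simps)
qed

lemma forces_join:
  assumes c: "c \<in> Obj C" and v: "\<rho> a \<in> X c" "\<rho> b \<in> X c" "\<rho> m \<in> X c"
  shows "forces C L c \<rho> \<sigma> (fm_join a b m) \<longleftrightarrow> ijoin c (\<rho> a) (\<rho> b) (\<rho> m)"
proof -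
  have "(\<forall>f\<in>into C c. \<forall>x\<in>X (Dom C f). \<forall>g\<in>into C (Dom C f).
      le (Dom C g) (res g (res f (\<rho> a))) (res g x) \<and> le (Dom C g) (res g (res f (\<rho> b))) (res g x) \<longrightarrow>
      le (Dom C g) (res g (res f (\<rho> m))) (res g x)) \<longleftrightarrow>
    (\<forall>f\<in>into C c. \<forall>x\<in>X (Dom C f).
      le (Dom C f) (res f (\<rho> a)) x \<longrightarrow> le (Dom C f) (res f (\<rho> b)) x \<longrightarrow> le (Dom C f) (res f (\<rho> m)) x)"
    (is "?l \<longleftrightarrow> ?r")
  proof
    assume l: ?l
    show ?r
    proof (intro ballI impI)
      fix f x assume f: "f \<in> into C c" and x: "x \<in> X (Dom C f)"
        "le (Dom C f) (res f (\<rho> a)) x" "le (Dom C f) (res f (\<rho> b)) x"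
      then show "le (Dom C f) (res f (\<rho> m)) x"
        using l[rule_format, OF f x(1) into_id[OF into_dom[OF f]]] v into_dom[OF f] by simp
    qed
  next
    assume r: ?r
    show ?l
    proof (intro ballI impI)
      fix f x g assume f: "f \<in> into C c" and x: "x \<in> X (Dom C f)" and g: "g \<in> into C (Dom C f)"
        and "le (Dom C g) (res g (res f (\<rho> a))) (res g x) \<and> le (Dom C g) (res g (res f (\<rho> b))) (res g x)"
      then show "le (Dom C g) (res g (res f (\<rho> m))) (res g x)"
        using r[rule_format, OF into_comp[OF f g], of "res g x"] v
        by (simp add: res_comp[OF f g])
    qed
  qed
  then show ?thesis
    by (simp add: fm_join_def ijoin_def Let_def forces_simps)
qed

text \<open>This subformula occurs twice in \<open>fm_Join\<close>, once for the join and once for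
  the competing upper bound. The side condition keeps the bound variable from capturing the
  bound.\<close>

lemma forces_ub:
  assumes c: "c \<in> Obj C" and v: "\<rho> u \<in> X c" "\<sigma> A \<in> Pw c" and "x \<noteq> u"
  shows "forces C L c \<rho> \<sigma> (FAll x (x \<^bold>\<in> A \<^bold>\<longrightarrow> x \<^bold>\<le> u)) \<longleftrightarrow> iub c (\<sigma> A) (\<rho> u)"
    (is "?l \<longleftrightarrow> ?r")
proof
  assume l: ?l
  show ?r unfolding iub_def
  proof (intro allI impI)
    fix f y assume fy: "(f, y) \<in> \<sigma> A"
    note f = PwD[OF v(2) fy]
    have d: "Dom C f \<in> Obj C" using f(1) by auto
    have "(Idt C (Dom C f), y) \<in> pres (Idt C (Dom C f)) (pres f (\<sigma> A))"
      using fy f d v by (simp add: mem_pres intoD)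
    then show "le (Dom C f) y (res f (\<rho> u))"
      using l[unfolded forces_simps, rule_format, OF f(1,2) into_id[OF d]] f v d \<open>x \<noteq> u\<close> by simp
  qed
next
  assume r: ?r
  show ?l unfolding forces_simps
  proof (intro ballI impI)
    fix f y g assume f: "f \<in> into C c" and y: "y \<in> X (Dom C f)" and g: "g \<in> into C (Dom C f)"
      and m: "(Idt C (Dom C g), (res g \<circ> (res f \<circ> \<rho>)(x := y)) x) \<in> (pres g \<circ> (pres f \<circ> \<sigma>)) A"
    have "(Cmp C f g, res g y) \<in> \<sigma> A"
      using m f g by (auto simp: mem_pres intoD)
    then show "le (Dom C g) ((res g \<circ> (res f \<circ> \<rho>)(x := y)) x) ((res g \<circ> (res f \<circ> \<rho>)(x := y)) u)"
      using r \<open>x \<noteq> u\<close> f g v res_comp[OF f g v(1)] unfolding iub_def by fastforce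
  qed
qed

lemma forces_Join:
  assumes c: "c \<in> Obj C" and v: "\<rho> s \<in> X c" "\<sigma> A \<in> Pw c"
  shows "forces C L c \<rho> \<sigma> (fm_Join A s) \<longleftrightarrow> iJoin c (\<sigma> A) (\<rho> s)"
proof -
  let ?p = "FAll (s+1) ((s+1) \<^bold>\<in> A \<^bold>\<longrightarrow> (s+1) \<^bold>\<le> (s+2))"
  have "forces C L c \<rho> \<sigma> (FAll (s+2) (?p \<^bold>\<longrightarrow> s \<^bold>\<le> (s+2))) \<longleftrightarrow>
     (\<forall>f\<in>into C c. \<forall>u\<in>X (Dom C f). iub (Dom C f) (pres f (\<sigma> A)) u \<longrightarrow> le (Dom C f) (res f (\<rho> s)) u)"
    (is "?l \<longleftrightarrow> ?r")
  proof
    assume l: ?l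
    show ?r
    proof (intro ballI impI)
      fix f u assume f: "f \<in> into C c" and u: "u \<in> X (Dom C f)" and ub: "iub (Dom C f) (pres f (\<sigma> A)) u"
      have d: "Dom C f \<in> Obj C" using f by auto
      show "le (Dom C f) (res f (\<rho> s)) u"
        using l[unfolded forces_FAll[of _ _ _ "s+2"] forces_FImp[of _ _ _ ?p], rule_format, OF f u into_id[OF d]]
          forces_ub[of "Dom C f" "res (Idt C (Dom C f)) \<circ> (res f \<circ> \<rho>)(s + 2 := u)" "s+2"
            "pres (Idt C (Dom C f)) \<circ> (pres f \<circ> \<sigma>)" A "s+1"] d u f v ub
        by (simp add: forces.simps(1))
    qed
  next
    assume r: ?r
    show ?l unfolding forces_FAll[of _ _ _ "s+2"] forces_FImp[of _ _ _ ?p]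
    proof (intro ballI impI)
      fix f u g assume f: "f \<in> into C c" and u: "u \<in> X (Dom C f)" and g: "g \<in> into C (Dom C f)"
      assume "forces C L (Dom C g) (res g \<circ> (res f \<circ> \<rho>)(s + 2 := u)) (pres g \<circ> (pres f \<circ> \<sigma>)) ?p"
      then have "iub (Dom C g) (pres (Cmp C f g) (\<sigma> A)) (res g u)"
        using forces_ub[of "Dom C g" "res g \<circ> (res f \<circ> \<rho>)(s + 2 := u)" "s+2"
            "pres g \<circ> (pres f \<circ> \<sigma>)" A "s+1"] f u g v into_trans[OF f g]
        by (simp add: pres_comp[OF f g])
      then show "forces C L (Dom C g) (res g \<circ> (res f \<circ> \<rho>)(s + 2 := u)) (pres g \<circ> (pres f \<circ> \<sigma>)) (s \<^bold>\<le> (s+2))"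
        using r[rule_format, OF into_comp[OF f g], of "res g u"] f u g v
        by (simp add: res_comp[OF f g] forces.simps(1))
    qed
  qed
  then show ?thesis
    using forces_ub[of c \<rho> s \<sigma> A "s+1"] c v
    by (simp add: fm_Join_def iJoin_def Let_def forces.simps(4))
qed

lemma forces_well_inside:
  assumes c: "c \<in> Obj C" and v: "\<rho> a \<in> X c" "\<rho> b \<in> X c"
  shows "forces C L c \<rho> \<sigma> (fm_well_inside a b) \<longleftrightarrow> iwell_inside c (\<rho> a) (\<rho> b)"
  using v by (simp add: fm_well_inside_def iwell_inside_def Let_def forces_top forces_bot forces_meet[OF c]
      forces_join[OF c] forces_simps cong: bex_cong)

lemma forces_directed:
  assumes c: "c \<in> Obj C" and v: "\<sigma> A \<in> Pw c"
  shows "forces C L c \<rho> \<sigma> (fm_directed A) \<longleftrightarrow> idirected c (\<sigma> A)"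
proof -
  have "forces C L c \<rho> \<sigma>
      (FAll 0 (FAll 1 (0 \<^bold>\<in> A \<^bold>\<and> 1 \<^bold>\<in> A \<^bold>\<longrightarrow> FEx 2 (2 \<^bold>\<in> A \<^bold>\<and> 0 \<^bold>\<le> 2 \<^bold>\<and> 1 \<^bold>\<le> 2)))) \<longleftrightarrow>
    (\<forall>f x y. (f, x) \<in> \<sigma> A \<longrightarrow> (f, y) \<in> \<sigma> A \<longrightarrow>
       (\<exists>z. (f, z) \<in> \<sigma> A \<and> le (Dom C f) x z \<and> le (Dom C f) y z))" (is "?l \<longleftrightarrow> ?r")
  proof
    assume l: ?l
    show ?r
    proof (intro allI impI)
      fix f x y assume fx: "(f, x) \<in> \<sigma> A" and fy: "(f, y) \<in> \<sigma> A"
      note x = PwD[OF v fx] and y = PwD[OF v fy]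
      have d: "Dom C f \<in> Obj C" using x(1) by auto
      show "\<exists>z. (f, z) \<in> \<sigma> A \<and> le (Dom C f) x z \<and> le (Dom C f) y z"
        using l[unfolded forces_simps, rule_format, OF x(1,2), of "Idt C (Dom C f)" y "Idt C (Dom C f)"]
          d x(1,2) y(2) v fx fy
        by (auto simp: mem_pres intoD)
    qed
  next
    assume r: ?r
    show ?l unfolding forces_simps
    proof (intro ballI impI)
      fix f x g y h assume f: "f \<in> into C c" and x: "x \<in> X (Dom C f)" and g0: "g \<in> into C (Dom C f)"
        and y0: "y \<in> X (Dom C g)" and h0: "h \<in> into C (Dom C g)"
      then have g: "g \<in> into C (Dom C f)" and y: "y \<in> X (Dom C g)" and h: "h \<in> into C (Dom C g)" by simp_all
      let ?r = "res h \<circ> (res g \<circ> (res f \<circ> \<rho>)(0 := x))(1 := y)" and ?s = "pres h \<circ> (pres g \<circ> (pres f \<circ> \<sigma>))"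
      \<comment> \<open>The two quantifiers and the implication contribute one arrow each; this is
        the composite at which directedness of the given set is applied.\<close>
      let ?k = "Cmp C f (Cmp C g h)"
      assume m: "(Idt C (Dom C h), ?r 0) \<in> ?s A \<and> (Idt C (Dom C h), ?r 1) \<in> ?s A"
      have dh: "Dom C h \<in> Obj C" using h by auto
      have kh: "Cmp C h (Idt C (Dom C h)) = h" using h by (simp add: intoD)
      have "(?k, ?r 0) \<in> \<sigma> A" "(?k, ?r 1) \<in> \<sigma> A"
        using m f g h by (auto simp: mem_pres kh)
      then obtain z where z: "(?k, z) \<in> \<sigma> A" "le (Dom C ?k) (?r 0) z" "le (Dom C ?k) (?r 1) z"
        using r by blast
      have D: "Dom C ?k = Dom C h" using f g h by (simp add: into_comp)
      have "z \<in> X (Dom C h)" using PwD(2)[OF v z(1)] D by simp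
      moreover have "(Idt C (Dom C h), z) \<in> ?s A"
        using z(1) f g h dh by (simp add: mem_pres kh into_comp)
      ultimately show "\<exists>z\<in>X (Dom C h). (Idt C (Dom C h), (?r(2 := z)) 2) \<in> ?s A \<and>
          le (Dom C h) ((?r(2 := z)) 0) ((?r(2 := z)) 2) \<and> le (Dom C h) ((?r(2 := z)) 1) ((?r(2 := z)) 2)"
        using z(2,3) D by (intro bexI[of _ z]) auto
    qed
  qed
  then show ?thesis
    by (simp add: fm_directed_def idirected_def forces.simps(3,4,7))
qed

end

text \<open>The external content of the validity of the frame, compactness and regularity formulas.
  The operations stay relations here, as in the formulas: that tops and meets exist at each stage is
  derived later from \<open>complete\<close>.\<close>

locale internal_kreg = psh_relation C U L for C :: "('o, 'a) category" and U :: "'u set set" and L +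
  assumes le_refl: "c \<in> Obj C \<Longrightarrow> x \<in> X c \<Longrightarrow> le c x x"
    and le_antisym: "c \<in> Obj C \<Longrightarrow> le c x y \<Longrightarrow> le c y x \<Longrightarrow> x = y"
    and le_trans: "c \<in> Obj C \<Longrightarrow> le c x y \<Longrightarrow> le c y z \<Longrightarrow> le c x z"
    and complete: "c \<in> Obj C \<Longrightarrow> S \<in> Pw c \<Longrightarrow> \<exists>s\<in>X c. iJoin c S s"
    and distrib: "c \<in> Obj C \<Longrightarrow> S \<in> Pw c \<Longrightarrow> B \<in> Pw c \<Longrightarrow> a \<in> X c \<Longrightarrow> s \<in> X c \<Longrightarrow> m \<in> X c \<Longrightarrow>
      iJoin c S s \<Longrightarrow> imeet c a s m \<Longrightarrow>
      \<forall>f\<in>into C c. \<forall>y\<in>X (Dom C f).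
        (f, y) \<in> B \<longleftrightarrow> (\<exists>x\<in>X (Dom C f). (f, x) \<in> S \<and> imeet (Dom C f) (res f a) x y) \<Longrightarrow>
      iJoin c B m"
    and compact: "c \<in> Obj C \<Longrightarrow> S \<in> Pw c \<Longrightarrow> t \<in> X c \<Longrightarrow> idirected c S \<Longrightarrow> itop c t \<Longrightarrow>
      iJoin c S t \<Longrightarrow> (Idt C c, t) \<in> S"
    and regular: "c \<in> Obj C \<Longrightarrow> S \<in> Pw c \<Longrightarrow> b \<in> X c \<Longrightarrow>
      \<forall>f\<in>into C c. \<forall>x\<in>X (Dom C f). (f, x) \<in> S \<longleftrightarrow> iwell_inside (Dom C f) x (res f b) \<Longrightarrow>
      iJoin c S b"

section \<open>Validity of the axioms as conditions on stages\<close>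

context psh_relation
begin

text \<open>Instantiation at the identity arrow. The composite with \<open>res (Idt C c)\<close>
  stays in the statement because valuations are arbitrary: restriction along the identity fixes only
  values in \<open>X c\<close>.\<close>

lemma FAllD:
  assumes "c \<in> Obj C" "forces C L c \<rho> \<sigma> (FAll x p)" "a \<in> X c"
  shows "forces C L c ((res (Idt C c) \<circ> \<rho>)(x := a)) (pres (Idt C c) \<circ> \<sigma>) p"
  using assms by (auto simp: forces_simps dest!: bspec[OF _ into_id])

lemma FAllPD:
  assumes "c \<in> Obj C" "forces C L c \<rho> \<sigma> (FAllP A p)" "S \<in> Pw c"
  shows "forces C L c (res (Idt C c) \<circ> \<rho>) ((pres (Idt C c) \<circ> \<sigma>)(A := S)) p"
  using assms by (auto simp: forces_simps dest!: bspec[OF _ into_id])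

lemma FImpD:
  assumes "c \<in> Obj C" "forces C L c \<rho> \<sigma> (p \<^bold>\<longrightarrow> q)"
    "forces C L c (res (Idt C c) \<circ> \<rho>) (pres (Idt C c) \<circ> \<sigma>) p"
  shows "forces C L c (res (Idt C c) \<circ> \<rho>) (pres (Idt C c) \<circ> \<sigma>) q"
  using assms by (auto simp: forces_simps dest!: bspec[OF _ into_id])

lemma validD: "valid C L p \<Longrightarrow> c \<in> Obj C \<Longrightarrow> forces C L c \<rho> \<sigma> p"
  by (simp add: valid_def)

lemma valid_FAnd: "valid C L (p \<^bold>\<and> q) \<longleftrightarrow> valid C L p \<and> valid C L q"
  by (auto simp: valid_def forces.simps(4))

lemma valid_poset:
  "valid C L fm_poset \<longleftrightarrow>
     (\<forall>c\<in>Obj C. (\<forall>x\<in>X c. le c x x) \<and> (\<forall>x\<in>X c. \<forall>y\<in>X c. le c x y \<longrightarrow> le c y x \<longrightarrow> x = y) \<and>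
       (\<forall>x\<in>X c. \<forall>y\<in>X c. \<forall>z\<in>X c. le c x y \<longrightarrow> le c y z \<longrightarrow> le c x z))" (is "?l \<longleftrightarrow> ?r")
proof
  assume l: ?l
  show ?r
  proof (intro ballI conjI impI)
    fix c assume c: "c \<in> Obj C"
    note * = l[unfolded fm_poset_def valid_FAnd]
    fix x assume x: "x \<in> X c"
    show "le c x x"
      using FAllD[OF c validD[OF *[THEN conjunct1] c] x] by (simp add: forces_simps)
    fix y assume y: "y \<in> X c"
    show "x = y" if "le c x y" "le c y x"
      using FImpD[OF c FAllD[OF c FAllD[OF c validD[OF *[THEN conjunct2, THEN conjunct1] c] x] y]] that c x y
      by (simp add: forces_simps(1,2,4))
    fix z assume z: "z \<in> X c"
    show "le c x z" if "le c x y" "le c y z"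
      using FImpD[OF c FAllD[OF c FAllD[OF c FAllD[OF c validD[OF *[THEN conjunct2, THEN conjunct2] c] x] y] z]]
        that c x y z
      by (simp add: forces_simps(1,2,4))
  qed
next
  assume r: ?r
  have o: "Dom C f \<in> Obj C" if "f \<in> into C c" for f c using that by auto
  have as: "x = y" if "c \<in> Obj C" "le c x y" "le c y x" for c x y
    using r that le_in[OF that(1,2)] by blast
  have tr: "le c x z" if "c \<in> Obj C" "le c x y" "le c y z" for c x y z
    using r that le_in[OF that(1,2)] le_in[OF that(1,3)] by blast
  show ?l
    unfolding fm_poset_def valid_FAnd
  proof (intro conjI)
    show "valid C L (FAll 0 (0 \<^bold>\<le> 0))"
      using r o by (simp add: valid_def forces_simps)
    show "valid C L (FAll 0 (FAll 1 (0 \<^bold>\<le> 1 \<^bold>\<and> 1 \<^bold>\<le> 0 \<^bold>\<longrightarrow> 0 \<^bold>= 1)))"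
      unfolding valid_def forces_simps
      by (intro ballI allI impI) (elim conjE, rule as[OF o])
    show "valid C L (FAll 0 (FAll 1 (FAll 2 (0 \<^bold>\<le> 1 \<^bold>\<and> 1 \<^bold>\<le> 2 \<^bold>\<longrightarrow> 0 \<^bold>\<le> 2))))"
      unfolding valid_def forces_simps
      by (intro ballI allI impI) (elim conjE, rule tr[OF o])
  qed
qed

lemma valid_complete: "valid C L fm_complete \<longleftrightarrow> (\<forall>c\<in>Obj C. \<forall>S\<in>Pw c. \<exists>s\<in>X c. iJoin c S s)"
    (is "?l \<longleftrightarrow> ?r")
proof
  assume l: ?l
  show ?r
  proof (intro ballI)
    fix c S assume c: "c \<in> Obj C" and S: "S \<in> Pw c"
    show "\<exists>s\<in>X c. iJoin c S s"
      using FAllPD[OF c validD[OF l[unfolded fm_complete_def] c] S] c S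
      by (simp add: forces_simps(5) forces_Join cong: bex_cong)
  qed
next
  assume r: ?r
  then show ?l
    by (auto simp: valid_def fm_complete_def forces_simps(5,8) forces_Join into_dom cong: bex_cong)
qed

text \<open>After the restriction \<open>g\<close> that the implications add, both sides of the
  biconditional depend only on \<open>Cmp C f g\<close> and \<open>res g y\<close>. Hence the cases
  with \<open>g\<close> an identity already represent all of them.\<close>

lemma forces_distrib_set:
  assumes c: "c \<in> Obj C" and v: "\<rho> 0 \<in> X c" "\<sigma> 0 \<in> Pw c" "\<sigma> 1 \<in> Pw c"
  shows "forces C L c \<rho> \<sigma> (FAll 3 (3 \<^bold>\<in> 1 \<^bold>\<longleftrightarrow> FEx 4 (4 \<^bold>\<in> 0 \<^bold>\<and> fm_meet 0 4 3))) \<longleftrightarrow>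
    (\<forall>f\<in>into C c. \<forall>y\<in>X (Dom C f).
       (f, y) \<in> \<sigma> 1 \<longleftrightarrow> (\<exists>x\<in>X (Dom C f). (f, x) \<in> \<sigma> 0 \<and> imeet (Dom C f) (res f (\<rho> 0)) x y))"
    (is "?l \<longleftrightarrow> ?r")
proof -
  let ?m = "\<lambda>f y. \<exists>x\<in>X (Dom C f). (f, x) \<in> \<sigma> 0 \<and> imeet (Dom C f) (res f (\<rho> 0)) x y"
  have key: "forces C L (Dom C g) (res g \<circ> (res f \<circ> \<rho>)(3 := y)) (pres g \<circ> (pres f \<circ> \<sigma>))
      (FEx 4 (4 \<^bold>\<in> 0 \<^bold>\<and> fm_meet 0 4 3)) \<longleftrightarrow> ?m (Cmp C f g) (res g y)"
    "forces C L (Dom C g) (res g \<circ> (res f \<circ> \<rho>)(3 := y)) (pres g \<circ> (pres f \<circ> \<sigma>)) (3 \<^bold>\<in> 1) \<longleftrightarrow>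
      (Cmp C f g, res g y) \<in> \<sigma> 1"
    if f: "f \<in> into C c" and y: "y \<in> X (Dom C f)" and g: "g \<in> into C (Dom C f)" for f y g
    using f g y v into_trans[OF f g]
    by (simp_all add: forces_simps(3,4,5) forces_meet mem_pres res_comp intoD cong: bex_cong)
  have "?l \<longleftrightarrow> (\<forall>f\<in>into C c. \<forall>y\<in>X (Dom C f). \<forall>g\<in>into C (Dom C f).
      (Cmp C f g, res g y) \<in> \<sigma> 1 \<longleftrightarrow> ?m (Cmp C f g) (res g y))"
    unfolding FIff_def forces_simps(4,6,7) using key by fastforce
  also have "\<dots> \<longleftrightarrow> ?r"
  proof
    assume l: "\<forall>f\<in>into C c. \<forall>y\<in>X (Dom C f). \<forall>g\<in>into C (Dom C f).
      (Cmp C f g, res g y) \<in> \<sigma> 1 \<longleftrightarrow> ?m (Cmp C f g) (res g y)"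
    show ?r
    proof (intro ballI)
      fix f y assume f: "f \<in> into C c" and y: "y \<in> X (Dom C f)"
      show "(f, y) \<in> \<sigma> 1 \<longleftrightarrow> ?m f y"
        using l[rule_format, OF f y into_id[OF into_dom[OF f]]] f y into_dom[OF f] by (simp add: intoD)
    qed
  next
    assume r: ?r
    show "\<forall>f\<in>into C c. \<forall>y\<in>X (Dom C f). \<forall>g\<in>into C (Dom C f).
      (Cmp C f g, res g y) \<in> \<sigma> 1 \<longleftrightarrow> ?m (Cmp C f g) (res g y)"
    proof (intro ballI)
      fix f y g assume "f \<in> into C c" "y \<in> X (Dom C f)" "g \<in> into C (Dom C f)"
      then show "(Cmp C f g, res g y) \<in> \<sigma> 1 \<longleftrightarrow> ?m (Cmp C f g) (res g y)"
        by (intro r[rule_format, OF into_comp]) auto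
    qed
  qed
  finally show ?thesis .
qed

definition distrib_at where
  "distrib_at c \<longleftrightarrow> (\<forall>S\<in>Pw c. \<forall>a\<in>X c. \<forall>s\<in>X c. \<forall>m\<in>X c. \<forall>B\<in>Pw c.
      iJoin c S s \<longrightarrow> imeet c a s m \<longrightarrow>
      (\<forall>f\<in>into C c. \<forall>y\<in>X (Dom C f).
        (f, y) \<in> B \<longleftrightarrow> (\<exists>x\<in>X (Dom C f). (f, x) \<in> S \<and> imeet (Dom C f) (res f a) x y)) \<longrightarrow>
      iJoin c B m)"

lemma valid_distrib: "valid C L fm_distrib \<longleftrightarrow> (\<forall>c\<in>Obj C. distrib_at c)" (is "?l \<longleftrightarrow> ?r")
proof
  assume l: ?l
  show ?r unfolding distrib_at_def
  proof (intro ballI impI)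
    fix c S a s m B
    assume c: "c \<in> Obj C" and v: "S \<in> Pw c" "a \<in> X c" "s \<in> X c" "m \<in> X c" "B \<in> Pw c"
      and "iJoin c S s" "imeet c a s m"
      "\<forall>f\<in>into C c. \<forall>y\<in>X (Dom C f).
        (f, y) \<in> B \<longleftrightarrow> (\<exists>x\<in>X (Dom C f). (f, x) \<in> S \<and> imeet (Dom C f) (res f a) x y)"
    note 1 = FAllD[OF c FAllD[OF c FAllD[OF c FAllPD[OF c validD[OF l[unfolded fm_distrib_def] c] v(1)] v(2)] v(3)] v(4)]
    show "iJoin c B m"
      using FImpD[OF c FAllPD[OF c FImpD[OF c 1] v(5)]] c v
        \<open>iJoin c S s\<close> \<open>imeet c a s m\<close> \<open>\<forall>f\<in>into C c. _ f\<close>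
      by (simp add: forces_distrib_set forces_Join forces_meet forces_simps(4) del: One_nat_def)
  qed
next
  assume r: ?r
  show ?l unfolding valid_def fm_distrib_def forces_FAll[of _ _ _ 0] forces_FAll[of _ _ _ 1] forces_FAll[of _ _ _ 2]
      forces_FAllP forces_FImp
  proof (intro ballI allI impI)
    \<comment> \<open>One arrow for each universal quantifier and implication: \<open>f1\<close> to
      \<open>f4\<close> introduce \<open>S\<close>, \<open>a\<close>, \<open>s\<close> and
      \<open>m\<close>, \<open>f5\<close> comes from the outer implication, \<open>f6\<close>
      introduces \<open>B\<close>, and \<open>f7\<close> comes from the inner implication. The
      hypotheses hold at \<open>f5\<close> and are carried to \<open>f7\<close> by
      \<open>iJoin_res\<close> and \<open>imeet_res\<close>.\<close>
    fix c \<rho> \<sigma> f1 S f2 a f3 s f4 m f5 f6 B f7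
    assume c: "c \<in> Obj C" and f1: "f1 \<in> into C c" and S: "S \<in> Pw (Dom C f1)" 
      and f2: "f2 \<in> into C (Dom C f1)" and a: "a \<in> X (Dom C f2)" 
      and f3: "f3 \<in> into C (Dom C f2)" and s: "s \<in> X (Dom C f3)"
      and f4: "f4 \<in> into C (Dom C f3)" and m: "m \<in> X (Dom C f4)"
      and f5: "f5 \<in> into C (Dom C f4)"
    let ?c = "Dom C f5" and ?S = "pres f5 (pres f4 (pres f3 (pres f2 S)))"
      and ?a = "res f5 (res f4 (res f3 a))" and ?s = "res f5 (res f4 s)" and ?m = "res f5 m"
    assume p: "forces C L (Dom C f5)
        (res f5 \<circ> (res f4 \<circ> (res f3 \<circ> (res f2 \<circ> (res f1 \<circ> \<rho>))(0 := a))(1 := s))(2 := m))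
        (pres f5 \<circ> (pres f4 \<circ> (pres f3 \<circ> (pres f2 \<circ> (pres f1 \<circ> \<sigma>)(0 := S)))))
        (fm_Join 0 1 \<^bold>\<and> fm_meet 0 1 2)"
    note ss = S f2 f3 f4 f5 a s m into_dom[OF f5]
    have p': "iJoin ?c ?S ?s" "imeet ?c ?a ?s ?m"
      using p ss by (simp_all add: forces_simps(4) forces_Join forces_meet del: One_nat_def)
    have cl: "?S \<in> Pw ?c" "?a \<in> X ?c" "?s \<in> X ?c" "?m \<in> X ?c" using ss by auto
    assume f6: "f6 \<in> into C (Dom C f5)" and B: "B \<in> Pw (Dom C f6)" and f7: "f7 \<in> into C (Dom C f6)"
    note o7 = into_dom[OF f7]
    let ?\<rho> = "res f7 \<circ> (res f6 \<circ> (res f5 \<circ> (res f4 \<circ> (res f3 \<circ> (res f2 \<circ> (res f1 \<circ> \<rho>))(0 := a))(1 := s))(2 := m)))"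
    let ?\<sigma> = "pres f7 \<circ> (pres f6 \<circ> (pres f5 \<circ> (pres f4 \<circ> (pres f3 \<circ> (pres f2 \<circ> (pres f1 \<circ> \<sigma>)(0 := S))))))(1 := B)"
    have e: "?\<rho> 0 = res f7 (res f6 ?a)" "?\<rho> 2 = res f7 (res f6 ?m)" "?\<sigma> 0 = pres f7 (pres f6 ?S)"
      "?\<sigma> 1 = pres f7 B" by simp_all
    have cl7: "?\<rho> 0 \<in> X (Dom C f7)" "?\<sigma> 0 \<in> Pw (Dom C f7)" "?\<sigma> 1 \<in> Pw (Dom C f7)" "?\<rho> 2 \<in> X (Dom C f7)"
      unfolding e using cl f6 f7 B by auto
    assume q: "forces C L (Dom C f7) ?\<rho> ?\<sigma> (FAll 3 (3 \<^bold>\<in> 1 \<^bold>\<longleftrightarrow> FEx 4 (4 \<^bold>\<in> 0 \<^bold>\<and> fm_meet 0 4 3)))"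
    have "iJoin (Dom C f7) (?\<sigma> 1) (?\<rho> 2)"
    proof (rule r[unfolded distrib_at_def, rule_format, OF o7, of "?\<sigma> 0" "?\<rho> 0" "res f7 (res f6 ?s)"])
      show "iJoin (Dom C f7) (?\<sigma> 0) (res f7 (res f6 ?s))"
        unfolding e by (rule iJoin_res[OF f7 res_closed[OF f6 cl(3)] iJoin_res[OF f6 cl(3) p'(1)]])
      show "imeet (Dom C f7) (?\<rho> 0) (res f7 (res f6 ?s)) (?\<rho> 2)"
        unfolding e by (rule imeet_res[OF f7 res_closed[OF f6 cl(2)] res_closed[OF f6 cl(3)]
            res_closed[OF f6 cl(4)] imeet_res[OF f6 cl(2,3,4) p'(2)]])
      show "(f, y) \<in> ?\<sigma> 1 \<longleftrightarrow> (\<exists>x\<in>X (Dom C f). (f, x) \<in> ?\<sigma> 0 \<and> imeet (Dom C f) (res f (?\<rho> 0)) x y)"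
        if "f \<in> into C (Dom C f7)" "y \<in> X (Dom C f)" for f y
        using q[unfolded forces_distrib_set[of "Dom C f7" ?\<rho> ?\<sigma>, OF o7 cl7(1-3)]] that by blast
    qed (use cl7 cl f6 f7 in auto)
    then show "forces C L (Dom C f7) ?\<rho> ?\<sigma> (fm_Join 1 2)"
      using forces_Join[of "Dom C f7" ?\<rho> 2 ?\<sigma> 1, OF o7 cl7(4,3)] by blast
  qed
qed

lemma valid_compact: "valid C L fm_compact \<longleftrightarrow> (\<forall>c\<in>Obj C. \<forall>S\<in>Pw c. \<forall>t\<in>X c.
     idirected c S \<longrightarrow> itop c t \<longrightarrow> iJoin c S t \<longrightarrow> (Idt C c, t) \<in> S)" (is "?l \<longleftrightarrow> ?r")
proof
  assume l: ?l
  show ?r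
  proof (intro ballI impI)
    fix c S t assume c: "c \<in> Obj C" and S: "S \<in> Pw c" and t: "t \<in> X c"
      and *: "idirected c S" "itop c t" "iJoin c S t"
    show "(Idt C c, t) \<in> S"
      using FImpD[OF c FAllD[OF c FAllPD[OF c validD[OF l[unfolded fm_compact_def] c] S] t]] c S t *
      by (simp add: forces_simps(3,4) forces_directed forces_top forces_Join)
  qed
next
  assume r: ?r
  show ?l unfolding valid_def fm_compact_def forces_simps(6-8)
  proof (intro ballI allI impI)
    fix c \<rho> \<sigma> f S g t h
    assume f: "f \<in> into C c" and S: "S \<in> Pw (Dom C f)" and g: "g \<in> into C (Dom C f)"
      and t: "t \<in> X (Dom C g)" and h: "h \<in> into C (Dom C g)"
      and p: "forces C L (Dom C h) (res h \<circ> (res g \<circ> (res f \<circ> \<rho>))(0 := t))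
         (pres h \<circ> (pres g \<circ> (pres f \<circ> \<sigma>)(0 := S))) (fm_directed 0 \<^bold>\<and> fm_top 0 \<^bold>\<and> fm_Join 0 0)"
    show "forces C L (Dom C h) (res h \<circ> (res g \<circ> (res f \<circ> \<rho>))(0 := t))
         (pres h \<circ> (pres g \<circ> (pres f \<circ> \<sigma>)(0 := S))) (0 \<^bold>\<in> 0)"
      using r[rule_format, OF into_dom[OF h], of "pres h (pres g S)" "res h t"] p f S g t h into_dom[OF h]
      by (simp add: forces_simps(3,4) forces_directed forces_top forces_Join)
  qed
qed

lemma forces_regular_set:
  assumes c: "c \<in> Obj C" and v: "\<rho> 0 \<in> X c" "\<sigma> 0 \<in> Pw c"
  shows "forces C L c \<rho> \<sigma> (FAll 1 (1 \<^bold>\<in> 0 \<^bold>\<longleftrightarrow> fm_well_inside 1 0)) \<longleftrightarrow>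
    (\<forall>f\<in>into C c. \<forall>x\<in>X (Dom C f). (f, x) \<in> \<sigma> 0 \<longleftrightarrow> iwell_inside (Dom C f) x (res f (\<rho> 0)))"
    (is "?l \<longleftrightarrow> ?r")
proof -
  let ?m = "\<lambda>f y. iwell_inside (Dom C f) y (res f (\<rho> 0))"
  have key: "forces C L (Dom C g) (res g \<circ> (res f \<circ> \<rho>)(1 := y)) (pres g \<circ> (pres f \<circ> \<sigma>))
      (fm_well_inside 1 0) \<longleftrightarrow> ?m (Cmp C f g) (res g y)"
    "forces C L (Dom C g) (res g \<circ> (res f \<circ> \<rho>)(1 := y)) (pres g \<circ> (pres f \<circ> \<sigma>)) (1 \<^bold>\<in> 0) \<longleftrightarrow>
      (Cmp C f g, res g y) \<in> \<sigma> 0"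
    if f: "f \<in> into C c" and y: "y \<in> X (Dom C f)" and g: "g \<in> into C (Dom C f)" for f y g
    using f g y v into_trans[OF f g]
    by (simp_all add: forces_simps(3) forces_well_inside mem_pres res_comp intoD del: One_nat_def)
  have "?l \<longleftrightarrow> (\<forall>f\<in>into C c. \<forall>y\<in>X (Dom C f). \<forall>g\<in>into C (Dom C f).
      (Cmp C f g, res g y) \<in> \<sigma> 0 \<longleftrightarrow> ?m (Cmp C f g) (res g y))"
    unfolding FIff_def forces_simps(4,6,7) using key by fastforce
  also have "\<dots> \<longleftrightarrow> ?r"
  proof
    assume l: "\<forall>f\<in>into C c. \<forall>y\<in>X (Dom C f). \<forall>g\<in>into C (Dom C f).
      (Cmp C f g, res g y) \<in> \<sigma> 0 \<longleftrightarrow> ?m (Cmp C f g) (res g y)"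
    show ?r
    proof (intro ballI)
      fix f y assume f: "f \<in> into C c" and y: "y \<in> X (Dom C f)"
      show "(f, y) \<in> \<sigma> 0 \<longleftrightarrow> ?m f y"
        using l[rule_format, OF f y into_id[OF into_dom[OF f]]] f y into_dom[OF f] by (simp add: intoD)
    qed
  next
    assume r: ?r
    show "\<forall>f\<in>into C c. \<forall>y\<in>X (Dom C f). \<forall>g\<in>into C (Dom C f).
      (Cmp C f g, res g y) \<in> \<sigma> 0 \<longleftrightarrow> ?m (Cmp C f g) (res g y)"
    proof (intro ballI)
      fix f y g assume "f \<in> into C c" "y \<in> X (Dom C f)" "g \<in> into C (Dom C f)"
      then show "(Cmp C f g, res g y) \<in> \<sigma> 0 \<longleftrightarrow> ?m (Cmp C f g) (res g y)"
        by (intro r[rule_format, OF into_comp]) auto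
    qed
  qed
  finally show ?thesis .
qed

lemma valid_regular: "valid C L fm_regular \<longleftrightarrow> (\<forall>c\<in>Obj C. \<forall>S\<in>Pw c. \<forall>b\<in>X c.
     (\<forall>f\<in>into C c. \<forall>x\<in>X (Dom C f). (f, x) \<in> S \<longleftrightarrow> iwell_inside (Dom C f) x (res f b)) \<longrightarrow> iJoin c S b)"
  (is "?l \<longleftrightarrow> ?r")
proof
  assume l: ?l
  show ?r
  proof (intro ballI impI)
    fix c S b assume c: "c \<in> Obj C" and S: "S \<in> Pw c" and b: "b \<in> X c"
      and *: "\<forall>f\<in>into C c. \<forall>x\<in>X (Dom C f). (f, x) \<in> S \<longleftrightarrow> iwell_inside (Dom C f) x (res f b)"
    show "iJoin c S b"
      using FImpD[OF c FAllPD[OF c FAllD[OF c validD[OF l[unfolded fm_regular_def] c] b] S]] c S b *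
      by (simp add: forces_regular_set forces_Join del: One_nat_def)
  qed
next
  assume r: ?r
  show ?l unfolding valid_def fm_regular_def forces_FAll[of _ _ _ 0] forces_FAllP forces_FImp[of _ _ _ "FAll 1 p" for p]
  proof (intro ballI allI impI)
    fix c \<rho> \<sigma> f b g S h
    assume f: "f \<in> into C c" and b: "b \<in> X (Dom C f)" and g: "g \<in> into C (Dom C f)"
      and S: "S \<in> Pw (Dom C g)" and h: "h \<in> into C (Dom C g)"
      and p: "forces C L (Dom C h) (res h \<circ> (res g \<circ> (res f \<circ> \<rho>)(0 := b)))
         (pres h \<circ> (pres g \<circ> (pres f \<circ> \<sigma>))(0 := S)) (FAll 1 (1 \<^bold>\<in> 0 \<^bold>\<longleftrightarrow> fm_well_inside 1 0))"
    show "forces C L (Dom C h) (res h \<circ> (res g \<circ> (res f \<circ> \<rho>)(0 := b)))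
         (pres h \<circ> (pres g \<circ> (pres f \<circ> \<sigma>))(0 := S)) (fm_Join 0 0)"
      using r[rule_format, OF into_dom[OF h], of "pres h S" "res h (res g b)"] p f S g b h into_dom[OF h]
      by (simp add: forces_regular_set forces_Join del: One_nat_def)
  qed
qed

lemma valid_iff_internal_kreg:
  "valid C L fm_frame \<and> valid C L fm_compact \<and> valid C L fm_regular \<longleftrightarrow> internal_kreg C U L"
  (is "?l \<longleftrightarrow> ?r")
proof
  assume ?l
  then have v: "valid C L fm_poset" "valid C L fm_complete" "valid C L fm_distrib"
    "valid C L fm_compact" "valid C L fm_regular"
    by (auto simp: fm_frame_def valid_FAnd)
  show ?r
  proof unfold_locales
    fix c assume c: "c \<in> Obj C"
    note po = v(1)[unfolded valid_poset, rule_format, OF c]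
    show "le c x x" if "x \<in> X c" for x using po that by blast
    show "x = y" if "le c x y" "le c y x" for x y
      using po that le_in[OF c that(1)] by blast
    show "le c x z" if "le c x y" "le c y z" for x y z
      using po that le_in[OF c that(1)] le_in[OF c that(2)] by blast
    show "\<exists>s\<in>X c. iJoin c S s" if "S \<in> Pw c" for S
      using v(2) c that by (simp add: valid_complete)
    show "iJoin c B m" if "S \<in> Pw c" "B \<in> Pw c" "a \<in> X c" "s \<in> X c" "m \<in> X c" "iJoin c S s" "imeet c a s m"
      "\<forall>f\<in>into C c. \<forall>y\<in>X (Dom C f).
        (f, y) \<in> B \<longleftrightarrow> (\<exists>x\<in>X (Dom C f). (f, x) \<in> S \<and> imeet (Dom C f) (res f a) x y)" for S B a s m
      by (rule v(3)[unfolded valid_distrib distrib_at_def, THEN bspec, OF c, THEN bspec, OF that(1), THEN bspec,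
            OF that(3), THEN bspec, OF that(4), THEN bspec, OF that(5), THEN bspec, OF that(2),
            THEN mp, OF that(6), THEN mp, OF that(7), THEN mp, OF that(8)])
    show "(Idt C c, t) \<in> S" if "S \<in> Pw c" "t \<in> X c" "idirected c S" "itop c t" "iJoin c S t" for S t
      using v(4) c that by (simp add: valid_compact)
    show "iJoin c S b" if "S \<in> Pw c" "b \<in> X c"
      "\<forall>f\<in>into C c. \<forall>x\<in>X (Dom C f). (f, x) \<in> S \<longleftrightarrow> iwell_inside (Dom C f) x (res f b)" for S b
      by (rule v(5)[unfolded valid_regular, THEN bspec, OF c, THEN bspec, OF that(1), THEN bspec, OF that(2),
            THEN mp, OF that(3)])
  qed
next
  assume ?r
  then interpret internal_kreg C U L .
  have "valid C L fm_poset"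
    unfolding valid_poset by (intro ballI conjI impI) (auto intro: le_refl le_antisym elim: le_trans)
  moreover have "valid C L fm_distrib"
    unfolding valid_distrib distrib_at_def by (intro ballI impI) (rule distrib)
  moreover have "valid C L fm_regular"
    unfolding valid_regular by (intro ballI impI) (rule regular)
  ultimately show ?l
    using complete compact by (simp add: fm_frame_def valid_FAnd valid_complete valid_compact)
qed

end

lemma internal_kreg_frame_iff:
  assumes "is_category C"
  shows "internal_kreg_frame U C L \<longleftrightarrow> internal_kreg C U L"
proof
  assume l: "internal_kreg_frame U C L"
  interpret psh_relation C U L
    by unfold_locales (use assms l in \<open>auto simp: internal_kreg_frame_def\<close>)
  show "internal_kreg C U L"
    using l valid_iff_internal_kreg by (auto simp: internal_kreg_frame_def)
next
  assume "internal_kreg C U L"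
  then interpret internal_kreg C U L .
  show "internal_kreg_frame U C L"
    using psh rel_subset rel_restrict valid_iff_internal_kreg internal_kreg_axioms
    unfolding internal_kreg_frame_def by blast
qed

section \<open>The stages of an internal compact regular frame\<close>

definition stage :: "('o, 'a, 'u) psh_rel \<Rightarrow> 'o \<Rightarrow> 'u gorder" where
  "stage L c = \<lparr>carrier = FObj (fst L) c, eq = (=), le = (\<lambda>x y. (x, y) \<in> snd L c)\<rparr>"

lemma stage_simps [simp]:
  "carrier (stage L c) = FObj (fst L) c" "x \<sqsubseteq>\<^bsub>stage L c\<^esub> y \<longleftrightarrow> (x, y) \<in> snd L c"
  by (simp_all add: stage_def)

context psh_relation
begin

text \<open>The subpresheaf generated by elements of a single stage. It turns subsets of
  \<open>X c\<close> into elements of the power object, so that internal joins and internal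
  compactness can be applied to them.\<close>

definition gen :: "'o \<Rightarrow> 'u set \<Rightarrow> ('a \<times> 'u) set" where
  "gen c A = {(f, y). f \<in> into C c \<and> (\<exists>x\<in>A. y = res f x)}"

lemma gen_Pw:
  assumes "A \<subseteq> X c"
  shows "gen c A \<in> Pw c"
proof (rule PwI)
  fix f y g assume "(f, y) \<in> gen c A" and g: "g \<in> into C (Dom C f)"
  then obtain x where "f \<in> into C c" "x \<in> A" "y = res f x" by (auto simp: gen_def)
  then show "(Cmp C f g, res g y) \<in> gen c A"
    using assms g res_comp[of f c g x] by (auto simp: gen_def intro!: bexI[of _ x])
qed (use assms in \<open>auto simp: gen_def\<close>)

lemma iub_gen:
  assumes "c \<in> Obj C" "A \<subseteq> X c" "u \<in> X c"
  shows "iub c (gen c A) u \<longleftrightarrow> (\<forall>x\<in>A. le c x u)"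
proof
  assume l: "iub c (gen c A) u"
  show "\<forall>x\<in>A. le c x u"
  proof
    fix x assume "x \<in> A"
    then have "(Idt C c, x) \<in> gen c A" using assms by (auto simp: gen_def intro!: bexI[of _ x])
    then show "le c x u" using l[unfolded iub_def, rule_format] assms by fastforce
  qed
qed (auto simp: iub_def gen_def le_res)

lemma pres_gen:
  assumes "f \<in> into C c" "A \<subseteq> X c"
  shows "pres f (gen c A) = gen (Dom C f) (res f ` A)"
proof -
  have "(g, y) \<in> pres f (gen c A) \<longleftrightarrow> (g, y) \<in> gen (Dom C f) (res f ` A)" for g y
  proof (cases "g \<in> into C (Dom C f)")
    case g: True
    have "(\<exists>x\<in>A. y = res (Cmp C f g) x) \<longleftrightarrow> (\<exists>x\<in>A. y = res g (res f x))"
      using res_comp[OF assms(1) g] assms(2) by (auto simp: subset_iff)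
    then show ?thesis using g assms(1) by (auto simp: mem_pres gen_def)
  qed (auto simp: mem_pres gen_def)
  then show ?thesis by auto
qed

text \<open>An upper bound of a generated set is an upper bound of its generators. Binary joins, and
  the bottom as the join of the empty set, thus inherit existence and uniqueness from
  \<open>iJoin\<close>.\<close>

lemma ijoin_iff_iJoin:
  assumes c: "c \<in> Obj C" and v: "a \<in> X c" "b \<in> X c" "j \<in> X c"
  shows "ijoin c a b j \<longleftrightarrow> iJoin c (gen c {a, b}) j"
proof -
  have "iub (Dom C f) (pres f (gen c {a, b})) u \<longleftrightarrow> le (Dom C f) (res f a) u \<and> le (Dom C f) (res f b) u"
    if "f \<in> into C c" "u \<in> X (Dom C f)" for f u
    using pres_gen[OF that(1), of "{a, b}"] iub_gen[OF into_dom[OF that(1)], of "{res f a, res f b}" u] that v by simp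
  then show ?thesis
    using iub_gen[OF c, of "{a, b}" j] v by (auto simp: ijoin_def iJoin_def)
qed

lemma ibot_iff_iJoin: "ibot c z \<longleftrightarrow> iJoin c {} z"
  by (auto simp: ibot_def iJoin_def iub_def mem_pres)

lemma empty_Pw: "{} \<in> Pw c"
  by (rule PwI) auto

end

section \<open>The stages as compact frames\<close>

context internal_kreg
begin

abbreviation St :: "'o \<Rightarrow> 'u gorder" where "St c \<equiv> stage L c"

lemma partial_order_stage: "c \<in> Obj C \<Longrightarrow> partial_order (St c)"
  by standard (auto simp: stage_def le_refl intro: le_antisym elim: le_trans)

lemma iJoin_le:
  assumes "c \<in> Obj C" "iJoin c S s" "s \<in> X c" "S \<in> Pw c" "u \<in> X c" "iub c S u"
  shows "le c s u"
proof -
  have "iub (Dom C (Idt C c)) (pres (Idt C c) S) u" using assms by simp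
  then show ?thesis
    using assms(2)[unfolded iJoin_def, THEN conjunct2, rule_format, OF into_id[OF assms(1)], of u] assms by simp
qed

lemma complete_lattice_stage:
  assumes "c \<in> Obj C"
  shows "complete_lattice (St c)"
proof (rule complete_latticeI_Sup[OF partial_order_stage[OF assms]])
  fix A assume "A \<subseteq> carrier (St c)"
  then have A: "A \<subseteq> X c" by simp
  obtain s where s: "s \<in> X c" "iJoin c (gen c A) s" using complete[OF assms gen_Pw[OF A]] by blast
  then have "\<forall>x\<in>A. le c x s" using iub_gen[OF assms A s(1)] by (auto simp: iJoin_def)
  moreover have "le c s u" if "u \<in> X c" "\<forall>x\<in>A. le c x u" for u
    using iJoin_le[OF assms s(2,1) gen_Pw[OF A] that(1)] iub_gen[OF assms A that(1)] that(2) by simp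
  ultimately show "\<exists>s\<in>carrier (St c). (\<forall>x\<in>A. x \<sqsubseteq>\<^bsub>St c\<^esub> s) \<and>
     (\<forall>u\<in>carrier (St c). (\<forall>x\<in>A. x \<sqsubseteq>\<^bsub>St c\<^esub> u) \<longrightarrow> s \<sqsubseteq>\<^bsub>St c\<^esub> u)"
    using s by auto
qed

lemma iJoin_unique:
  assumes "c \<in> Obj C" "S \<in> Pw c" "s \<in> X c" "s' \<in> X c" "iJoin c S s" "iJoin c S s'"
  shows "s = s'"
  using assms iJoin_le[OF assms(1,5,3,2,4)] iJoin_le[OF assms(1,6,4,2,3)]
  by (auto simp: iJoin_def intro: le_antisym)

lemma iJoin_gen:
  assumes c: "c \<in> Obj C" and A: "A \<subseteq> X c"
  shows "iJoin c (gen c A) (\<Squnion>\<^bsub>St c\<^esub> A)"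
proof -
  interpret complete_lattice "St c" by (rule complete_lattice_stage[OF c])
  obtain s where s: "s \<in> X c" "iJoin c (gen c A) s" using complete[OF c gen_Pw[OF A]] by blast
  have "\<Squnion>\<^bsub>St c\<^esub> A = s"
  proof (rule Sup_eqI)
    show "s \<sqsubseteq>\<^bsub>St c\<^esub> u" if "u \<in> carrier (St c)" "\<And>x. x \<in> A \<Longrightarrow> x \<sqsubseteq>\<^bsub>St c\<^esub> u" for u
      using iJoin_le[OF c s(2,1) gen_Pw[OF A], of u] iub_gen[OF c A, of u] that by simp
  qed (use s A iub_gen[OF c A s(1)] in \<open>auto simp: iJoin_def\<close>)
  then show ?thesis using s by simp
qed

lemma Sup_closed [simp]:
  assumes "c \<in> Obj C" "A \<subseteq> X c"
  shows "\<Squnion>\<^bsub>St c\<^esub> A \<in> X c"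
proof -
  interpret complete_lattice "St c" by (rule complete_lattice_stage[OF assms(1)])
  show ?thesis using sup_closed[of A] assms by simp
qed

text \<open>Internal joins are stable under restriction, and on generated sets they are the joins of
  the stage.\<close>

lemma res_Sup:
  assumes "f \<in> into C c" "A \<subseteq> X c"
  shows "res f (\<Squnion>\<^bsub>St c\<^esub> A) = \<Squnion>\<^bsub>St (Dom C f)\<^esub> (res f ` A)"
proof -
  have c: "c \<in> Obj C" "Dom C f \<in> Obj C" using assms by (auto simp: into_def)
  have A': "res f ` A \<subseteq> X (Dom C f)" using assms by auto
  show ?thesis
    using iJoin_res[OF assms(1) _ iJoin_gen[OF c(1) assms(2)]] assms c A' iJoin_gen[OF c(2) A']
    by (intro iJoin_unique[OF c(2) gen_Pw[OF A']]) (auto simp: pres_gen)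
qed

text \<open>A greatest element of a stage need not a priori restrict to greatest elements. The
  internal top does so by definition; it exists as the join of everything, and it is then the
  greatest element of the stage.\<close>

lemma itop_iff:
  assumes c: "c \<in> Obj C" and t: "t \<in> X c"
  shows "itop c t \<longleftrightarrow> t = \<top>\<^bsub>St c\<^esub>"
proof -
  interpret complete_lattice "St c" by (rule complete_lattice_stage[OF c])
  have *: "\<top>\<^bsub>St c\<^esub> = t" if t: "itop c t" "t \<in> X c" for t
  proof (rule top_eqI)
    show "x \<sqsubseteq>\<^bsub>St c\<^esub> t" if "x \<in> carrier (St c)" for x
      using t(1)[unfolded itop_def, rule_format, OF into_id[OF c], of x] that c t(2) by simp
  qed (use t in auto)
  let ?S = "{(f, x). f \<in> into C c \<and> x \<in> X (Dom C f)}"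
  have "?S \<in> Pw c" by (rule PwI) auto
  then obtain s where "s \<in> X c" "iJoin c ?S s" using complete[OF c] by blast
  then have "itop c s" "s \<in> X c" by (auto simp: iJoin_def iub_def itop_def)
  then show ?thesis using * t by metis
qed

lemma iJoin_gen_iff:
  assumes "c \<in> Obj C" "A \<subseteq> X c" "s \<in> X c"
  shows "iJoin c (gen c A) s \<longleftrightarrow> s = \<Squnion>\<^bsub>St c\<^esub> A"
  using iJoin_gen[OF assms(1,2)] iJoin_unique[OF assms(1) gen_Pw[OF assms(2)] assms(3) Sup_closed[OF assms(1,2)]]
  by blast

lemma ibot_iff:
  assumes c: "c \<in> Obj C" and z: "z \<in> X c"
  shows "ibot c z \<longleftrightarrow> z = \<bottom>\<^bsub>St c\<^esub>"
proof -
  interpret complete_lattice "St c" by (rule complete_lattice_stage[OF c])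
  have "gen c {} = {}" by (simp add: gen_def)
  then show ?thesis using iJoin_gen_iff[OF c _ z, of "{}"] by (simp add: ibot_iff_iJoin Sup_empty)
qed

text \<open>As for the top, completeness provides an internal meet. It is the join of the common
  lower bounds at all later stages, which together form a subpresheaf.\<close>

lemma imeet_iff:
  assumes c: "c \<in> Obj C" and a: "a \<in> X c" and b: "b \<in> X c" and m: "m \<in> X c"
  shows "imeet c a b m \<longleftrightarrow> m = a \<sqinter>\<^bsub>St c\<^esub> b"
proof -
  interpret complete_lattice "St c" by (rule complete_lattice_stage[OF c])
  have *: "a \<sqinter>\<^bsub>St c\<^esub> b = m" if m: "imeet c a b m" "m \<in> X c" for m
  proof (rule meet_eqI)
    show "x \<sqsubseteq>\<^bsub>St c\<^esub> m" if "x \<in> carrier (St c)" "x \<sqsubseteq>\<^bsub>St c\<^esub> a" "x \<sqsubseteq>\<^bsub>St c\<^esub> b" for x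
      using m(1)[unfolded imeet_def, THEN conjunct2, THEN conjunct2, rule_format, OF into_id[OF c], of x]
        that c a b m(2) by simp
  qed (use a b m in \<open>auto simp: imeet_def\<close>)
  let ?S = "{(f, x). f \<in> into C c \<and> le (Dom C f) x (res f a) \<and> le (Dom C f) x (res f b)}"
  have S: "?S \<in> Pw c"
  proof (rule PwI)
    fix f x g assume "(f, x) \<in> ?S" "g \<in> into C (Dom C f)"
    then show "(Cmp C f g, res g x) \<in> ?S"
      using a b by (auto simp: res_comp le_res)
  qed (auto dest: le_in(1)[rotated])
  then obtain s where s: "s \<in> X c" "iJoin c ?S s" using complete[OF c] by blast
  have "le c s a" "le c s b" by (rule iJoin_le[OF c s(2,1) S]; use a b in \<open>auto simp: iub_def\<close>)+
  then have "imeet c a b s" using s by (auto simp: iJoin_def iub_def imeet_def)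
  then show ?thesis using * m s(1) by metis
qed

lemma ijoin_iff:
  assumes "c \<in> Obj C" "a \<in> X c" "b \<in> X c" "j \<in> X c"
  shows "ijoin c a b j \<longleftrightarrow> j = a \<squnion>\<^bsub>St c\<^esub> b"
  using iJoin_gen_iff[of c "{a, b}" j] assms by (simp add: ijoin_iff_iJoin join_def)

lemma res_meet:
  assumes "f \<in> into C c" "a \<in> X c" "b \<in> X c"
  shows "res f (a \<sqinter>\<^bsub>St c\<^esub> b) = res f a \<sqinter>\<^bsub>St (Dom C f)\<^esub> res f b"
proof -
  have c: "c \<in> Obj C" "Dom C f \<in> Obj C" using assms by (auto simp: into_def)
  interpret complete_lattice "St c" by (rule complete_lattice_stage[OF c(1)])
  have m: "a \<sqinter>\<^bsub>St c\<^esub> b \<in> X c" using meet_closed[of a b] assms by simp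
  show ?thesis
    using imeet_res[OF assms m] imeet_iff[OF c(1) assms(2,3) m] imeet_iff[OF c(2), of "res f a" "res f b"] assms m
    by simp
qed

lemma res_top:
  assumes "f \<in> into C c"
  shows "res f \<top>\<^bsub>St c\<^esub> = \<top>\<^bsub>St (Dom C f)\<^esub>"
proof -
  have c: "c \<in> Obj C" "Dom C f \<in> Obj C" using assms by (auto simp: into_def)
  interpret complete_lattice "St c" by (rule complete_lattice_stage[OF c(1)])
  have m: "\<top>\<^bsub>St c\<^esub> \<in> X c" using top_closed by simp
  show ?thesis
    using itop_res[OF assms m] itop_iff[OF c(1) m] itop_iff[OF c(2) res_closed[OF assms m]] by simp
qed

lemma iJoinI:
  assumes "iub c S s" "\<And>f u. f \<in> into C c \<Longrightarrow> u \<in> X (Dom C f) \<Longrightarrow> iub (Dom C f) (pres f S) u \<Longrightarrow>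
    le (Dom C f) (res f s) u"
  shows "iJoin c S s"
  using assms by (simp add: iJoin_def)

text \<open>This is internal distributivity for the generated set \<open>gen c A\<close>.
  Restriction preserves meets, so the set of meets that the internal law refers to is generated by
  the meets taken at stage \<open>c\<close>.\<close>

lemma frm_stage:
  assumes c: "c \<in> Obj C"
  shows "frm (St c)"
proof -
  interpret complete_lattice "St c" by (rule complete_lattice_stage[OF c])
  show ?thesis
  proof unfold_locales
    fix a A assume a: "a \<in> carrier (St c)" and A: "A \<subseteq> carrier (St c)"
    let ?B = "(\<lambda>x. a \<sqinter>\<^bsub>St c\<^esub> x) ` A" and ?m = "a \<sqinter>\<^bsub>St c\<^esub> \<Squnion>\<^bsub>St c\<^esub> A"
    have aX: "a \<in> X c" and AX: "A \<subseteq> X c" using a A by auto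
    have mX: "?m \<in> X c" using a A c meet_closed[of a "\<Squnion>\<^bsub>St c\<^esub> A"] by simp
    have BX: "?B \<subseteq> X c" using a A meet_closed[of a] by auto
    have "iJoin c (gen c ?B) ?m"
    proof (rule distrib[OF c gen_Pw[OF AX] gen_Pw[OF BX] aX Sup_closed[OF c AX] mX iJoin_gen[OF c AX]])
      show "imeet c a (\<Squnion>\<^bsub>St c\<^esub> A) ?m" using imeet_iff[OF c aX Sup_closed[OF c AX] mX] by simp
      show "\<forall>f\<in>into C c. \<forall>y\<in>X (Dom C f). (f, y) \<in> gen c ?B \<longleftrightarrow>
          (\<exists>x\<in>X (Dom C f). (f, x) \<in> gen c A \<and> imeet (Dom C f) (res f a) x y)"
      proof (intro ballI)
        fix f y assume f: "f \<in> into C c" and y: "y \<in> X (Dom C f)"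
        have "(\<exists>x\<in>X (Dom C f). (f, x) \<in> gen c A \<and> imeet (Dom C f) (res f a) x y) \<longleftrightarrow>
            (\<exists>x\<in>A. imeet (Dom C f) (res f a) (res f x) y)"
          using f AX by (auto simp: gen_def)
        also have "\<dots> \<longleftrightarrow> (\<exists>x\<in>A. y = res f (a \<sqinter>\<^bsub>St c\<^esub> x))"
        proof (rule bex_cong[OF HOL.refl])
          fix x assume "x \<in> A"
          then have x: "x \<in> X c" using AX by auto
          show "imeet (Dom C f) (res f a) (res f x) y \<longleftrightarrow> y = res f (a \<sqinter>\<^bsub>St c\<^esub> x)"
            using f x aX y by (simp add: res_meet imeet_iff into_dom[OF f])
        qed
        also have "\<dots> \<longleftrightarrow> (f, y) \<in> gen c ?B" using f by (auto simp: gen_def)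
        finally show "(f, y) \<in> gen c ?B \<longleftrightarrow>
          (\<exists>x\<in>X (Dom C f). (f, x) \<in> gen c A \<and> imeet (Dom C f) (res f a) x y)" by simp
      qed
    qed
    then show "?m = \<Squnion>\<^bsub>St c\<^esub> ?B"
      by (rule iJoin_unique[OF c gen_Pw[OF BX] mX Sup_closed[OF c BX] _ iJoin_gen[OF c BX]])
  qed
qed

lemma frm_hom_res:
  assumes "f \<in> into C c"
  shows "frm_hom (St c) (St (Dom C f)) (res f)"
proof -
  have c: "c \<in> Obj C" "Dom C f \<in> Obj C" using assms by (auto simp: into_def)
  interpret A: frm "St c" by (rule frm_stage[OF c(1)])
  interpret B: frm "St (Dom C f)" by (rule frm_stage[OF c(2)])
  show ?thesis
    by unfold_locales (use assms in \<open>auto simp: frame_hom_def res_top res_meet res_Sup\<close>)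
qed

text \<open>Top, bottom, binary meets and binary joins are stagewise, and the complement is sought
  at the stage itself. Internal and stagewise regularity therefore differ only in the join that they
  take.\<close>

lemma iwell_inside_iff:
  assumes c: "c \<in> Obj C" and v: "a \<in> X c" "b \<in> X c"
  shows "iwell_inside c a b \<longleftrightarrow> well_inside (St c) a b"
proof -
  interpret frm "St c" by (rule frm_stage[OF c])
  have "\<top>\<^bsub>St c\<^esub> \<in> X c" "\<bottom>\<^bsub>St c\<^esub> \<in> X c" using top_closed bottom_closed by auto
  then show ?thesis
    using c v unfolding iwell_inside_def well_inside_def
    by (auto simp: itop_iff ibot_iff imeet_iff ijoin_iff eq_commute[of "\<bottom>\<^bsub>St c\<^esub>"] eq_commute[of "\<top>\<^bsub>St c\<^esub>"]
        cong: bex_cong)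
qed

text \<open>A directed subset of the stage generates an internally directed set, because bounds
  found at \<open>c\<close> restrict to bounds later on. Internal compactness returns a member over
  the identity arrow, and those are exactly the elements of \<open>A\<close>.\<close>

lemma compact_frame_stage:
  assumes c: "c \<in> Obj C"
  shows "compact_frame (St c)"
  unfolding compact_frame_def
proof (intro allI impI)
  interpret frm "St c" by (rule frm_stage[OF c])
  fix A assume "A \<subseteq> carrier (St c)" and d: "directed_in (St c) A" and s: "\<Squnion>\<^bsub>St c\<^esub> A = \<top>\<^bsub>St c\<^esub>"
  then have A: "A \<subseteq> X c" by simp
  have t: "\<top>\<^bsub>St c\<^esub> \<in> X c" using top_closed by simp
  have "idirected c (gen c A)" unfolding idirected_def
  proof (intro conjI allI impI)
    obtain x where "x \<in> A" using d by (auto simp: directed_in_def)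
    then show "\<exists>x\<in>X c. (Idt C c, x) \<in> gen c A"
      using A c by (intro bexI[of _ x]) (auto simp: gen_def intro!: bexI[of _ x])
    fix f x y assume "(f, x) \<in> gen c A" "(f, y) \<in> gen c A"
    then obtain x' y' where f: "f \<in> into C c" and x': "x' \<in> A" "y' \<in> A" "x = res f x'" "y = res f y'"
      by (auto simp: gen_def)
    then obtain z where z: "z \<in> A" "le c x' z" "le c y' z" using d by (auto simp: directed_in_def)
    show "\<exists>z. (f, z) \<in> gen c A \<and> le (Dom C f) x z \<and> le (Dom C f) y z"
      by (rule exI[of _ "res f z"]) (use f x' z in \<open>auto simp: gen_def le_res\<close>)
  qed
  then have "(Idt C c, \<top>\<^bsub>St c\<^esub>) \<in> gen c A"
    using iJoin_gen[OF c A] s by (intro compact[OF c gen_Pw[OF A] t]) (auto simp: itop_iff[OF c t])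
  then show "\<top>\<^bsub>St c\<^esub> \<in> A" using A c by (auto simp: gen_def)
qed

section \<open>Normality of the stages\<close>

definition below :: "'o \<Rightarrow> 'u \<Rightarrow> ('a \<times> 'u) set" where
  "below c u = {(f, x). f \<in> into C c \<and> x \<in> X (Dom C f) \<and> well_inside (St (Dom C f)) x (res f u)}"

lemma below_Pw:
  assumes "u \<in> X c"
  shows "below c u \<in> Pw c"
proof (rule PwI)
  fix f x g assume "(f, x) \<in> below c u" and g: "g \<in> into C (Dom C f)"
  then have f: "f \<in> into C c" "x \<in> X (Dom C f)" "well_inside (St (Dom C f)) x (res f u)"
    by (auto simp: below_def)
  interpret frm_hom "St (Dom C f)" "St (Dom C g)" "res g" by (rule frm_hom_res[OF g])
  show "(Cmp C f g, res g x) \<in> below c u"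
    using h_well_inside[of x "res f u"] f g assms by (auto simp: below_def res_comp)
qed (auto simp: below_def)

lemma iJoin_below:
  assumes c: "c \<in> Obj C" and u: "u \<in> X c"
  shows "iJoin c (below c u) u"
  by (rule regular[OF c below_Pw[OF u] u]) (use u in \<open>auto simp: below_def iwell_inside_iff into_dom\<close>)

lemma normal_frm_stage:
  assumes c: "c \<in> Obj C"
  shows "normal_frm (St c)"
proof -
  interpret S: frm "St c" by (rule frm_stage[OF c])
  show ?thesis
  proof unfold_locales
    fix u w assume uw: "u \<in> carrier (St c)" "w \<in> carrier (St c)" "u \<squnion>\<^bsub>St c\<^esub> w = \<top>\<^bsub>St c\<^esub>"
    then have u: "u \<in> X c" and w: "w \<in> X c" by auto
    let ?T = "{(f, y). \<exists>x. (f, x) \<in> below c u \<and> y = x \<squnion>\<^bsub>St (Dom C f)\<^esub> res f w}"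
    have jc: "x \<squnion>\<^bsub>St d\<^esub> y \<in> X d" "le d x (x \<squnion>\<^bsub>St d\<^esub> y)" "le d y (x \<squnion>\<^bsub>St d\<^esub> y)"
      "\<And>z. le d x z \<Longrightarrow> le d y z \<Longrightarrow> le d (x \<squnion>\<^bsub>St d\<^esub> y) z"
      if d: "d \<in> Obj C" and xy: "x \<in> X d" "y \<in> X d" for d x y
    proof -
      interpret D: frm "St d" by (rule frm_stage[OF d])
      show "x \<squnion>\<^bsub>St d\<^esub> y \<in> X d" "le d x (x \<squnion>\<^bsub>St d\<^esub> y)" "le d y (x \<squnion>\<^bsub>St d\<^esub> y)"
        using D.join_closed[of x y] D.join_left[of x y] D.join_right[of x y] xy by auto
      show "le d (x \<squnion>\<^bsub>St d\<^esub> y) z" if "le d x z" "le d y z" for z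
        using D.join_le[of x z y] that xy le_in[OF d that(1)] by auto
    qed
    \<comment> \<open>The bottom is well inside everything. It makes \<open>?T\<close> inhabited,
      and later it shows that upper bounds of \<open>?T\<close> dominate the restrictions of
      \<open>w\<close>.\<close>
    have bot: "(f, \<bottom>\<^bsub>St (Dom C f)\<^esub>) \<in> below c u" if f: "f \<in> into C c" for f
    proof -
      interpret D: frm "St (Dom C f)" by (rule frm_stage[OF into_dom[OF f]])
      show ?thesis using D.well_inside_bottom[of "res f u"] D.bottom_closed f u by (auto simp: below_def)
    qed
    have botX: "\<bottom>\<^bsub>St (Dom C f)\<^esub> \<in> X (Dom C f)" if f: "f \<in> into C c" for f
      using bot[OF f] by (simp add: below_def)
    have B: "f \<in> into C c" "x \<in> X (Dom C f)" "Dom C f \<in> Obj C" if "(f, x) \<in> below c u" for f x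
      using that by (auto simp: below_def)
    have T: "?T \<in> Pw c"
    proof (rule PwI)
      fix f y g assume "(f, y) \<in> ?T" and g: "g \<in> into C (Dom C f)"
      then obtain x where x: "(f, x) \<in> below c u" and y: "y = x \<squnion>\<^bsub>St (Dom C f)\<^esub> res f w" by auto
      interpret frm_hom "St (Dom C f)" "St (Dom C g)" "res g" by (rule frm_hom_res[OF g])
      show "(Cmp C f g, res g y) \<in> ?T"
        using PwD(3)[OF below_Pw[OF u] x g] h_join[of x "res f w"] B[OF x] w g
        by (auto simp: y res_comp)
    qed (use w in \<open>auto intro!: jc(1) dest: B\<close>)
    have tX: "\<top>\<^bsub>St c\<^esub> \<in> X c" using S.top_closed by simp
    \<comment> \<open>Membership over the identity is the point: it produces an element well inside
      \<open>u\<close> at the stage \<open>c\<close> itself, although the internal join that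
      represents \<open>u\<close> ranges over all later stages.\<close>
    have "(Idt C c, \<top>\<^bsub>St c\<^esub>) \<in> ?T"
    proof (rule compact[OF c T tX])
      show "idirected c ?T" unfolding idirected_def
      proof (intro conjI allI impI)
        show "\<exists>x\<in>X c. (Idt C c, x) \<in> ?T"
          using bot[OF into_id[OF c]] PwD(2)[OF T, of "Idt C c"] c by fastforce
        fix f x y assume "(f, x) \<in> ?T" "(f, y) \<in> ?T"
        then obtain x' y' where x': "(f, x') \<in> below c u" "x = x' \<squnion>\<^bsub>St (Dom C f)\<^esub> res f w"
          and y': "(f, y') \<in> below c u" "y = y' \<squnion>\<^bsub>St (Dom C f)\<^esub> res f w" by auto
        interpret D: frm "St (Dom C f)" by (rule frm_stage[OF B(3)[OF x'(1)]])
        let ?z = "x' \<squnion>\<^bsub>St (Dom C f)\<^esub> y'"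
        have "(f, ?z) \<in> below c u"
          using x'(1) y'(1) u D.well_inside_join[of x' "res f u" y'] D.join_closed[of x' y'] by (auto simp: below_def)
        moreover have "le (Dom C f) x (?z \<squnion>\<^bsub>St (Dom C f)\<^esub> res f w)" "le (Dom C f) y (?z \<squnion>\<^bsub>St (Dom C f)\<^esub> res f w)"
          using D.join_mono[of x' "res f w" ?z "res f w"] D.join_mono[of y' "res f w" ?z "res f w"]
            B[OF x'(1)] B[OF y'(1)] w D.join_closed[of x' y'] jc[of "Dom C f" x' y'] x'(2) y'(2)
          by (auto simp: le_refl)
        ultimately show "\<exists>z. (f, z) \<in> ?T \<and> le (Dom C f) x z \<and> le (Dom C f) y z" by blast
      qed
      show "itop c \<top>\<^bsub>St c\<^esub>" using itop_iff[OF c tX] by simp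
      show "iJoin c ?T \<top>\<^bsub>St c\<^esub>"
      proof (rule iJoinI)
        show "iub c ?T \<top>\<^bsub>St c\<^esub>"
          using itop_iff[OF c tX] PwD[OF T] by (auto simp: iub_def itop_def)
        \<comment> \<open>An upper bound of \<open>?T\<close> dominates all elements well inside
          \<open>u\<close>, hence \<open>u\<close> by internal regularity, and it dominates
          \<open>w\<close>. So it dominates the restriction of \<open>u \<squnion> w\<close>, which
          is the top.\<close>
        fix f v assume f: "f \<in> into C c" and v: "v \<in> X (Dom C f)" and ub: "iub (Dom C f) (pres f ?T) v"
        have ub': "le (Dom C g) (x \<squnion>\<^bsub>St (Dom C g)\<^esub> res g (res f w)) (res g v)"
          if g: "g \<in> into C (Dom C f)" "(Cmp C f g, x) \<in> below c u" for g x
        proof -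
          have "(Cmp C f g, x \<squnion>\<^bsub>St (Dom C g)\<^esub> res g (res f w)) \<in> ?T"
            using g w f by (auto simp: res_comp)
          then show ?thesis using ub g by (auto simp: iub_def mem_pres)
        qed
        have d: "Dom C f \<in> Obj C" using f by auto
        have "le (Dom C f) (res f u) v"
        proof (rule iJoin_le[OF d iJoin_res[OF f u iJoin_below[OF c u]] _ _ v])
          show "iub (Dom C f) (pres f (below c u)) v" unfolding iub_def
          proof (intro allI impI)
            fix g x assume "(g, x) \<in> pres f (below c u)"
            then have g: "g \<in> into C (Dom C f)" "(Cmp C f g, x) \<in> below c u" by (auto simp: mem_pres)
            have "x \<in> X (Dom C g)" using B[OF g(2)] f g(1) by simp
            then have "le (Dom C g) x (x \<squnion>\<^bsub>St (Dom C g)\<^esub> res g (res f w))"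
              using jc(2)[of "Dom C g" x "res g (res f w)"] f g w by auto
            then show "le (Dom C g) x (res g v)" using le_trans[OF _ _ ub'[OF g]] g by auto
          qed
        qed (use f u below_Pw[OF u] in auto)
        moreover have "le (Dom C f) (res f w) v"
        proof -
          have "(Cmp C f (Idt C (Dom C f)), \<bottom>\<^bsub>St (Dom C f)\<^esub>) \<in> below c u" using bot[OF f] f by (simp add: intoD)
          from ub'[OF into_id[OF d] this]
          have "le (Dom C f) (\<bottom>\<^bsub>St (Dom C f)\<^esub> \<squnion>\<^bsub>St (Dom C f)\<^esub> res f w) v" using d f w v by simp
          then show ?thesis using le_trans[OF d jc(3)[OF d botX[OF f], of "res f w"]] f w by auto
        qed
        ultimately have "le (Dom C f) (res f u \<squnion>\<^bsub>St (Dom C f)\<^esub> res f w) v"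
          using jc(4)[OF d, of "res f u" "res f w"] f u w by auto
        moreover interpret frm_hom "St c" "St (Dom C f)" "res f" by (rule frm_hom_res[OF f])
        have "res f \<top>\<^bsub>St c\<^esub> = res f u \<squnion>\<^bsub>St (Dom C f)\<^esub> res f w"
          using h_join[of u w] uw by simp
        ultimately show "le (Dom C f) (res f \<top>\<^bsub>St c\<^esub>) v" by simp
      qed
    qed
    then obtain x where "(Idt C c, x) \<in> below c u" "\<top>\<^bsub>St c\<^esub> = x \<squnion>\<^bsub>St c\<^esub> w" using c w by auto
    then show "\<exists>v\<in>carrier (St c). well_inside (St c) v u \<and> v \<squnion>\<^bsub>St c\<^esub> w = \<top>\<^bsub>St c\<^esub>"
      using c u by (auto simp: below_def intro!: bexI[of _ x])
  qed
qed

end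

section \<open>Representation by lax families\<close>

text \<open>\<open>L\<close> is lax-represented by a presheaf \<open>K\<close> of compact regular frames if \<open>L(c)\<close> is, via
  \<open>x \<mapsto> (r (f\<^sup>* x))\<^sub>f\<close>, the poset of families \<open>(u\<^sub>f)\<close> indexed by the arrows \<open>f : d \<rightarrow> c\<close> with
  \<open>u\<^sub>f \<in> K(d)\<close> and \<open>g\<^sup>* u\<^sub>f \<le> u\<^bsub>fg\<^esub>\<close>. The families with equality here, which are
  determined by \<open>u\<^bsub>id\<^esub> \<in> K(c)\<close>, are then the regular elements of \<open>L(c)\<close>.\<close>

locale lax_rep = psh_relation C U L for C :: "('o, 'a) category" and U :: "'u set set" and L +
  fixes K :: "'o \<Rightarrow> 'u gorder" and kr :: "'a \<Rightarrow> 'u \<Rightarrow> 'u" and r :: "'o \<Rightarrow> 'u \<Rightarrow> 'u"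
  assumes K_frm: "c \<in> Obj C \<Longrightarrow> frm (K c)"
    and K_compact: "c \<in> Obj C \<Longrightarrow> compact_frame (K c)"
    and K_regular: "c \<in> Obj C \<Longrightarrow> regular_frame (K c)"
    and kr_hom: "f \<in> into C c \<Longrightarrow> frm_hom (K c) (K (Dom C f)) (kr f)"
    and kr_id: "c \<in> Obj C \<Longrightarrow> x \<in> carrier (K c) \<Longrightarrow> kr (Idt C c) x = x"
    and kr_comp: "f \<in> into C c \<Longrightarrow> g \<in> into C (Dom C f) \<Longrightarrow> x \<in> carrier (K c) \<Longrightarrow>
      kr (Cmp C f g) x = kr g (kr f x)"
    and r_closed: "c \<in> Obj C \<Longrightarrow> x \<in> X c \<Longrightarrow> r c x \<in> carrier (K c)"
    and r_le: "c \<in> Obj C \<Longrightarrow> x \<in> X c \<Longrightarrow> y \<in> X c \<Longrightarrow>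
      le c x y \<longleftrightarrow> (\<forall>f\<in>into C c. r (Dom C f) (res f x) \<sqsubseteq>\<^bsub>K (Dom C f)\<^esub> r (Dom C f) (res f y))"
    and r_inj: "c \<in> Obj C \<Longrightarrow> x \<in> X c \<Longrightarrow> y \<in> X c \<Longrightarrow>
      (\<And>f. f \<in> into C c \<Longrightarrow> r (Dom C f) (res f x) = r (Dom C f) (res f y)) \<Longrightarrow> x = y"
    and r_lax: "f \<in> into C c \<Longrightarrow> x \<in> X c \<Longrightarrow> kr f (r c x) \<sqsubseteq>\<^bsub>K (Dom C f)\<^esub> r (Dom C f) (res f x)"
    and r_surj: "c \<in> Obj C \<Longrightarrow> (\<And>f. f \<in> into C c \<Longrightarrow> u f \<in> carrier (K (Dom C f))) \<Longrightarrow>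
      (\<And>f g. f \<in> into C c \<Longrightarrow> g \<in> into C (Dom C f) \<Longrightarrow> kr g (u f) \<sqsubseteq>\<^bsub>K (Dom C g)\<^esub> u (Cmp C f g)) \<Longrightarrow>
      \<exists>x\<in>X c. \<forall>f\<in>into C c. r (Dom C f) (res f x) = u f"
begin

text \<open>The member at \<open>f\<close> of the lax family that represents
  \<open>x\<close>.\<close>

definition comp_at :: "'u \<Rightarrow> 'a \<Rightarrow> 'u" where
  "comp_at x f = r (Dom C f) (res f x)"

lemma comp_at_closed [simp, intro]: "f \<in> into C c \<Longrightarrow> x \<in> X c \<Longrightarrow> comp_at x f \<in> carrier (K (Dom C f))"
  by (auto simp: comp_at_def intro!: r_closed)

lemma comp_at_res: "f \<in> into C c \<Longrightarrow> g \<in> into C (Dom C f) \<Longrightarrow> x \<in> X c \<Longrightarrow>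
    comp_at (res f x) g = comp_at x (Cmp C f g)"
  by (simp add: comp_at_def res_comp)

lemma comp_at_id: "c \<in> Obj C \<Longrightarrow> x \<in> X c \<Longrightarrow> comp_at x (Idt C c) = r c x"
  by (simp add: comp_at_def)

lemma le_iff: "c \<in> Obj C \<Longrightarrow> x \<in> X c \<Longrightarrow> y \<in> X c \<Longrightarrow>
    le c x y \<longleftrightarrow> (\<forall>f\<in>into C c. comp_at x f \<sqsubseteq>\<^bsub>K (Dom C f)\<^esub> comp_at y f)"
  by (simp add: r_le comp_at_def)

lemma eqI: "c \<in> Obj C \<Longrightarrow> x \<in> X c \<Longrightarrow> y \<in> X c \<Longrightarrow>
    (\<And>f. f \<in> into C c \<Longrightarrow> comp_at x f = comp_at y f) \<Longrightarrow> x = y"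
  by (rule r_inj) (auto simp: comp_at_def)

lemma comp_at_lax:
  assumes "f \<in> into C c" "g \<in> into C (Dom C f)" "x \<in> X c"
  shows "kr g (comp_at x f) \<sqsubseteq>\<^bsub>K (Dom C g)\<^esub> comp_at x (Cmp C f g)"
  using r_lax[OF assms(2), of "res f x"] assms by (simp add: comp_at_def res_comp)

lemma lax_rep_le_refl: "c \<in> Obj C \<Longrightarrow> x \<in> X c \<Longrightarrow> le c x x"
proof -
  assume c: "c \<in> Obj C" and x: "x \<in> X c"
  have "comp_at x f \<sqsubseteq>\<^bsub>K (Dom C f)\<^esub> comp_at x f" if f: "f \<in> into C c" for f
  proof -
    interpret frm "K (Dom C f)" by (rule K_frm[OF into_dom[OF f]])
    show ?thesis using f x by auto
  qed
  then show ?thesis using le_iff[OF c x x] by simp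
qed

lemma comp_at_antisym:
  assumes "c \<in> Obj C" "le c x y" "le c y x" "f \<in> into C c"
  shows "comp_at x f = comp_at y f"
proof -
  interpret frm "K (Dom C f)" by (rule K_frm[OF into_dom[OF assms(4)]])
  have "x \<in> X c" "y \<in> X c" using le_in[OF assms(1,2)] .
  then show ?thesis using assms le_iff by (intro le_antisym) auto
qed

lemma lax_rep_le_antisym:
  assumes "c \<in> Obj C" "le c x y" "le c y x"
  shows "x = y"
  by (rule eqI[OF assms(1) le_in[OF assms(1,2)]]) (rule comp_at_antisym[OF assms])

lemma lax_rep_le_trans:
  assumes "c \<in> Obj C" "le c x y" "le c y z"
  shows "le c x z"
proof -
  have v: "x \<in> X c" "y \<in> X c" "z \<in> X c" using le_in[OF assms(1)] assms by blast+
  have "comp_at x f \<sqsubseteq>\<^bsub>K (Dom C f)\<^esub> comp_at z f" if f: "f \<in> into C c" for f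
  proof -
    interpret frm "K (Dom C f)" by (rule K_frm[OF into_dom[OF f]])
    show ?thesis
      by (rule le_trans[of _ "comp_at y f"]) (use f v assms le_iff in auto)
  qed
  then show ?thesis using v assms(1) by (simp add: le_iff)
qed

lemma realize:
  assumes "c \<in> Obj C" "\<And>f. f \<in> into C c \<Longrightarrow> u f \<in> carrier (K (Dom C f))"
    "\<And>f g. f \<in> into C c \<Longrightarrow> g \<in> into C (Dom C f) \<Longrightarrow> kr g (u f) \<sqsubseteq>\<^bsub>K (Dom C g)\<^esub> u (Cmp C f g)"
  obtains x where "x \<in> X c" "\<And>f. f \<in> into C c \<Longrightarrow> comp_at x f = u f"
  using r_surj[of c u, OF assms] that by (auto simp: comp_at_def)

section \<open>Operations on lax families are componentwise\<close>

abbreviation vals :: "('a \<times> 'u) set \<Rightarrow> 'a \<Rightarrow> 'u set" where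
  "vals S f \<equiv> r (Dom C f) ` {x. (f, x) \<in> S}"

lemma vals_closed: "S \<in> Pw c \<Longrightarrow> f \<in> into C c \<Longrightarrow> vals S f \<subseteq> carrier (K (Dom C f))"
  by (auto intro!: r_closed dest: PwD)

text \<open>Since \<open>S\<close> is closed under restriction, an element of \<open>S\<close> at
  \<open>f\<close> reappears in the value sets at every \<open>Cmp C f g\<close>. No value has to be
  pushed forward from an earlier stage, and the componentwise joins already bound
  \<open>S\<close>.\<close>

lemma iJoin_if_comp:
  assumes c: "c \<in> Obj C" and S: "S \<in> Pw c" and s: "s \<in> X c"
    and eq: "\<And>f. f \<in> into C c \<Longrightarrow> comp_at s f = \<Squnion>\<^bsub>K (Dom C f)\<^esub> vals S f"
  shows "iJoin c S s"
  unfolding iJoin_def iub_def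
proof (intro conjI allI ballI impI)
  fix f x assume fx: "(f, x) \<in> S"
  note f = PwD[OF S fx]
  have "comp_at x g \<sqsubseteq>\<^bsub>K (Dom C g)\<^esub> comp_at (res f s) g" if g: "g \<in> into C (Dom C f)" for g
  proof -
    interpret frm "K (Dom C g)" by (rule K_frm[OF into_dom[OF g]])
    have fg: "Cmp C f g \<in> into C c" using f(1) g by (rule into_comp)
    have "comp_at x g \<in> vals S (Cmp C f g)" using f(3)[OF g] f(1) g by (auto simp: comp_at_def)
    then show ?thesis
      using sup_upper[of "vals S (Cmp C f g)" "comp_at x g"] vals_closed[OF S fg] f(1) g s eq[OF fg]
      by (simp add: comp_at_res)
  qed
  then show "le (Dom C f) x (res f s)" using f s by (simp add: le_iff into_dom)
next
  fix f u assume f: "f \<in> into C c" and u: "u \<in> X (Dom C f)"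
    and ub: "\<forall>g x. (g, x) \<in> pres f S \<longrightarrow> le (Dom C g) x (res g u)"
  have "comp_at (res f s) g \<sqsubseteq>\<^bsub>K (Dom C g)\<^esub> comp_at u g" if g: "g \<in> into C (Dom C f)" for g
  proof -
    interpret frm "K (Dom C g)" by (rule K_frm[OF into_dom[OF g]])
    have fg: "Cmp C f g \<in> into C c" using f g by (rule into_comp)
    have "\<Squnion>\<^bsub>K (Dom C g)\<^esub> vals S (Cmp C f g) \<sqsubseteq>\<^bsub>K (Dom C g)\<^esub> comp_at u g"
    proof (rule sup_least)
      fix y assume "y \<in> vals S (Cmp C f g)"
      then obtain x where x: "(Cmp C f g, x) \<in> S" "y = r (Dom C g) x" using f g by auto
      have xX: "x \<in> X (Dom C g)" using PwD(2)[OF S x(1)] f g by simp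
      have "le (Dom C g) x (res g u)" using ub x(1) g by (auto simp: mem_pres)
      then show "y \<sqsubseteq>\<^bsub>K (Dom C g)\<^esub> comp_at u g"
        using le_iff[OF into_dom[OF g] xX res_closed[OF g u]] into_id[OF into_dom[OF g]] xX g u x(2)
        by (auto simp: comp_at_id into_dom[OF g] comp_at_def dest!: bspec)
    qed (use vals_closed[OF S fg] f g u in auto)
    then show ?thesis using eq[OF fg] f g s by (simp add: comp_at_res)
  qed
  then show "le (Dom C f) (res f s) u" using f s u by (simp add: le_iff into_dom)
qed

text \<open>The transition maps preserve joins, and \<open>r_lax\<close> puts the image of the value
  of \<open>x\<close> below the value of its restriction, which again belongs to \<open>S\<close>.
  Hence the componentwise joins form a lax family.\<close>

lemma Join_comp_ex:
  assumes c: "c \<in> Obj C" and S: "S \<in> Pw c"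
  obtains s where "s \<in> X c" "\<And>f. f \<in> into C c \<Longrightarrow> comp_at s f = \<Squnion>\<^bsub>K (Dom C f)\<^esub> vals S f"
proof (rule realize[OF c, of "\<lambda>f. \<Squnion>\<^bsub>K (Dom C f)\<^esub> vals S f"])
  fix f assume f: "f \<in> into C c"
  interpret F: frm "K (Dom C f)" by (rule K_frm[OF into_dom[OF f]])
  show "\<Squnion>\<^bsub>K (Dom C f)\<^esub> vals S f \<in> carrier (K (Dom C f))" using vals_closed[OF S f] by simp
  fix g assume g: "g \<in> into C (Dom C f)"
  interpret frm_hom "K (Dom C f)" "K (Dom C g)" "kr g" by (rule kr_hom[OF g])
  have "kr g (\<Squnion>\<^bsub>K (Dom C f)\<^esub> vals S f) = \<Squnion>\<^bsub>K (Dom C g)\<^esub> (kr g ` vals S f)"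
    by (rule h_Sup[OF vals_closed[OF S f]])
  also have "\<dots> \<sqsubseteq>\<^bsub>K (Dom C g)\<^esub> \<Squnion>\<^bsub>K (Dom C g)\<^esub> vals S (Cmp C f g)"
  proof (rule M.Sup_mono)
    fix y assume "y \<in> kr g ` vals S f"
    then obtain x where x: "(f, x) \<in> S" "y = kr g (r (Dom C f) x)" by auto
    show "\<exists>z\<in>vals S (Cmp C f g). y \<sqsubseteq>\<^bsub>K (Dom C g)\<^esub> z"
      using PwD[OF S x(1)] g f r_lax[OF g, of x] x(2) by auto
  qed (use vals_closed[OF S f] vals_closed[OF S into_comp[OF f g]] h f g in auto)
  finally show "kr g (\<Squnion>\<^bsub>K (Dom C f)\<^esub> vals S f) \<sqsubseteq>\<^bsub>K (Dom C g)\<^esub>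
      \<Squnion>\<^bsub>K (Dom C (Cmp C f g))\<^esub> vals S (Cmp C f g)" using f g by simp
qed (use that in auto)

lemma iJoin_le_iJoin:
  assumes c: "c \<in> Obj C" and S: "S \<in> Pw c" and s: "s \<in> X c" "s' \<in> X c" "iJoin c S s" "iJoin c S s'"
  shows "le c s s'"
proof -
  have "iub (Dom C (Idt C c)) (pres (Idt C c) S) s'" using assms by (simp add: iJoin_def)
  then show ?thesis
    using s(3)[unfolded iJoin_def, THEN conjunct2, rule_format, OF into_id[OF c], of s'] c s by simp
qed

text \<open>The componentwise join exists and is an internal join; two internal joins of the same
  set lie below each other, which gives the converse of \<open>iJoin_if_comp\<close>. Meets and top
  are handled by the same pattern.\<close>

lemma iJoin_iff_comp:
  assumes c: "c \<in> Obj C" and S: "S \<in> Pw c" and s: "s \<in> X c"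
  shows "iJoin c S s \<longleftrightarrow> (\<forall>f\<in>into C c. comp_at s f = \<Squnion>\<^bsub>K (Dom C f)\<^esub> vals S f)"
proof
  assume j: "iJoin c S s"
  obtain s' where s': "s' \<in> X c" "\<And>f. f \<in> into C c \<Longrightarrow> comp_at s' f = \<Squnion>\<^bsub>K (Dom C f)\<^esub> vals S f"
    using Join_comp_ex[OF c S] by blast
  have j': "iJoin c S s'" by (rule iJoin_if_comp[OF c S s'])
  show "\<forall>f\<in>into C c. comp_at s f = \<Squnion>\<^bsub>K (Dom C f)\<^esub> vals S f"
    using s'(2) comp_at_antisym[OF c iJoin_le_iJoin[OF c S s s'(1) j j'] iJoin_le_iJoin[OF c S s'(1) s j' j]]
    by simp
qed (auto intro: iJoin_if_comp[OF c S s])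

lemma meet_comp_ex:
  assumes c: "c \<in> Obj C" and v: "a \<in> X c" "b \<in> X c"
  obtains m where "m \<in> X c" "\<And>f. f \<in> into C c \<Longrightarrow> comp_at m f = comp_at a f \<sqinter>\<^bsub>K (Dom C f)\<^esub> comp_at b f"
proof (rule realize[OF c, of "\<lambda>f. comp_at a f \<sqinter>\<^bsub>K (Dom C f)\<^esub> comp_at b f"])
  fix f assume f: "f \<in> into C c"
  interpret F: frm "K (Dom C f)" by (rule K_frm[OF into_dom[OF f]])
  show "comp_at a f \<sqinter>\<^bsub>K (Dom C f)\<^esub> comp_at b f \<in> carrier (K (Dom C f))" using f v by simp
  fix g assume g: "g \<in> into C (Dom C f)"
  interpret frm_hom "K (Dom C f)" "K (Dom C g)" "kr g" by (rule kr_hom[OF g])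
  show "kr g (comp_at a f \<sqinter>\<^bsub>K (Dom C f)\<^esub> comp_at b f) \<sqsubseteq>\<^bsub>K (Dom C g)\<^esub>
      comp_at a (Cmp C f g) \<sqinter>\<^bsub>K (Dom C (Cmp C f g))\<^esub> comp_at b (Cmp C f g)"
    using f g v h comp_at_lax[OF f g] comp_at_closed[OF into_comp[OF f g]]
    by (auto simp: h_meet intro!: M.meet_mono)
qed (use that in auto)

lemma imeet_iff_comp:
  assumes c: "c \<in> Obj C" and v: "a \<in> X c" "b \<in> X c" "m \<in> X c"
  shows "imeet c a b m \<longleftrightarrow> (\<forall>f\<in>into C c. comp_at m f = comp_at a f \<sqinter>\<^bsub>K (Dom C f)\<^esub> comp_at b f)"
proof -
  have suff: "imeet c a b m" if m: "m \<in> X c"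
    and eq: "\<And>f. f \<in> into C c \<Longrightarrow> comp_at m f = comp_at a f \<sqinter>\<^bsub>K (Dom C f)\<^esub> comp_at b f" for m
    unfolding imeet_def
  proof (intro conjI ballI impI)
    have "comp_at m f \<sqsubseteq>\<^bsub>K (Dom C f)\<^esub> comp_at a f \<and> comp_at m f \<sqsubseteq>\<^bsub>K (Dom C f)\<^esub> comp_at b f"
      if f: "f \<in> into C c" for f
    proof -
      interpret frm "K (Dom C f)" by (rule K_frm[OF into_dom[OF f]])
      show ?thesis using eq[OF f] f v by (auto simp: meet_left meet_right)
    qed
    then show "le c m a" "le c m b" using c v m by (auto simp: le_iff)
    fix f x assume f: "f \<in> into C c" and x: "x \<in> X (Dom C f)" "le (Dom C f) x (res f a)" "le (Dom C f) x (res f b)"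
    have "comp_at x g \<sqsubseteq>\<^bsub>K (Dom C g)\<^esub> comp_at (res f m) g" if g: "g \<in> into C (Dom C f)" for g
    proof -
      interpret frm "K (Dom C g)" by (rule K_frm[OF into_dom[OF g]])
      have "comp_at x g \<sqsubseteq>\<^bsub>K (Dom C g)\<^esub> comp_at (res f a) g" "comp_at x g \<sqsubseteq>\<^bsub>K (Dom C g)\<^esub> comp_at (res f b) g"
        using x le_iff[OF into_dom[OF f]] f g v by auto
      then show ?thesis
        using eq[OF into_comp[OF f g]] f g v m x comp_at_closed[OF into_comp[OF f g]]
        by (auto simp: comp_at_res intro!: meet_le)
    qed
    then show "le (Dom C f) x (res f m)" using f m x by (simp add: le_iff into_dom)
  qed
  obtain m' where m': "m' \<in> X c" "\<And>f. f \<in> into C c \<Longrightarrow> comp_at m' f = comp_at a f \<sqinter>\<^bsub>K (Dom C f)\<^esub> comp_at b f"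
    using meet_comp_ex[OF c v(1,2)] by blast
  have uniq: "le c m m'" if "imeet c a b m" "imeet c a b m'" "m \<in> X c" "m' \<in> X c" for m m'
    using that(2)[unfolded imeet_def, THEN conjunct2, THEN conjunct2, rule_format, OF into_id[OF c], of m]
      that c v by (simp add: imeet_def)
  show ?thesis
  proof
    assume m: "imeet c a b m"
    show "\<forall>f\<in>into C c. comp_at m f = comp_at a f \<sqinter>\<^bsub>K (Dom C f)\<^esub> comp_at b f"
      using m'(2) comp_at_antisym[OF c uniq[OF m suff[OF m'] v(3) m'(1)] uniq[OF suff[OF m'] m m'(1) v(3)]] by simp
  qed (use suff v in auto)
qed

lemma ijoin_iff_comp:
  assumes c: "c \<in> Obj C" and v: "a \<in> X c" "b \<in> X c" "j \<in> X c"
  shows "ijoin c a b j \<longleftrightarrow> (\<forall>f\<in>into C c. comp_at j f = comp_at a f \<squnion>\<^bsub>K (Dom C f)\<^esub> comp_at b f)"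
proof -
  have A: "{a, b} \<subseteq> X c" using v by simp
  have "vals (gen c {a, b}) f = {comp_at a f, comp_at b f}" if "f \<in> into C c" for f
    using that by (auto simp: gen_def comp_at_def)
  then show ?thesis
    by (simp add: ijoin_iff_iJoin[OF c v] iJoin_iff_comp[OF c gen_Pw[OF A] v(3)] join_def)
qed

lemma itop_iff_comp:
  assumes c: "c \<in> Obj C" and t: "t \<in> X c"
  shows "itop c t \<longleftrightarrow> (\<forall>f\<in>into C c. comp_at t f = \<top>\<^bsub>K (Dom C f)\<^esub>)"
proof -
  have suff: "itop c t" if t: "t \<in> X c" and eq: "\<And>f. f \<in> into C c \<Longrightarrow> comp_at t f = \<top>\<^bsub>K (Dom C f)\<^esub>" for t
    unfolding itop_def
  proof (intro ballI)
    fix f x assume f: "f \<in> into C c" and x: "x \<in> X (Dom C f)"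
    have "comp_at x g \<sqsubseteq>\<^bsub>K (Dom C g)\<^esub> comp_at (res f t) g" if g: "g \<in> into C (Dom C f)" for g
    proof -
      interpret frm "K (Dom C g)" by (rule K_frm[OF into_dom[OF g]])
      show ?thesis using eq[OF into_comp[OF f g]] f g t x by (simp add: comp_at_res)
    qed
    then show "le (Dom C f) x (res f t)" using f t x by (simp add: le_iff into_dom)
  qed
  obtain t' where t': "t' \<in> X c" "\<And>f. f \<in> into C c \<Longrightarrow> comp_at t' f = \<top>\<^bsub>K (Dom C f)\<^esub>"
  proof (rule realize[OF c, of "\<lambda>f. \<top>\<^bsub>K (Dom C f)\<^esub>"])
    fix f assume f: "f \<in> into C c"
    interpret F: frm "K (Dom C f)" by (rule K_frm[OF into_dom[OF f]])
    show "\<top>\<^bsub>K (Dom C f)\<^esub> \<in> carrier (K (Dom C f))" by simp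
    fix g assume g: "g \<in> into C (Dom C f)"
    interpret frm_hom "K (Dom C f)" "K (Dom C g)" "kr g" by (rule kr_hom[OF g])
    show "kr g \<top>\<^bsub>K (Dom C f)\<^esub> \<sqsubseteq>\<^bsub>K (Dom C g)\<^esub> \<top>\<^bsub>K (Dom C (Cmp C f g))\<^esub>"
      using f g by (simp add: h_top)
  qed (use that in auto)
  have uniq: "le c t t'" if "itop c t'" "t \<in> X c" "t' \<in> X c" for t t'
    using that(1)[unfolded itop_def, rule_format, OF into_id[OF c], of t] that c by simp
  show ?thesis
  proof
    assume m: "itop c t"
    show "\<forall>f\<in>into C c. comp_at t f = \<top>\<^bsub>K (Dom C f)\<^esub>"
      using t'(2) comp_at_antisym[OF c uniq[OF suff[OF t'] t t'(1)] uniq[OF m t'(1) t]] by simp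
  qed (use suff t in auto)
qed

lemma ibot_iff_comp:
  assumes c: "c \<in> Obj C" and z: "z \<in> X c"
  shows "ibot c z \<longleftrightarrow> (\<forall>f\<in>into C c. comp_at z f = \<bottom>\<^bsub>K (Dom C f)\<^esub>)"
proof -
  have "\<Squnion>\<^bsub>K (Dom C f)\<^esub> {} = \<bottom>\<^bsub>K (Dom C f)\<^esub>" if f: "f \<in> into C c" for f
  proof -
    interpret frm "K (Dom C f)" by (rule K_frm[OF into_dom[OF f]])
    show ?thesis by (rule Sup_empty)
  qed
  then show ?thesis by (simp add: ibot_iff_iJoin iJoin_iff_comp[OF c empty_Pw z])
qed

section \<open>Strict families, the axioms of an internal compact regular frame, and its regular
  elements\<close>

definition strict :: "'o \<Rightarrow> 'u \<Rightarrow> 'u \<Rightarrow> bool" where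
  "strict c k x \<longleftrightarrow> x \<in> X c \<and> (\<forall>f\<in>into C c. comp_at x f = kr f k)"

lemma strict_ex:
  assumes c: "c \<in> Obj C" and k: "k \<in> carrier (K c)"
  obtains x where "strict c k x"
proof (rule realize[OF c, of "\<lambda>f. kr f k"])
  fix f assume f: "f \<in> into C c"
  interpret F: frm_hom "K c" "K (Dom C f)" "kr f" by (rule kr_hom[OF f])
  show kf: "kr f k \<in> carrier (K (Dom C f))" using k F.h by simp
  fix g assume g: "g \<in> into C (Dom C f)"
  interpret G: frm_hom "K (Dom C f)" "K (Dom C g)" "kr g" by (rule kr_hom[OF g])
  show "kr g (kr f k) \<sqsubseteq>\<^bsub>K (Dom C g)\<^esub> kr (Cmp C f g) k"
    using f g k kf G.h by (simp add: kr_comp)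
qed (use that in \<open>auto simp: strict_def\<close>)

lemma strict_r: "c \<in> Obj C \<Longrightarrow> k \<in> carrier (K c) \<Longrightarrow> strict c k x \<Longrightarrow> r c x = k"
  by (metis strict_def comp_at_id into_id kr_id)

text \<open>The complement \<open>w\<close> found in \<open>K c\<close> is also spread strictly over
  the later stages. The frame maps \<open>kr f\<close> carry the meet with it to the bottom; for the
  cover, the component of \<open>b\<close> at \<open>f\<close> may exceed
  \<open>kr f (r c b)\<close>, which only helps.\<close>

lemma iwell_inside_strict:
  assumes c: "c \<in> Obj C" and k: "k \<in> carrier (K c)" "strict c k x" and b: "b \<in> X c"
    and wi: "well_inside (K c) k (r c b)"
  shows "iwell_inside c x b"
proof -
  interpret K: frm "K c" by (rule K_frm[OF c])
  obtain w where w: "w \<in> carrier (K c)" "k \<sqinter>\<^bsub>K c\<^esub> w = \<bottom>\<^bsub>K c\<^esub>" "r c b \<squnion>\<^bsub>K c\<^esub> w = \<top>\<^bsub>K c\<^esub>"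
    by (rule K.well_insideE[OF wi])
  obtain y where y: "strict c w y" using strict_ex[OF c w(1)] by blast
  obtain z where z: "strict c \<bottom>\<^bsub>K c\<^esub> z" using strict_ex[OF c K.bottom_closed] by blast
  obtain t where t: "strict c \<top>\<^bsub>K c\<^esub> t" using strict_ex[OF c K.top_closed] by blast
  have X: "x \<in> X c" "y \<in> X c" "z \<in> X c" "t \<in> X c" using k y z t by (auto simp: strict_def)
  have "comp_at z f = \<bottom>\<^bsub>K (Dom C f)\<^esub> \<and> comp_at t f = \<top>\<^bsub>K (Dom C f)\<^esub> \<and>
      \<bottom>\<^bsub>K (Dom C f)\<^esub> = comp_at x f \<sqinter>\<^bsub>K (Dom C f)\<^esub> comp_at y f \<and>
      \<top>\<^bsub>K (Dom C f)\<^esub> = comp_at b f \<squnion>\<^bsub>K (Dom C f)\<^esub> comp_at y f" if f: "f \<in> into C c" for f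
  proof -
    interpret frm_hom "K c" "K (Dom C f)" "kr f" by (rule kr_hom[OF f])
    have e: "comp_at x f = kr f k" "comp_at y f = kr f w" "comp_at z f = kr f \<bottom>\<^bsub>K c\<^esub>" "comp_at t f = kr f \<top>\<^bsub>K c\<^esub>"
      using k y z t f by (auto simp: strict_def)
    have rb: "r c b \<in> carrier (K c)" using c b by (rule r_closed)
    have "kr f (r c b) \<squnion>\<^bsub>K (Dom C f)\<^esub> kr f w = \<top>\<^bsub>K (Dom C f)\<^esub>"
      using h_join[OF rb w(1)] w(3) h_top by simp
    then have "comp_at b f \<squnion>\<^bsub>K (Dom C f)\<^esub> kr f w = \<top>\<^bsub>K (Dom C f)\<^esub>"
      using M.join_top_mono[of "kr f (r c b)" "kr f w" "comp_at b f" "kr f w"] r_lax[OF f b] h[OF rb] h[OF w(1)] f b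
      by (simp add: comp_at_def r_closed into_dom)
    then show ?thesis using h_meet[OF k(1) w(1)] w(2) h_top h_bottom by (simp add: e)
  qed
  then have "ibot c z \<and> itop c t \<and> imeet c x y z \<and> ijoin c b y t"
    using X b by (simp add: ibot_iff_comp[OF c] itop_iff_comp[OF c] imeet_iff_comp[OF c] ijoin_iff_comp[OF c])
  then show ?thesis using X by (auto simp: iwell_inside_def)
qed

lemma iwell_inside_comp:
  assumes c: "c \<in> Obj C" and v: "x \<in> X c" "b \<in> X c" and wi: "iwell_inside c x b"
  obtains w where "w \<in> X c"
    "\<And>f. f \<in> into C c \<Longrightarrow> comp_at x f \<sqinter>\<^bsub>K (Dom C f)\<^esub> comp_at w f = \<bottom>\<^bsub>K (Dom C f)\<^esub>"
    "\<And>f. f \<in> into C c \<Longrightarrow> comp_at b f \<squnion>\<^bsub>K (Dom C f)\<^esub> comp_at w f = \<top>\<^bsub>K (Dom C f)\<^esub>"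
proof -
  obtain w z t where w: "w \<in> X c" "z \<in> X c" "t \<in> X c" "ibot c z" "itop c t" "imeet c x w z" "ijoin c b w t"
    using wi by (auto simp: iwell_inside_def)
  show ?thesis
    by (rule that[OF w(1)])
      (use w v c in \<open>auto simp: ibot_iff_comp itop_iff_comp imeet_iff_comp ijoin_iff_comp\<close>)
qed

text \<open>Each axiom reduces to its counterpart in the frames \<open>K (Dom C f)\<close>.
  Compactness looks at the identity component only. For regularity the approximants are strict
  families, and these supply enough elements that are internally well inside.\<close>

lemma internal_kreg: "internal_kreg C U L"
proof unfold_locales
  fix c assume c: "c \<in> Obj C"
  show "le c x x" if "x \<in> X c" for x using c that by (rule lax_rep_le_refl)
  show "x = y" if "le c x y" "le c y x" for x y using c that by (rule lax_rep_le_antisym)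
  show "le c x z" if "le c x y" "le c y z" for x y z using c that by (rule lax_rep_le_trans)
  show "\<exists>s\<in>X c. iJoin c S s" if S: "S \<in> Pw c" for S
    using Join_comp_ex[OF c S] iJoin_if_comp[OF c S] by metis
  show "iJoin c B m" if S: "S \<in> Pw c" and B: "B \<in> Pw c" and v: "a \<in> X c" "s \<in> X c" "m \<in> X c"
    and j: "iJoin c S s" and mm: "imeet c a s m"
    and BS: "\<forall>f\<in>into C c. \<forall>y\<in>X (Dom C f).
      (f, y) \<in> B \<longleftrightarrow> (\<exists>x\<in>X (Dom C f). (f, x) \<in> S \<and> imeet (Dom C f) (res f a) x y)" for S B a s m
  proof (rule iJoin_if_comp[OF c B v(3)])
    fix f assume f: "f \<in> into C c"
    have d: "Dom C f \<in> Obj C" using f by auto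
    interpret frm "K (Dom C f)" by (rule K_frm[OF d])
    have "comp_at m f = comp_at a f \<sqinter>\<^bsub>K (Dom C f)\<^esub> \<Squnion>\<^bsub>K (Dom C f)\<^esub> vals S f"
      using mm j f v by (simp add: imeet_iff_comp[OF c] iJoin_iff_comp[OF c S])
    also have "\<dots> = \<Squnion>\<^bsub>K (Dom C f)\<^esub> ((\<lambda>y. comp_at a f \<sqinter>\<^bsub>K (Dom C f)\<^esub> y) ` vals S f)"
      by (rule frame_distrib) (use f v vals_closed[OF S f] in auto)
    \<comment> \<open>Every meet of the restricted \<open>a\<close> with a member of
      \<open>S\<close> over \<open>f\<close> is realised in \<open>L\<close> by
      \<open>meet_comp_ex\<close>, and by hypothesis \<open>B\<close> consists over \<open>f\<close>
      of exactly these meets.\<close>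
    also have "(\<lambda>y. comp_at a f \<sqinter>\<^bsub>K (Dom C f)\<^esub> y) ` vals S f = vals B f"
    proof (intro Set.set_eqI iffI)
      fix q assume "q \<in> (\<lambda>y. comp_at a f \<sqinter>\<^bsub>K (Dom C f)\<^esub> y) ` vals S f"
      then obtain x where x: "(f, x) \<in> S" "q = comp_at a f \<sqinter>\<^bsub>K (Dom C f)\<^esub> r (Dom C f) x" by auto
      have xX: "x \<in> X (Dom C f)" using PwD(2)[OF S x(1)] .
      have "\<exists>y\<in>X (Dom C f). imeet (Dom C f) (res f a) x y"
        using meet_comp_ex[OF d res_closed[OF f v(1)] xX] imeet_iff_comp[OF d res_closed[OF f v(1)] xX] by metis
      then obtain y where y: "y \<in> X (Dom C f)" "imeet (Dom C f) (res f a) x y" by blast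
      have "(f, y) \<in> B" using BS f y x(1) xX by blast
      moreover have "r (Dom C f) y = q"
        using y imeet_iff_comp[OF d res_closed[OF f v(1)] xX y(1)] into_id[OF d] x(2) xX f v d
        by (auto simp: comp_at_id comp_at_def dest!: bspec)
      ultimately show "q \<in> vals B f" by auto
    next
      fix q assume "q \<in> vals B f"
      then obtain y where y: "(f, y) \<in> B" "q = r (Dom C f) y" by auto
      have yX: "y \<in> X (Dom C f)" using PwD(2)[OF B y(1)] .
      obtain x where x: "x \<in> X (Dom C f)" "(f, x) \<in> S" "imeet (Dom C f) (res f a) x y"
        using BS f y(1) yX by blast
      have "r (Dom C f) y = comp_at a f \<sqinter>\<^bsub>K (Dom C f)\<^esub> r (Dom C f) x"
        using x imeet_iff_comp[OF d res_closed[OF f v(1)] x(1) yX] into_id[OF d] yX f v d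
        by (auto simp: comp_at_id comp_at_def dest!: bspec)
      then show "q \<in> (\<lambda>y. comp_at a f \<sqinter>\<^bsub>K (Dom C f)\<^esub> y) ` vals S f" using x y by auto
    qed
    finally show "comp_at m f = \<Squnion>\<^bsub>K (Dom C f)\<^esub> vals B f" .
  qed
  show "(Idt C c, t) \<in> S" if S: "S \<in> Pw c" and t: "t \<in> X c" and d: "idirected c S" and tt: "itop c t"
    and j: "iJoin c S t" for S t
  proof -
    interpret frm "K c" by (rule K_frm[OF c])
    have ci: "Dom C (Idt C c) = c" using c by simp
    have vc: "vals S (Idt C c) \<subseteq> carrier (K c)" using vals_closed[OF S into_id[OF c]] c by simp
    have "\<Squnion>\<^bsub>K c\<^esub> vals S (Idt C c) = \<top>\<^bsub>K c\<^esub>"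
      using j tt t c by (simp add: iJoin_iff_comp[OF c S] itop_iff_comp[OF c]) (metis ci into_id)
    moreover have "directed_in (K c) (vals S (Idt C c))" unfolding directed_in_def
    proof (intro conjI ballI)
      show "vals S (Idt C c) \<noteq> {}" using d by (auto simp: idirected_def)
      fix p q assume "p \<in> vals S (Idt C c)" "q \<in> vals S (Idt C c)"
      then obtain x y where xy: "(Idt C c, x) \<in> S" "(Idt C c, y) \<in> S" "p = r c x" "q = r c y" using ci by auto
      then obtain z where z: "(Idt C c, z) \<in> S" "le c x z" "le c y z"
        using d c unfolding idirected_def by (metis ci)
      have zX: "x \<in> X c" "y \<in> X c" "z \<in> X c" using le_in[OF c] z by blast+
      have "r c x \<sqsubseteq>\<^bsub>K c\<^esub> r c z" "r c y \<sqsubseteq>\<^bsub>K c\<^esub> r c z"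
        using z zX c le_iff[OF c] into_id[OF c] comp_at_id[OF c] ci by metis+
      then show "\<exists>s\<in>vals S (Idt C c). p \<sqsubseteq>\<^bsub>K c\<^esub> s \<and> q \<sqsubseteq>\<^bsub>K c\<^esub> s" using xy z(1) ci by auto
    qed
    ultimately have "\<top>\<^bsub>K c\<^esub> \<in> vals S (Idt C c)"
      using K_compact[OF c] vc by (simp add: compact_frame_def)
    then obtain x where x: "(Idt C c, x) \<in> S" "r c x = \<top>\<^bsub>K c\<^esub>" using ci by auto
    have xX: "x \<in> X c" using PwD(2)[OF S x(1)] ci by simp
    \<comment> \<open>Laxness spreads the top from the identity component to all the others.\<close>
    have "comp_at x f = \<top>\<^bsub>K (Dom C f)\<^esub>" if f: "f \<in> into C c" for f
    proof -
      interpret H: frm_hom "K c" "K (Dom C f)" "kr f" by (rule kr_hom[OF f])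
      show ?thesis using r_lax[OF f xX] x(2) H.h_top comp_at_closed[OF f xX]
        by (intro H.M.top_le) (auto simp: comp_at_def)
    qed
    then have "x = t" using tt t xX c by (intro eqI[OF c xX t]) (auto simp: itop_iff_comp)
    then show ?thesis using x by simp
  qed
  show "iJoin c S b" if S: "S \<in> Pw c" and b: "b \<in> X c"
    and Sb: "\<forall>f\<in>into C c. \<forall>x\<in>X (Dom C f). (f, x) \<in> S \<longleftrightarrow> iwell_inside (Dom C f) x (res f b)" for S b
  proof (rule iJoin_if_comp[OF c S b])
    fix f assume f: "f \<in> into C c"
    have d: "Dom C f \<in> Obj C" using f by auto
    interpret frm "K (Dom C f)" by (rule K_frm[OF d])
    let ?b = "comp_at b f"
    have bX: "res f b \<in> X (Dom C f)" using f b by auto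
    have bK: "?b \<in> carrier (K (Dom C f))" using f b by auto
    show "?b = \<Squnion>\<^bsub>K (Dom C f)\<^esub> vals S f"
    proof (rule le_antisym)
      have "?b = reg_interior (K (Dom C f)) ?b"
        using K_regular[OF d] bK by (simp add: regular_frame_iff)
      also have "\<dots> \<sqsubseteq>\<^bsub>K (Dom C f)\<^esub> \<Squnion>\<^bsub>K (Dom C f)\<^esub> vals S f"
        unfolding reg_interior_def
      proof (rule Sup_mono)
        fix k assume "k \<in> {v \<in> carrier (K (Dom C f)). well_inside (K (Dom C f)) v ?b}"
        then have k: "k \<in> carrier (K (Dom C f))" "well_inside (K (Dom C f)) k (r (Dom C f) (res f b))"
          by (auto simp: comp_at_def)
        obtain x where x: "strict (Dom C f) k x" using strict_ex[OF d k(1)] by blast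
        have "(f, x) \<in> S"
          using Sb f x iwell_inside_strict[OF d k(1) x bX k(2)] by (auto simp: strict_def)
        moreover have "r (Dom C f) x = k" by (rule strict_r[OF d k(1) x])
        ultimately show "\<exists>y\<in>vals S f. k \<sqsubseteq>\<^bsub>K (Dom C f)\<^esub> y" using k by (intro bexI[of _ k]) auto
      qed (use vals_closed[OF S f] in auto)
      finally show "?b \<sqsubseteq>\<^bsub>K (Dom C f)\<^esub> \<Squnion>\<^bsub>K (Dom C f)\<^esub> vals S f" .
      show "\<Squnion>\<^bsub>K (Dom C f)\<^esub> vals S f \<sqsubseteq>\<^bsub>K (Dom C f)\<^esub> ?b"
      proof (rule sup_least)
        fix q assume "q \<in> vals S f"
        then obtain x where x: "(f, x) \<in> S" "q = r (Dom C f) x" by auto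
        have xX: "x \<in> X (Dom C f)" using PwD(2)[OF S x(1)] .
        have "iwell_inside (Dom C f) x (res f b)" using Sb f x xX by auto
        then obtain w where w: "w \<in> X (Dom C f)"
          "\<And>g. g \<in> into C (Dom C f) \<Longrightarrow> comp_at x g \<sqinter>\<^bsub>K (Dom C g)\<^esub> comp_at w g = \<bottom>\<^bsub>K (Dom C g)\<^esub>"
          "\<And>g. g \<in> into C (Dom C f) \<Longrightarrow> comp_at (res f b) g \<squnion>\<^bsub>K (Dom C g)\<^esub> comp_at w g = \<top>\<^bsub>K (Dom C g)\<^esub>"
          using iwell_inside_comp[OF d xX bX] by blast
        show "q \<sqsubseteq>\<^bsub>K (Dom C f)\<^esub> ?b"
          using le_if_meet_bottom_join_top[of "r (Dom C f) x" ?b "r (Dom C f) w"]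
            w(2)[OF into_id[OF d]] w(3)[OF into_id[OF d]] w(1) xX bX bK d r_closed[OF d] x(2)
          by (simp add: comp_at_id comp_at_def)
      qed (use vals_closed[OF S f] bK in auto)
    qed (use vals_closed[OF S f] bK in auto)
  qed
qed

sublocale internal_kreg C U L
  by (rule internal_kreg)

text \<open>Let \<open>y\<close> be the strict family on \<open>r c x\<close>. Laxness puts each
  component of \<open>y\<close> below that of \<open>x\<close>; if \<open>x\<close> is regular, the
  reverse holds because everything well inside \<open>x\<close> is below \<open>y\<close>.
  Conversely, regularity of \<open>K c\<close> exhibits a strict family as a join of strict families
  that are well inside it.\<close>

lemma strict_iff_regs:
  assumes c: "c \<in> Obj C" and x: "x \<in> X c"
  shows "x \<in> regs (St c) \<longleftrightarrow> strict c (r c x) x"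
proof
  interpret S: frm "St c" by (rule frm_stage[OF c])
  have rx: "r c x \<in> carrier (K c)" using r_closed c x .
  {
    assume reg: "x \<in> regs (St c)"
    obtain y where y: "strict c (r c x) y" using strict_ex[OF c rx] by blast
    then have yX: "y \<in> X c" by (simp add: strict_def)
    have "le c v y" if v: "v \<in> X c" "well_inside (St c) v x" for v
    proof -
      have "iwell_inside c v x" using v x by (simp add: iwell_inside_iff[OF c])
      then obtain w where w: "w \<in> X c"
        "\<And>f. f \<in> into C c \<Longrightarrow> comp_at v f \<sqinter>\<^bsub>K (Dom C f)\<^esub> comp_at w f = \<bottom>\<^bsub>K (Dom C f)\<^esub>"
        "\<And>f. f \<in> into C c \<Longrightarrow> comp_at x f \<squnion>\<^bsub>K (Dom C f)\<^esub> comp_at w f = \<top>\<^bsub>K (Dom C f)\<^esub>"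
        using iwell_inside_comp[OF c v(1) x] by blast
      have rw: "r c w \<in> carrier (K c)" using r_closed c w(1) .
      \<comment> \<open>Only the identity component of the cover is used. Its image under
        \<open>kr f\<close> is a cover by \<open>kr f (r c x)\<close> instead of the possibly larger
        component of \<open>x\<close> at \<open>f\<close>, and this forces \<open>v\<close> below
        the strict family.\<close>
      have top: "r c x \<squnion>\<^bsub>K c\<^esub> r c w = \<top>\<^bsub>K c\<^esub>"
        using w(3)[OF into_id[OF c]] c x w(1) by (simp add: comp_at_id)
      have "comp_at v f \<sqsubseteq>\<^bsub>K (Dom C f)\<^esub> comp_at y f" if f: "f \<in> into C c" for f
      proof -
        interpret H: frm_hom "K c" "K (Dom C f)" "kr f" by (rule kr_hom[OF f])
        have yf: "comp_at y f = kr f (r c x)" using y f by (simp add: strict_def)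
        have "kr f (r c x) \<squnion>\<^bsub>K (Dom C f)\<^esub> kr f (r c w) = \<top>\<^bsub>K (Dom C f)\<^esub>"
          using H.h_join[OF rx rw] top H.h_top by simp
        then have "kr f (r c x) \<squnion>\<^bsub>K (Dom C f)\<^esub> comp_at w f = \<top>\<^bsub>K (Dom C f)\<^esub>"
          using H.M.join_top_mono[of "kr f (r c x)" "kr f (r c w)" "kr f (r c x)" "comp_at w f"]
            H.h[OF rx] H.h[OF rw] r_lax[OF f w(1)] comp_at_closed[OF f w(1)] by (simp add: comp_at_def)
        then show ?thesis
          using H.M.le_if_meet_bottom_join_top[of "comp_at v f" "kr f (r c x)" "comp_at w f"]
            w(2)[OF f] f v w(1) H.h[OF rx] yf by auto
      qed
      then show ?thesis using le_iff[OF c v(1) yX] by simp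
    qed
    then have "reg_interior (St c) x \<sqsubseteq>\<^bsub>St c\<^esub> y"
      unfolding reg_interior_def using yX by (intro S.sup_least) auto
    then have xy: "le c x y" using S.reg_interior_regs[OF reg] by simp
    have "comp_at x f = kr f (r c x)" if f: "f \<in> into C c" for f
    proof -
      interpret H: frm_hom "K c" "K (Dom C f)" "kr f" by (rule kr_hom[OF f])
      show ?thesis
      proof (rule H.M.le_antisym)
        show "comp_at x f \<sqsubseteq>\<^bsub>K (Dom C f)\<^esub> kr f (r c x)"
          using xy le_iff[OF c x yX] f y by (auto simp: strict_def)
        show "kr f (r c x) \<sqsubseteq>\<^bsub>K (Dom C f)\<^esub> comp_at x f" using r_lax[OF f x] by (simp add: comp_at_def)
      qed (use f x H.h[OF rx] in auto)
    qed
    then show "strict c (r c x) x" using x by (simp add: strict_def)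
  next
    assume st: "strict c (r c x) x"
    show "x \<in> regs (St c)"
    proof (rule S.regsI)
      let ?v = "reg_interior (St c) x"
      have vX: "?v \<in> X c" using S.reg_interior_closed[of x] by simp
      have "comp_at x f \<sqsubseteq>\<^bsub>K (Dom C f)\<^esub> comp_at ?v f" if f: "f \<in> into C c" for f
      proof -
        interpret H: frm_hom "K c" "K (Dom C f)" "kr f" by (rule kr_hom[OF f])
        let ?A = "{k \<in> carrier (K c). well_inside (K c) k (r c x)}"
        have "comp_at x f = kr f (r c x)" using st f by (simp add: strict_def)
        also have "r c x = \<Squnion>\<^bsub>K c\<^esub> ?A"
          using K_regular[OF c] rx by (simp add: regular_frame_def)
        also have "kr f (\<Squnion>\<^bsub>K c\<^esub> ?A) = \<Squnion>\<^bsub>K (Dom C f)\<^esub> (kr f ` ?A)" by (rule H.h_Sup) auto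
        also have "\<dots> \<sqsubseteq>\<^bsub>K (Dom C f)\<^esub> comp_at ?v f"
        proof (rule H.M.sup_least)
          fix q assume "q \<in> kr f ` ?A"
          then obtain k where k: "k \<in> carrier (K c)" "well_inside (K c) k (r c x)" "q = kr f k" by auto
          obtain y where y: "strict c k y" using strict_ex[OF c k(1)] by blast
          then have yX: "y \<in> X c" by (simp add: strict_def)
          have "well_inside (St c) y x"
            using iwell_inside_strict[OF c k(1) y x k(2)] iwell_inside_iff[OF c yX x] by simp
          then have "le c y ?v" using S.le_reg_interior[of y x] yX by simp
          then show "q \<sqsubseteq>\<^bsub>K (Dom C f)\<^esub> comp_at ?v f"
            using le_iff[OF c yX vX] f y k(3) by (auto simp: strict_def)
        qed (use H.h f vX in auto)
        finally show ?thesis .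
      qed
      then show "x \<sqsubseteq>\<^bsub>St c\<^esub> ?v" using le_iff[OF c x vX] by simp
    qed (use x in auto)
  }
qed

lemma r_res_regs:
  assumes "f \<in> into C c" "x \<in> regs (St c)"
  shows "r (Dom C f) (res f x) = kr f (r c x)"
proof -
  have c: "c \<in> Obj C" using assms(1) by (auto simp: into_def)
  have x: "x \<in> X c" using regs_carrier[OF assms(2)] by simp
  show ?thesis using assms strict_iff_regs[OF c x] by (simp add: strict_def comp_at_def)
qed

text \<open>Regular elements are strict, hence determined by the identity component, and
  \<open>strict_ex\<close> lets this component be any element of \<open>K c\<close>.\<close>

lemma r_bij:
  assumes c: "c \<in> Obj C"
  shows "bij_betw (r c) (regs (St c)) (carrier (K c))"
proof (rule bij_betwI')
  fix x y assume xy: "x \<in> regs (St c)" "y \<in> regs (St c)"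
  then have X: "x \<in> X c" "y \<in> X c" using regs_carrier by fastforce+
  show "r c x = r c y \<longleftrightarrow> x = y"
    using eqI[OF c X] r_res_regs[OF _ xy(1)] r_res_regs[OF _ xy(2)] by (auto simp: comp_at_def)
next
  fix x assume "x \<in> regs (St c)"
  then show "r c x \<in> carrier (K c)" using r_closed[OF c, of x] regs_carrier[of x "St c"] by simp
next
  fix k assume k: "k \<in> carrier (K c)"
  obtain x where x: "strict c k x" using strict_ex[OF c k] by blast
  then have "r c x = k" by (rule strict_r[OF c k])
  moreover have "x \<in> regs (St c)" using strict_iff_regs[OF c, of x] x calculation by (auto simp: strict_def)
  ultimately show "\<exists>x\<in>regs (St c). k = r c x" by auto
qed

lemma r_le_regs:
  assumes c: "c \<in> Obj C" and xy: "x \<in> regs (St c)" "y \<in> regs (St c)"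
  shows "r c x \<sqsubseteq>\<^bsub>K c\<^esub> r c y \<longleftrightarrow> le c x y"
proof
  have X: "x \<in> X c" "y \<in> X c" using xy regs_carrier by fastforce+
  have rc: "r c x \<in> carrier (K c)" "r c y \<in> carrier (K c)" using r_closed[OF c] X by auto
  show "le c x y" if "r c x \<sqsubseteq>\<^bsub>K c\<^esub> r c y"
  proof -
    have "r (Dom C f) (res f x) \<sqsubseteq>\<^bsub>K (Dom C f)\<^esub> r (Dom C f) (res f y)" if f: "f \<in> into C c" for f
    proof -
      interpret H: frm_hom "K c" "K (Dom C f)" "kr f" by (rule kr_hom[OF f])
      show ?thesis using H.h_mono[OF rc \<open>r c x \<sqsubseteq>\<^bsub>K c\<^esub> r c y\<close>] r_res_regs[OF f] xy by simp
    qed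
    then show ?thesis using r_le[OF c X] by simp
  qed
  show "r c x \<sqsubseteq>\<^bsub>K c\<^esub> r c y" if "le c x y"
    using that le_iff[OF c X] into_id[OF c] comp_at_id[OF c] X c by (metis id_arr(2))
qed

end

section \<open>Representation of an internal compact regular frame by its regular elements\<close>

context internal_kreg
begin

lemma reg_interior_closed [simp, intro]: "c \<in> Obj C \<Longrightarrow> reg_interior (St c) x \<in> X c"
  using frm.reg_interior_closed[OF frm_stage, of c x] by simp

text \<open>By internal regularity \<open>x\<close> is the internal join of elements well inside its
  restrictions. Each of them lies below the interior of that restriction, hence below the interior
  of the corresponding restriction of \<open>y\<close>.\<close>

lemma le_iff_reg_interior:
  assumes c: "c \<in> Obj C" and x: "x \<in> X c" and y: "y \<in> X c"
  shows "le c x y \<longleftrightarrow> (\<forall>f\<in>into C c.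
    le (Dom C f) (reg_interior (St (Dom C f)) (res f x)) (reg_interior (St (Dom C f)) (res f y)))"
proof
  assume l: "le c x y"
  show "\<forall>f\<in>into C c.
    le (Dom C f) (reg_interior (St (Dom C f)) (res f x)) (reg_interior (St (Dom C f)) (res f y))"
  proof
    fix f assume f: "f \<in> into C c"
    interpret frm "St (Dom C f)" by (rule frm_stage[OF into_dom[OF f]])
    show "le (Dom C f) (reg_interior (St (Dom C f)) (res f x)) (reg_interior (St (Dom C f)) (res f y))"
      using reg_interior_mono[of "res f x" "res f y"] f x y le_res[OF f l] by simp
  qed
next
  assume r: "\<forall>f\<in>into C c.
    le (Dom C f) (reg_interior (St (Dom C f)) (res f x)) (reg_interior (St (Dom C f)) (res f y))"
  show "le c x y"
  proof (rule iJoin_le[OF c iJoin_below[OF c x] x below_Pw[OF x] y])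
    show "iub c (below c x) y" unfolding iub_def
    proof (intro allI impI)
      fix f v assume "(f, v) \<in> below c x"
      then have f: "f \<in> into C c" and v: "v \<in> X (Dom C f)" "well_inside (St (Dom C f)) v (res f x)"
        by (auto simp: below_def)
      have d: "Dom C f \<in> Obj C" using f by auto
      interpret frm "St (Dom C f)" by (rule frm_stage[OF d])
      have "le (Dom C f) v (reg_interior (St (Dom C f)) (res f x))"
        using le_reg_interior[of v "res f x"] v by simp
      moreover have "le (Dom C f) (reg_interior (St (Dom C f)) (res f y)) (res f y)"
        using reg_interior_le[of "res f y"] f y by simp
      ultimately show "le (Dom C f) v (res f y)"
        using r f internal_kreg_axioms internal_kreg.le_trans[OF internal_kreg_axioms d] by blast
    qed
  qed
qed

lemma lax_family_realized:
  assumes c: "c \<in> Obj C" and u: "\<And>f. f \<in> into C c \<Longrightarrow> u f \<in> regs (St (Dom C f))"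
    and lax: "\<And>f g. f \<in> into C c \<Longrightarrow> g \<in> into C (Dom C f) \<Longrightarrow> le (Dom C g) (res g (u f)) (u (Cmp C f g))"
  shows "\<exists>x\<in>X c. \<forall>f\<in>into C c. reg_interior (St (Dom C f)) (res f x) = u f"
proof -
  have uX: "u f \<in> X (Dom C f)" if "f \<in> into C c" for f using regs_carrier[OF u[OF that]] by simp
  \<comment> \<open>The union of the down-sets of the \<open>u f\<close>. Laxness is exactly what
    closes it under restriction.\<close>
  let ?S = "{(f, x). f \<in> into C c \<and> x \<in> X (Dom C f) \<and> le (Dom C f) x (u f)}"
  have S: "?S \<in> Pw c"
  proof (rule PwI)
    fix f x g assume "(f, x) \<in> ?S" and g: "g \<in> into C (Dom C f)"
    then have f: "f \<in> into C c" "x \<in> X (Dom C f)" "le (Dom C f) x (u f)" by auto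
    have "le (Dom C g) (res g x) (u (Cmp C f g))"
      using le_trans[OF into_dom[OF g] le_res[OF g f(3)] lax[OF f(1) g]] .
    then show "(Cmp C f g, res g x) \<in> ?S" using f g by auto
  qed auto
  obtain x where x: "x \<in> X c" and j: "iJoin c ?S x" using complete[OF c S] by blast
  have "reg_interior (St (Dom C f)) (res f x) = u f" if f: "f \<in> into C c" for f
  proof -
    let ?d = "Dom C f"
    have d: "?d \<in> Obj C" using f by auto
    interpret D: frm "St ?d" by (rule frm_stage[OF d])
    have fx: "res f x \<in> X ?d" using f x by auto
    have "(f, u f) \<in> ?S" using f uX le_refl[OF d] by auto
    then have "le ?d (u f) (res f x)" using j by (auto simp: iJoin_def iub_def)
    then have ge: "le ?d (u f) (reg_interior (St ?d) (res f x))"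
      using D.reg_interior_mono[of "u f" "res f x"] D.reg_interior_regs[OF u[OF f]] uX[OF f] fx by simp
    \<comment> \<open>The family is shifted along \<open>f\<close> to the stage
      \<open>Dom C f\<close>, where \<open>u f\<close> is the identity component. If
      \<open>u f\<close> covers together with the complement \<open>w\<close> of \<open>v\<close>,
      then \<open>v\<close> lies below \<open>u f\<close> by cancellation.\<close>
    have le: "le ?d v (u f)" if v: "v \<in> X ?d" "well_inside (St ?d) v (res f x)" for v
    proof -
      obtain w where w: "w \<in> X ?d" "v \<sqinter>\<^bsub>St ?d\<^esub> w = \<bottom>\<^bsub>St ?d\<^esub>" "res f x \<squnion>\<^bsub>St ?d\<^esub> w = \<top>\<^bsub>St ?d\<^esub>"
        using D.well_insideE[OF v(2)] by auto
      let ?j = "\<lambda>g. u (Cmp C f g) \<squnion>\<^bsub>St (Dom C g)\<^esub> res g w"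
      \<comment> \<open>At every stage \<open>?T\<close> has the largest element
        \<open>?j g\<close>, so directedness is immediate. The family \<open>?j\<close> is only lax,
        so these elements need not be restrictions of the one at the identity; bridging this gap is
        what compactness does.\<close>
      let ?T = "{(g, y). g \<in> into C ?d \<and> y \<in> X (Dom C g) \<and> le (Dom C g) y (?j g)}"
      have ug: "u (Cmp C f g) \<in> X (Dom C g)" if "g \<in> into C ?d" for g
        using uX[OF into_comp[OF f that]] f that by simp
      have jX: "?j g \<in> X (Dom C g)" "le (Dom C g) (u (Cmp C f g)) (?j g)" "le (Dom C g) (res g w) (?j g)"
        if g: "g \<in> into C ?d" for g
      proof -
        interpret G: frm "St (Dom C g)" by (rule frm_stage[OF into_dom[OF g]])
        show "?j g \<in> X (Dom C g)" "le (Dom C g) (u (Cmp C f g)) (?j g)" "le (Dom C g) (res g w) (?j g)"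
          using G.join_closed[of "u (Cmp C f g)" "res g w"] G.join_left[of "u (Cmp C f g)" "res g w"]
            G.join_right[of "u (Cmp C f g)" "res g w"] ug[OF g] g w(1) by auto
      qed
      have T: "?T \<in> Pw ?d"
      proof (rule PwI)
        fix g y h assume "(g, y) \<in> ?T" and h: "h \<in> into C (Dom C g)"
        then have g: "g \<in> into C ?d" "y \<in> X (Dom C g)" "le (Dom C g) y (?j g)" by auto
        interpret H: frm_hom "St (Dom C g)" "St (Dom C h)" "res h" by (rule frm_hom_res[OF h])
        have gh: "Cmp C g h \<in> into C ?d" using g(1) h by auto
        have "res h (?j g) = res h (u (Cmp C f g)) \<squnion>\<^bsub>St (Dom C h)\<^esub> res (Cmp C g h) w"
          using H.h_join[of "u (Cmp C f g)" "res g w"] ug[OF g(1)] g h w(1) by (simp add: res_comp)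
        moreover have "le (Dom C h) \<dots> (?j (Cmp C g h))"
          using H.M.join_mono[of "res h (u (Cmp C f g))" "res (Cmp C g h) w" "u (Cmp C f (Cmp C g h))" "res (Cmp C g h) w"]
            lax[OF into_comp[OF f g(1)], of h] ug[OF g(1)] ug[OF gh] g h gh w(1) f res_closed[OF gh w(1)]
          by (simp add: comp_assoc_into[OF f g(1) h] le_refl into_dom)
        ultimately have "le (Dom C h) (res h y) (?j (Cmp C g h))"
          using le_trans[OF into_dom[OF h] le_res[OF h g(3)]] by simp
        then show "(Cmp C g h, res h y) \<in> ?T" using g h gh by auto
      qed auto
      have tX: "\<top>\<^bsub>St ?d\<^esub> \<in> X ?d" using D.top_closed by simp
      have "(Idt C ?d, \<top>\<^bsub>St ?d\<^esub>) \<in> ?T"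
      proof (rule compact[OF d T tX])
        show "idirected ?d ?T" unfolding idirected_def
        proof (intro conjI allI impI)
          show "\<exists>x\<in>X ?d. (Idt C ?d, x) \<in> ?T"
            using jX[OF into_id[OF d]] d by (intro bexI[of _ "?j (Idt C ?d)"]) (auto intro: le_refl)
          fix g y z assume "(g, y) \<in> ?T" "(g, z) \<in> ?T"
          then show "\<exists>q. (g, q) \<in> ?T \<and> le (Dom C g) y q \<and> le (Dom C g) z q"
            using jX[of g] by (intro exI[of _ "?j g"]) (auto intro: le_refl)
        qed
        show it: "itop ?d \<top>\<^bsub>St ?d\<^esub>" using itop_iff[OF d tX] by simp
        show "iJoin ?d ?T \<top>\<^bsub>St ?d\<^esub>"
        proof (rule iJoinI)
          show "iub ?d ?T \<top>\<^bsub>St ?d\<^esub>"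
            using it unfolding iub_def itop_def by blast
          fix g z assume g: "g \<in> into C ?d" and z: "z \<in> X (Dom C g)" and ub: "iub (Dom C g) (pres g ?T) z"
          have e: "Dom C g \<in> Obj C" using g by auto
          note fg = into_comp[OF f g]
          have ub': "le (Dom C h) y (res h z)" if h: "h \<in> into C (Dom C g)" and y: "y \<in> X (Dom C h)"
            "le (Dom C h) y (?j (Cmp C g h))" for h y
            using ub h y into_comp[OF g h] g by (auto simp: iub_def mem_pres)
          have "le (Dom C g) (res g (res f x)) z"
          proof -
            have "le (Dom C (Cmp C f g)) (res (Cmp C f g) x) z"
            proof (rule iJoin_le[OF into_dom[OF fg] iJoin_res[OF fg x j] res_closed[OF fg x] pres_closed[OF fg S]])
              show "z \<in> X (Dom C (Cmp C f g))" using z f g by simp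
              show "iub (Dom C (Cmp C f g)) (pres (Cmp C f g) ?S) z" unfolding iub_def
              proof (intro allI impI)
                fix h y assume "(h, y) \<in> pres (Cmp C f g) ?S"
                then have h: "h \<in> into C (Dom C g)" and y: "y \<in> X (Dom C h)" "le (Dom C h) y (u (Cmp C (Cmp C f g) h))"
                  using f g fg by (auto simp: mem_pres)
                show "le (Dom C h) y (res h z)"
                  using ub'[OF h y(1)] le_trans[OF into_dom[OF h] y(2), of "?j (Cmp C g h)"]
                    jX(2)[OF into_comp[OF g h]] g h by (simp add: comp_assoc_into[OF f g h])
              qed
            qed
            then show ?thesis using f g x by (simp add: res_comp)
          qed
          moreover have "le (Dom C g) (res g w) z"
            using ub'[OF into_id[OF e], of "res g w"] jX(3)[OF g] g w(1) e z by (simp add: intoD)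
          moreover interpret H: frm_hom "St ?d" "St (Dom C g)" "res g" by (rule frm_hom_res[OF g])
          have "res g \<top>\<^bsub>St ?d\<^esub> = res g (res f x) \<squnion>\<^bsub>St (Dom C g)\<^esub> res g w"
            using H.h_join[of "res f x" w] w fx by simp
          ultimately show "le (Dom C g) (res g \<top>\<^bsub>St ?d\<^esub>) z"
            using H.M.join_le[of "res g (res f x)" z "res g w"] fx w(1) g z by simp
        qed
      qed
      \<comment> \<open>The top lies in \<open>?T\<close> over the identity, hence below
        \<open>?j (Idt C ?d)\<close>, which is the join of \<open>u f\<close> and
        \<open>w\<close>.\<close>
      then have "u f \<squnion>\<^bsub>St ?d\<^esub> w = \<top>\<^bsub>St ?d\<^esub>"
        using d f w(1) jX(1)[OF into_id[OF d]] by (intro D.top_le) (auto simp: intoD)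
      then show ?thesis
        using D.le_if_meet_bottom_join_top[of v "u f" w] v w uX[OF f] by simp
    qed
    have "le ?d (reg_interior (St ?d) (res f x)) (u f)"
      unfolding reg_interior_def using D.sup_least[of "{v \<in> carrier (St ?d). well_inside (St ?d) v (res f x)}" "u f"]
        le uX[OF f] by auto
    then show ?thesis using ge by (rule le_antisym[OF d])
  qed
  then show ?thesis using x by blast
qed

abbreviation res_reg :: "'a \<Rightarrow> 'u \<Rightarrow> 'u" where
  "res_reg f \<equiv> restrict (res f) (regs (St (Cod C f)))"

lemma frm_hom_res_reg:
  assumes f: "f \<in> into C c"
  shows "frm_hom (reg_part (St c)) (reg_part (St (Dom C f))) (res_reg f)"
proof -
  interpret H: frm_hom "St c" "St (Dom C f)" "res f" by (rule frm_hom_res[OF f])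
  interpret frm "reg_part (St c)" by (rule H.L.frm_reg_part)
  interpret frm "reg_part (St (Dom C f))" by (rule H.M.frm_reg_part)
  show ?thesis
    by unfold_locales (use H.h_regs H.frame_hom_reg_part f in \<open>auto simp: intoD\<close>)
qed

text \<open>Restriction carries \<open>reg_interior (St c) x\<close> to a regular element below
  \<open>res f x\<close>, hence below the interior of \<open>res f x\<close>; this is the laxness
  condition. Order and injectivity rest on \<open>le_iff_reg_interior\<close>, existence on
  \<open>lax_family_realized\<close>.\<close>

lemma lax_rep_regs: "lax_rep C U L (\<lambda>c. reg_part (St c)) res_reg (\<lambda>c. reg_interior (St c))"
proof (intro lax_rep.intro lax_rep_axioms.intro psh_relation_axioms)
  fix c assume c: "c \<in> Obj C"
  interpret N: normal_frm "St c" by (rule normal_frm_stage[OF c])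
  show "frm (reg_part (St c))" by (rule N.frm_reg_part)
  show "compact_frame (reg_part (St c))" by (rule N.compact_frame_reg_part[OF compact_frame_stage[OF c]])
  show "regular_frame (reg_part (St c))" by (rule N.regular_frame_reg_part)
  fix x
  show "res_reg (Idt C c) x = x" if "x \<in> carrier (reg_part (St c))"
    using that c regs_carrier[of x "St c"] by simp
  assume x: "x \<in> X c"
  show "reg_interior (St c) x \<in> carrier (reg_part (St c))"
    using N.reg_interior_in_regs[of x] x by simp
  fix y assume y: "y \<in> X c"
  show le: "le c x y \<longleftrightarrow> (\<forall>f\<in>into C c. reg_interior (St (Dom C f)) (res f x)
      \<sqsubseteq>\<^bsub>reg_part (St (Dom C f))\<^esub> reg_interior (St (Dom C f)) (res f y))"
    using le_iff_reg_interior[OF c x y] by simp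
  show "x = y" if "\<And>f. f \<in> into C c \<Longrightarrow>
      reg_interior (St (Dom C f)) (res f x) = reg_interior (St (Dom C f)) (res f y)"
    using le_iff_reg_interior[OF c x y] le_iff_reg_interior[OF c y x] that
    by (intro le_antisym[OF c]) (auto simp: le_refl into_dom)
next
  fix f c assume f: "f \<in> into C c"
  show "frm_hom (reg_part (St c)) (reg_part (St (Dom C f))) (res_reg f)" by (rule frm_hom_res_reg[OF f])
  have c: "c \<in> Obj C" "Dom C f \<in> Obj C" using f by (auto simp: into_def)
  interpret H: frm_hom "St c" "St (Dom C f)" "res f" by (rule frm_hom_res[OF f])
  interpret N: normal_frm "St c" by (rule normal_frm_stage[OF c(1)])
  fix x
  show "res_reg (Cmp C f g) x = res_reg g (res_reg f x)"
    if "g \<in> into C (Dom C f)" "x \<in> carrier (reg_part (St c))" for g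
    using that f H.h_regs[of x] into_comp[OF f that(1)] res_comp[OF f that(1), of x] regs_carrier[of x "St c"]
    by (simp add: intoD)
  assume x: "x \<in> X c"
  let ?i = "reg_interior (St c) x"
  have i: "?i \<in> regs (St c)" using N.reg_interior_in_regs[of x] x by simp
  have "le (Dom C f) (res f ?i) (res f x)"
    using le_res[OF f, of ?i x] H.L.reg_interior_le[of x] x by simp
  then show "res_reg f ?i \<sqsubseteq>\<^bsub>reg_part (St (Dom C f))\<^esub> reg_interior (St (Dom C f)) (res f x)"
    using H.M.reg_interior_mono[of "res f ?i" "res f x"] H.M.reg_interior_regs[OF H.h_regs[OF i]] i f x c
    by (simp add: intoD)
next
  fix c u assume c: "c \<in> Obj C"
    and u: "\<And>f. f \<in> into C c \<Longrightarrow> u f \<in> carrier (reg_part (St (Dom C f)))"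
    and lax: "\<And>f g. f \<in> into C c \<Longrightarrow> g \<in> into C (Dom C f) \<Longrightarrow>
      res_reg g (u f) \<sqsubseteq>\<^bsub>reg_part (St (Dom C g))\<^esub> u (Cmp C f g)"
  show "\<exists>x\<in>X c. \<forall>f\<in>into C c. reg_interior (St (Dom C f)) (res f x) = u f"
  proof (rule lax_family_realized[OF c])
    show "u f \<in> regs (St (Dom C f))" if "f \<in> into C c" for f using u[OF that] by simp
    show "le (Dom C g) (res g (u f)) (u (Cmp C f g))" if "f \<in> into C c" "g \<in> into C (Dom C f)" for f g
      using lax[OF that] u[OF that(1)] that by (simp add: intoD)
  qed
qed

text \<open>The interiors of the restrictions of \<open>x\<close> belong to \<open>S\<close> and
  dominate everything well inside these restrictions. A homomorphism is therefore determined by its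
  values on regular elements.\<close>

lemma iJoin_regs_below:
  assumes c: "c \<in> Obj C" and x: "x \<in> X c"
  defines "S \<equiv> {(f, v). f \<in> into C c \<and> v \<in> regs (St (Dom C f)) \<and> le (Dom C f) v (res f x)}"
  shows "S \<in> Pw c" "iJoin c S x"
proof -
  show S: "S \<in> Pw c"
  proof (rule PwI)
    fix f v g assume "(f, v) \<in> S" and g: "g \<in> into C (Dom C f)"
    then have f: "f \<in> into C c" "v \<in> regs (St (Dom C f))" "le (Dom C f) v (res f x)" by (auto simp: S_def)
    interpret H: frm_hom "St (Dom C f)" "St (Dom C g)" "res g" by (rule frm_hom_res[OF g])
    show "(Cmp C f g, res g v) \<in> S"
      using f g x H.h_regs[OF f(2)] le_res[OF g f(3)] by (auto simp: S_def res_comp)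
  qed (auto simp: S_def dest: regs_carrier)
  show "iJoin c S x"
  proof (rule iJoinI)
    show "iub c S x" by (auto simp: iub_def S_def)
    fix f u assume f: "f \<in> into C c" and u: "u \<in> X (Dom C f)" and ub: "iub (Dom C f) (pres f S) u"
    have d: "Dom C f \<in> Obj C" using f by auto
    have fx: "res f x \<in> X (Dom C f)" using f x by auto
    show "le (Dom C f) (res f x) u"
    proof (rule iJoin_le[OF d iJoin_below[OF d fx] fx below_Pw[OF fx] u])
      show "iub (Dom C f) (below (Dom C f) (res f x)) u" unfolding iub_def
      proof (intro allI impI)
        fix g v assume "(g, v) \<in> below (Dom C f) (res f x)"
        then have g: "g \<in> into C (Dom C f)" and v: "v \<in> X (Dom C g)" "well_inside (St (Dom C g)) v (res g (res f x))"
          by (auto simp: below_def)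
        have e: "Dom C g \<in> Obj C" using g by auto
        interpret N: normal_frm "St (Dom C g)" by (rule normal_frm_stage[OF e])
        let ?i = "reg_interior (St (Dom C g)) (res g (res f x))"
        have gx: "res g (res f x) \<in> X (Dom C g)" using g fx by auto
        have "(Cmp C f g, ?i) \<in> S"
          using f g x N.reg_interior_in_regs[of "res g (res f x)"] N.reg_interior_le[of "res g (res f x)"] gx
          by (auto simp: S_def res_comp)
        then have "le (Dom C g) ?i (res g u)" using ub g by (auto simp: iub_def mem_pres)
        moreover have "le (Dom C g) v ?i" using N.le_reg_interior[of v "res g (res f x)"] v by simp
        ultimately show "le (Dom C g) v (res g u)"
          using internal_kreg.le_trans[OF internal_kreg_axioms e] by blast
      qed
    qed
  qed
qed

end

section \<open>Internal homomorphisms\<close>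

lemma is_category_presheaf_topos: "is_category C \<Longrightarrow> is_category (presheaf_topos U C)"
  unfolding presheaf_topos_def
  by (intro is_category_functor_category is_category_op_cat is_category_set_cat)

lemma Hom_set_cat: "t \<in> Hom (set_cat U) A B \<longleftrightarrow> A \<in> U \<and> B \<in> U \<and> (\<exists>h. t = (A, h, B) \<and> h \<in> A \<rightarrow>\<^sub>E B)"
  by (auto simp: Hom_def set_cat_def)

lemma set_cat_simps [simp]:
  "Idt (set_cat U) A = (A, \<lambda>x\<in>A. x, A)"
  "Cmp (set_cat U) (B', g, D) (A, f, B) = (A, compose A g f, D)"
  by (simp_all add: set_cat_def)

lemma psh_map_Idt: "c \<in> Obj C \<Longrightarrow> psh_map (Idt (presheaf_topos U C) X) c = (\<lambda>x\<in>FObj X c. x)"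
  by (simp add: presheaf_topos_def psh_map_def set_arr_fun_def)

definition img :: "('o, 'a) category \<Rightarrow> ('o \<Rightarrow> 'u \<Rightarrow> 'u) \<Rightarrow> ('a \<times> 'u) set \<Rightarrow> ('a \<times> 'u) set" where
  "img C a S = (\<lambda>(f, x). (f, a (Dom C f) x)) ` S"

lemma mem_img: "(f, y) \<in> img C a S \<longleftrightarrow> (\<exists>x. (f, x) \<in> S \<and> y = a (Dom C f) x)"
  by (force simp: img_def)

locale psh_relation2 = L: psh_relation C U L + M: psh_relation C U M
  for C :: "('o, 'a) category" and U :: "'u set set" and L M
begin

text \<open>The first conjunct rebuilds the arrow from its underlying maps, so that equality of
  arrows can be checked on \<open>psh_map\<close>.\<close>

lemma Hom_presheaf_iff:
  "\<alpha> \<in> Hom (presheaf_topos U C) (fst L) (fst M) \<longleftrightarrow>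
     \<alpha> = (fst L, \<lambda>c\<in>Obj C. (L.X c, psh_map \<alpha> c, M.X c), fst M) \<and>
     (\<forall>c\<in>Obj C. psh_map \<alpha> c \<in> L.X c \<rightarrow>\<^sub>E M.X c) \<and>
     (\<forall>c\<in>Obj C. \<forall>f\<in>into C c. \<forall>x\<in>L.X c. psh_map \<alpha> (Dom C f) (L.res f x) = M.res f (psh_map \<alpha> c x))"
  (is "?l \<longleftrightarrow> ?a \<and> ?b \<and> ?n")
proof
  assume ?l
  then obtain \<eta> where \<eta>: "\<alpha> = (fst L, \<eta>, fst M)" "is_nat_trans (op_cat C) (set_cat U) (fst L) (fst M) \<eta>"
    "\<eta> \<in> extensional (Obj C)"
    by (auto simp: presheaf_topos_def Hom_functor_category)
  have h: "\<eta> c = (L.X c, psh_map \<alpha> c, M.X c)" "psh_map \<alpha> c \<in> L.X c \<rightarrow>\<^sub>E M.X c" if "c \<in> Obj C" for c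
  proof -
    obtain h where "\<eta> c = (L.X c, h, M.X c)" "h \<in> L.X c \<rightarrow>\<^sub>E M.X c"
      using \<eta>(2) \<open>c \<in> Obj C\<close> by (auto simp: is_nat_trans_def Hom_set_cat)
    then show "\<eta> c = (L.X c, psh_map \<alpha> c, M.X c)" "psh_map \<alpha> c \<in> L.X c \<rightarrow>\<^sub>E M.X c"
      by (simp_all add: psh_map_def \<eta>(1) set_arr_fun_def)
  qed
  have ?a using \<eta>(1,3) h(1) by (auto simp: extensional_def fun_eq_iff)
  moreover have ?n
  proof (intro ballI)
    fix c f x assume c: "c \<in> Obj C" and f: "f \<in> into C c" and x: "x \<in> L.X c"
    have fA: "f \<in> Arr C" "Cod C f = c" using f by (auto simp: into_def)
    have d: "Dom C f \<in> Obj C" using f by auto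
    have "Cmp (set_cat U) (\<eta> (Dom C f)) (FArr (fst L) f) = Cmp (set_cat U) (FArr (fst M) f) (\<eta> c)"
      using \<eta>(2) fA by (auto simp: is_nat_trans_def)
    then have "compose (L.X c) (psh_map \<alpha> (Dom C f)) (L.res f) = compose (L.X c) (M.res f) (psh_map \<alpha> c)"
      using L.FArr_psh(1)[OF fA(1)] M.FArr_psh(1)[OF fA(1)] h(1)[OF c] h(1)[OF d] fA by simp
    from fun_cong[OF this, of x] show "psh_map \<alpha> (Dom C f) (L.res f x) = M.res f (psh_map \<alpha> c x)"
      using x by (simp add: compose_def)
  qed
  ultimately show "?a \<and> ?b \<and> ?n" using h(2) by simp
next
  assume r: "?a \<and> ?b \<and> ?n"
  let ?\<eta> = "\<lambda>c\<in>Obj C. (L.X c, psh_map \<alpha> c, M.X c)"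
  have "is_nat_trans (op_cat C) (set_cat U) (fst L) (fst M) ?\<eta>" unfolding is_nat_trans_def
  proof (intro conjI ballI)
    fix c assume "c \<in> Obj (op_cat C)"
    then show "?\<eta> c \<in> Hom (set_cat U) (L.X c) (M.X c)"
      using r L.X_in_U M.X_in_U by (simp add: Hom_set_cat)
  next
    fix f assume "f \<in> Arr (op_cat C)"
    then have fA: "f \<in> Arr C" by simp
    then have f: "f \<in> into C (Cod C f)" "Dom C f \<in> Obj C" "Cod C f \<in> Obj C" by (auto simp: into_def)
    have "compose (L.X (Cod C f)) (psh_map \<alpha> (Dom C f)) (L.res f) = compose (L.X (Cod C f)) (M.res f) (psh_map \<alpha> (Cod C f))"
      using r f by (auto simp: compose_def fun_eq_iff)
    then show "Cmp (set_cat U) (?\<eta> (Cod (op_cat C) f)) (FArr (fst L) f) =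
        Cmp (set_cat U) (FArr (fst M) f) (?\<eta> (Dom (op_cat C) f))"
      using f by (simp add: L.FArr_psh(1)[OF fA] M.FArr_psh(1)[OF fA])
  qed
  then have "(fst L, ?\<eta>, fst M) \<in> Hom (presheaf_topos U C) (fst L) (fst M)"
    using L.psh M.psh by (simp add: presheaf_topos_def Hom_functor_category)
  then show ?l using r by metis
qed

definition preserves :: "('o \<Rightarrow> 'u \<Rightarrow> 'u) \<Rightarrow> bool" where
  "preserves a \<longleftrightarrow> (\<forall>c\<in>Obj C.
     (\<forall>t\<in>L.X c. L.itop c t \<longrightarrow> M.itop c (a c t)) \<and>
     (\<forall>x\<in>L.X c. \<forall>y\<in>L.X c. \<forall>m\<in>L.X c. L.imeet c x y m \<longrightarrow> M.imeet c (a c x) (a c y) (a c m)) \<and>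
     (\<forall>S\<in>L.Pw c. \<forall>s\<in>L.X c. L.iJoin c S s \<longrightarrow> M.iJoin c (img C a S) (a c s)))"

definition map_ok :: "('o \<Rightarrow> 'u \<Rightarrow> 'u) \<Rightarrow> bool" where
  "map_ok a \<longleftrightarrow> (\<forall>c\<in>Obj C. \<forall>x\<in>L.X c. a c x \<in> M.X c \<and>
     (\<forall>f\<in>into C c. a (Dom C f) (L.res f x) = M.res f (a c x)))"

lemma map_okD:
  assumes "map_ok a"
  shows "c \<in> Obj C \<Longrightarrow> x \<in> L.X c \<Longrightarrow> a c x \<in> M.X c"
    and "f \<in> into C c \<Longrightarrow> x \<in> L.X c \<Longrightarrow> a (Dom C f) (L.res f x) = M.res f (a c x)"
  using assms by (auto simp: map_ok_def into_def)

lemma img_Pw: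
  assumes a: "map_ok a" and S: "S \<in> L.Pw c"
  shows "img C a S \<in> M.Pw c"
proof (rule M.PwI)
  fix f y assume "(f, y) \<in> img C a S"
  then obtain x where x: "(f, x) \<in> S" "y = a (Dom C f) x" by (auto simp: mem_img)
  note f = L.PwD[OF S x(1)]
  show "f \<in> into C c \<and> y \<in> M.X (Dom C f)" using f x(2) map_okD(1)[OF a] by auto
  fix g assume g: "g \<in> into C (Dom C f)"
  show "(Cmp C f g, M.res g y) \<in> img C a S"
    unfolding mem_img using f(1) f(3)[OF g] g x(2) map_okD(2)[OF a g f(2)]
    by (intro exI[of _ "L.res g x"]) simp
qed

lemma internal_frame_hom_iff:
  assumes \<alpha>: "map_ok (psh_map \<alpha>)"
  shows "internal_frame_hom C L M \<alpha> \<longleftrightarrow> preserves (psh_map \<alpha>)"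
proof
  assume l: "internal_frame_hom C L M \<alpha>"
  show "preserves (psh_map \<alpha>)" unfolding preserves_def
  proof (intro ballI conjI impI)
    fix c assume c: "c \<in> Obj C"
    have E: "{} \<in> L.Pw c" by (rule L.PwI) auto
    note l' = l[unfolded internal_frame_hom_def Let_def, rule_format, OF c]
    {
      fix t assume t: "t \<in> L.X c" "L.itop c t"
      show "M.itop c (psh_map \<alpha> c t)"
        using l'[of "\<lambda>_. t" "\<lambda>_. {}"] t E c map_okD(1)[OF \<alpha> c t(1)] by (simp add: L.forces_top M.forces_top)
    next
      fix x y m assume v: "x \<in> L.X c" "y \<in> L.X c" "m \<in> L.X c" "L.imeet c x y m"
      \<comment> \<open>Valuations are total, so the remaining variables also receive
        \<open>m\<close>; the empty set serves as a dummy value of sort \<open>P L\<close>.\<close>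
      let ?\<rho> = "\<lambda>n::nat. if n = 0 then x else if n = 1 then y else m"
      have "\<forall>n. ?\<rho> n \<in> L.X c" using v by simp
      then show "M.imeet c (psh_map \<alpha> c x) (psh_map \<alpha> c y) (psh_map \<alpha> c m)"
        using l'[of ?\<rho> "\<lambda>_. {}"] v E c map_okD(1)[OF \<alpha> c]
        by (simp add: L.forces_meet[OF c] M.forces_meet[OF c] del: One_nat_def)
    next
      fix S s assume S: "S \<in> L.Pw c" "s \<in> L.X c" "L.iJoin c S s"
      show "M.iJoin c (img C (psh_map \<alpha>) S) (psh_map \<alpha> c s)"
        using l'[of "\<lambda>_. s" "\<lambda>_. S"] S c map_okD(1)[OF \<alpha> c] img_Pw[OF \<alpha> S(1)]
        by (simp add: L.forces_Join[OF c] M.forces_Join[OF c] img_def)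
    }
  qed
next
  assume r: "preserves (psh_map \<alpha>)"
  show "internal_frame_hom C L M \<alpha>" unfolding internal_frame_hom_def Let_def
  proof (intro ballI allI impI)
    fix c and \<rho> :: "nat \<Rightarrow> 'u" and \<sigma> :: "nat \<Rightarrow> ('a \<times> 'u) set"
    assume c: "c \<in> Obj C" and \<rho>: "\<forall>n. \<rho> n \<in> L.X c" and \<sigma>: "\<forall>n. \<sigma> n \<in> L.Pw c"
    have r': "psh_map \<alpha> c (\<rho> n) \<in> M.X c" "img C (psh_map \<alpha>) (\<sigma> n) \<in> M.Pw c" for n
      using \<rho> \<sigma> map_okD(1)[OF \<alpha> c] img_Pw[OF \<alpha>] by auto
    show "(forces C L c \<rho> \<sigma> (fm_top 0) \<longrightarrow>
         forces C M c (psh_map \<alpha> c \<circ> \<rho>) (\<lambda>n. (\<lambda>(f, x). (f, psh_map \<alpha> (Dom C f) x)) ` \<sigma> n) (fm_top 0)) \<and>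
        (forces C L c \<rho> \<sigma> (fm_meet 0 1 2) \<longrightarrow>
         forces C M c (psh_map \<alpha> c \<circ> \<rho>) (\<lambda>n. (\<lambda>(f, x). (f, psh_map \<alpha> (Dom C f) x)) ` \<sigma> n) (fm_meet 0 1 2)) \<and>
        (forces C L c \<rho> \<sigma> (fm_Join 0 0) \<longrightarrow>
         forces C M c (psh_map \<alpha> c \<circ> \<rho>) (\<lambda>n. (\<lambda>(f, x). (f, psh_map \<alpha> (Dom C f) x)) ` \<sigma> n) (fm_Join 0 0))"
      unfolding img_def[symmetric]
      using r c \<rho> \<sigma> r' by (simp add: L.forces_top M.forces_top L.forces_meet[OF c] M.forces_meet[OF c]
          L.forces_Join[OF c] M.forces_Join[OF c] preserves_def del: One_nat_def)
  qed
qed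

end

locale internal_kreg2 = L: internal_kreg C U L + M: internal_kreg C U M
  for C :: "('o, 'a) category" and U :: "'u set set" and L M
begin

sublocale psh_relation2 C U L M ..

end

section \<open>Homomorphisms and their restriction to regular elements\<close>

context internal_kreg2
begin

text \<open>The direct image of a generated set is generated by the images, so preservation of
  internal joins includes preservation of the joins of a stage. The converse fails: on the subobject
  classifier over a single arrow, sending the middle sieve to the top is natural and a frame map at
  each stage, but it destroys an internal join.\<close>

lemma frm_hom_stage:
  assumes a: "map_ok a" and p: "preserves a" and c: "c \<in> Obj C"
  shows "frm_hom (L.St c) (M.St c) (a c)"
proof -
  interpret A: frm "L.St c" by (rule L.frm_stage[OF c])
  interpret B: frm "M.St c" by (rule M.frm_stage[OF c])
  note aX = map_okD(1)[OF a c]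
  have tX: "\<top>\<^bsub>L.St c\<^esub> \<in> L.X c" using A.top_closed by simp
  have "a c \<top>\<^bsub>L.St c\<^esub> = \<top>\<^bsub>M.St c\<^esub>"
    using p c tX L.itop_iff[OF c tX] M.itop_iff[OF c aX[OF tX]] by (auto simp: preserves_def)
  moreover have "a c (x \<sqinter>\<^bsub>L.St c\<^esub> y) = a c x \<sqinter>\<^bsub>M.St c\<^esub> a c y" if xy: "x \<in> L.X c" "y \<in> L.X c" for x y
  proof -
    have m: "x \<sqinter>\<^bsub>L.St c\<^esub> y \<in> L.X c" using A.meet_closed[of x y] xy by simp
    then have "M.imeet c (a c x) (a c y) (a c (x \<sqinter>\<^bsub>L.St c\<^esub> y))"
      using p c xy L.imeet_iff[OF c xy m] by (simp add: preserves_def)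
    then show ?thesis using M.imeet_iff[OF c] aX xy m by simp
  qed
  moreover have "a c (\<Squnion>\<^bsub>L.St c\<^esub> A) = \<Squnion>\<^bsub>M.St c\<^esub> (a c ` A)" if A: "A \<subseteq> L.X c" for A
  proof -
    have A': "a c ` A \<subseteq> M.X c" using A aX by auto
    have "img C a (L.gen c A) = M.gen c (a c ` A)"
    proof -
      have "(f, y) \<in> img C a (L.gen c A) \<longleftrightarrow> (f, y) \<in> M.gen c (a c ` A)" for f y
      proof (cases "f \<in> into C c")
        case f: True
        have "(\<exists>x\<in>A. y = a (Dom C f) (L.res f x)) \<longleftrightarrow> (\<exists>x\<in>A. y = M.res f (a c x))"
          using map_okD(2)[OF a f] A by (intro bex_cong[OF HOL.refl]) auto
        then show ?thesis using f by (auto simp: mem_img L.gen_def M.gen_def)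
      qed (auto simp: mem_img L.gen_def M.gen_def)
      then show ?thesis by auto
    qed
    moreover have "M.iJoin c (img C a (L.gen c A)) (a c (\<Squnion>\<^bsub>L.St c\<^esub> A))"
      using p c L.gen_Pw[OF A] L.iJoin_gen[OF c A] L.Sup_closed[OF c A] by (simp add: preserves_def)
    ultimately show ?thesis
      using M.iJoin_unique[OF c M.gen_Pw[OF A'] aX[OF L.Sup_closed[OF c A]] M.Sup_closed[OF c A'] _ M.iJoin_gen[OF c A']]
      by simp
  qed
  ultimately show ?thesis
    by unfold_locales (auto simp: frame_hom_def intro: aX)
qed

text \<open>Both maps preserve the internal join of \<open>iJoin_regs_below\<close>, and the two
  direct images of the set of regular elements are equal.\<close>

lemma hom_eq_if_eq_on_regs:
  assumes a: "map_ok a" "preserves a" and b: "map_ok b" "preserves b"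
    and eq: "\<And>c x. c \<in> Obj C \<Longrightarrow> x \<in> regs (L.St c) \<Longrightarrow> a c x = b c x"
    and c: "c \<in> Obj C" and x: "x \<in> L.X c"
  shows "a c x = b c x"
proof -
  let ?S = "{(f, v). f \<in> into C c \<and> v \<in> regs (L.St (Dom C f)) \<and> L.le (Dom C f) v (L.res f x)}"
  note S = L.iJoin_regs_below[OF c x]
  have "img C a ?S = img C b ?S"
    unfolding img_def by (rule image_cong) (auto intro!: eq)
  moreover have "M.iJoin c (img C a ?S) (a c x)" using a(2) c x S unfolding preserves_def by blast
  moreover have "M.iJoin c (img C b ?S) (b c x)" using b(2) c x S unfolding preserves_def by blast
  ultimately show ?thesis
    using M.iJoin_unique[OF c img_Pw[OF a(1) S(1)] map_okD(1)[OF a(1) c x] map_okD(1)[OF b(1) c x]] by simp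
qed

text \<open>The value at \<open>x\<close> is the element whose family is \<open>b\<close> applied to
  the family of \<open>x\<close>. That family is lax because \<open>b\<close> is monotone and
  natural. Top, meets and internal joins are componentwise, so they are preserved because each
  \<open>b (Dom C f)\<close> is a frame homomorphism.\<close>

lemma hom_extends_from_regs:
  assumes hom: "\<And>c. c \<in> Obj C \<Longrightarrow> frm_hom (reg_part (L.St c)) (reg_part (M.St c)) (b c)"
    and nat: "\<And>c f x. f \<in> into C c \<Longrightarrow> x \<in> regs (L.St c) \<Longrightarrow> b (Dom C f) (L.res f x) = M.res f (b c x)"
  shows "\<exists>a. map_ok a \<and> preserves a \<and> (\<forall>c\<in>Obj C. \<forall>x\<in>regs (L.St c). a c x = b c x)"
proof -
  interpret LR: lax_rep C U L "\<lambda>c. reg_part (L.St c)" L.res_reg "\<lambda>c. reg_interior (L.St c)"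
    by (rule L.lax_rep_regs)
  interpret MR: lax_rep C U M "\<lambda>c. reg_part (M.St c)" M.res_reg "\<lambda>c. reg_interior (M.St c)"
    by (rule M.lax_rep_regs)
  have ex: "\<exists>y. y \<in> M.X c \<and> (\<forall>f\<in>into C c. MR.comp_at y f = b (Dom C f) (LR.comp_at x f))"
    if c: "c \<in> Obj C" and x: "x \<in> L.X c" for c x
  proof -
    obtain y where "y \<in> M.X c" "\<And>f. f \<in> into C c \<Longrightarrow> MR.comp_at y f = b (Dom C f) (LR.comp_at x f)"
    proof (rule MR.realize[OF c, of "\<lambda>f. b (Dom C f) (LR.comp_at x f)"])
      fix f assume f: "f \<in> into C c"
      interpret B: frm_hom "reg_part (L.St (Dom C f))" "reg_part (M.St (Dom C f))" "b (Dom C f)"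
        by (rule hom[OF L.into_dom[OF f]])
      show bf: "b (Dom C f) (LR.comp_at x f) \<in> carrier (reg_part (M.St (Dom C f)))"
        using B.h LR.comp_at_closed[OF f x] by blast
      fix g assume g: "g \<in> into C (Dom C f)"
      interpret G: frm_hom "reg_part (L.St (Dom C g))" "reg_part (M.St (Dom C g))" "b (Dom C g)"
        by (rule hom[OF L.into_dom[OF g]])
      interpret H: frm_hom "reg_part (L.St (Dom C f))" "reg_part (L.St (Dom C g))" "L.res_reg g"
        by (rule L.frm_hom_res_reg[OF g])
      have xf: "LR.comp_at x f \<in> regs (L.St (Dom C f))" using LR.comp_at_closed[OF f x] by simp
      have "M.res_reg g (b (Dom C f) (LR.comp_at x f)) = b (Dom C g) (L.res_reg g (LR.comp_at x f))"
        using nat[OF g xf] bf xf g by (simp add: intoD)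
      then show "M.res_reg g (b (Dom C f) (LR.comp_at x f)) \<sqsubseteq>\<^bsub>reg_part (M.St (Dom C g))\<^esub>
          b (Dom C (Cmp C f g)) (LR.comp_at x (Cmp C f g))"
        using G.h_mono[of "L.res_reg g (LR.comp_at x f)" "LR.comp_at x (Cmp C f g)"] LR.comp_at_lax[OF f g x]
          H.h[of "LR.comp_at x f"] xf LR.comp_at_closed[OF L.into_comp[OF f g] x] f g by simp
    qed (use that in auto)
    then show ?thesis by blast
  qed
  \<comment> \<open>\<open>MR.eqI\<close> makes such an element unique, so nothing depends on the
    choice.\<close>
  define a where "a c x = (SOME y. y \<in> M.X c \<and> (\<forall>f\<in>into C c. MR.comp_at y f = b (Dom C f) (LR.comp_at x f)))"
    for c x
  have aX: "a c x \<in> M.X c" and comp_a: "\<And>f. f \<in> into C c \<Longrightarrow> MR.comp_at (a c x) f = b (Dom C f) (LR.comp_at x f)"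
    if "c \<in> Obj C" "x \<in> L.X c" for c x
    using someI_ex[OF ex[OF that]] unfolding a_def[symmetric] by auto
  have ok: "map_ok a" unfolding map_ok_def
  proof (intro ballI conjI)
    fix c x assume c: "c \<in> Obj C" and x: "x \<in> L.X c"
    show "a c x \<in> M.X c" by (rule aX[OF c x])
    fix f assume f: "f \<in> into C c"
    have d: "Dom C f \<in> Obj C" and fx: "L.res f x \<in> L.X (Dom C f)" using f x by auto
    show "a (Dom C f) (L.res f x) = M.res f (a c x)"
    proof (rule MR.eqI[OF d aX[OF d fx] M.res_closed[OF f aX[OF c x]]])
      fix g assume g: "g \<in> into C (Dom C f)"
      show "MR.comp_at (a (Dom C f) (L.res f x)) g = MR.comp_at (M.res f (a c x)) g"
        using comp_a[OF d fx g] comp_a[OF c x L.into_comp[OF f g]] f g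
        by (simp add: MR.comp_at_res[OF f g aX[OF c x]] LR.comp_at_res[OF f g x])
    qed
  qed
  have "preserves a" unfolding preserves_def
  proof (intro ballI conjI impI)
    fix c assume c: "c \<in> Obj C"
    {
      fix t assume t: "t \<in> L.X c" "L.itop c t"
      show "M.itop c (a c t)" unfolding MR.itop_iff_comp[OF c aX[OF c t(1)]]
      proof
        fix f assume f: "f \<in> into C c"
        interpret B: frm_hom "reg_part (L.St (Dom C f))" "reg_part (M.St (Dom C f))" "b (Dom C f)"
          by (rule hom[OF L.into_dom[OF f]])
        show "MR.comp_at (a c t) f = \<top>\<^bsub>reg_part (M.St (Dom C f))\<^esub>"
          using comp_a[OF c t(1) f] t f B.h_top by (simp add: LR.itop_iff_comp[OF c])
      qed
    next
      fix x y m assume v: "x \<in> L.X c" "y \<in> L.X c" "m \<in> L.X c" "L.imeet c x y m"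
      show "M.imeet c (a c x) (a c y) (a c m)"
        unfolding MR.imeet_iff_comp[OF c aX[OF c v(1)] aX[OF c v(2)] aX[OF c v(3)]]
      proof
        fix f assume f: "f \<in> into C c"
        interpret B: frm_hom "reg_part (L.St (Dom C f))" "reg_part (M.St (Dom C f))" "b (Dom C f)"
          by (rule hom[OF L.into_dom[OF f]])
        show "MR.comp_at (a c m) f = MR.comp_at (a c x) f \<sqinter>\<^bsub>reg_part (M.St (Dom C f))\<^esub> MR.comp_at (a c y) f"
          using comp_a[OF c _ f] v f B.h_meet[OF LR.comp_at_closed[OF f v(1)] LR.comp_at_closed[OF f v(2)]]
          by (simp add: LR.imeet_iff_comp[OF c])
      qed
    next
      fix S s assume S: "S \<in> L.Pw c" and s: "s \<in> L.X c" and j: "L.iJoin c S s"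
      show "M.iJoin c (img C a S) (a c s)"
      proof (rule MR.iJoin_if_comp[OF c img_Pw[OF ok S] aX[OF c s]])
        fix f assume f: "f \<in> into C c"
        have d: "Dom C f \<in> Obj C" using f by auto
        interpret B: frm_hom "reg_part (L.St (Dom C f))" "reg_part (M.St (Dom C f))" "b (Dom C f)"
          by (rule hom[OF d])
        have r: "reg_interior (M.St (Dom C f)) (a (Dom C f) x) = b (Dom C f) (reg_interior (L.St (Dom C f)) x)"
          if "x \<in> L.X (Dom C f)" for x
          using comp_a[OF d that L.into_id[OF d]] MR.comp_at_id[OF d aX[OF d that]] LR.comp_at_id[OF d that] d by simp
        have "MR.vals (img C a S) f = b (Dom C f) ` LR.vals S f"
        proof -
          have "{y. (f, y) \<in> img C a S} = a (Dom C f) ` {x. (f, x) \<in> S}" by (auto simp: mem_img)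
          then show ?thesis using r L.PwD(2)[OF S] by (auto simp: image_image intro!: image_cong)
        qed
        then show "MR.comp_at (a c s) f = \<Squnion>\<^bsub>reg_part (M.St (Dom C f))\<^esub> MR.vals (img C a S) f"
          using comp_a[OF c s f] j f B.h_Sup[OF LR.vals_closed[OF S f]] by (simp add: LR.iJoin_iff_comp[OF c S s])
      qed
    }
  qed
  \<comment> \<open>Restrictions of the regular elements \<open>x\<close> and \<open>b c x\<close>
    are regular, hence equal to their interiors. Both families therefore have the component
    \<open>b (Dom C f) (L.res f x)\<close> at \<open>f\<close>.\<close>
  moreover have "a c x = b c x" if c: "c \<in> Obj C" and x: "x \<in> regs (L.St c)" for c x
  proof -
    interpret B: frm_hom "reg_part (L.St c)" "reg_part (M.St c)" "b c" by (rule hom[OF c])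
    have xX: "x \<in> L.X c" and b: "b c x \<in> regs (M.St c)" and bX: "b c x \<in> M.X c"
      using regs_carrier[OF x] B.h[of x] x regs_carrier[of "b c x" "M.St c"] by auto
    show ?thesis
    proof (rule MR.eqI[OF c aX[OF c xX] bX])
      fix f assume f: "f \<in> into C c"
      interpret HL: frm_hom "L.St c" "L.St (Dom C f)" "L.res f" by (rule L.frm_hom_res[OF f])
      interpret HM: frm_hom "M.St c" "M.St (Dom C f)" "M.res f" by (rule M.frm_hom_res[OF f])
      show "MR.comp_at (a c x) f = MR.comp_at (b c x) f"
        using comp_a[OF c xX f] nat[OF f x] HL.M.reg_interior_regs[OF HL.h_regs[OF x]]
          HM.M.reg_interior_regs[OF HM.h_regs[OF b]]
        by (simp add: MR.comp_at_def LR.comp_at_def)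
    qed
  qed
  ultimately show ?thesis using ok by blast
qed

lemma map_ok_if_Hom: "\<alpha> \<in> Hom (presheaf_topos U C) (fst L) (fst M) \<Longrightarrow> map_ok (psh_map \<alpha>)"
  by (auto simp: Hom_presheaf_iff map_ok_def)

end

section \<open>The category of internal compact regular frames\<close>

lemma Arr_internal_kreg_frm:
  assumes "is_category C"
  shows "(L, \<alpha>, M) \<in> Arr (internal_kreg_frm U C) \<longleftrightarrow>
    internal_kreg C U L \<and> internal_kreg C U M \<and> \<alpha> \<in> Hom (presheaf_topos U C) (fst L) (fst M) \<and>
    psh_relation2.preserves C L M (psh_map \<alpha>)" (is "?l \<longleftrightarrow> ?r")
proof (cases "internal_kreg C U L \<and> internal_kreg C U M \<and> \<alpha> \<in> Hom (presheaf_topos U C) (fst L) (fst M)")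
  case True
  then interpret L: internal_kreg C U L by blast
  interpret M: internal_kreg C U M using True by blast
  interpret internal_kreg2 C U L M ..
  show ?thesis
    using True internal_frame_hom_iff[OF map_ok_if_Hom]
    by (auto simp: internal_kreg_frm_def internal_kreg_frame_iff[OF assms])
qed (auto simp: internal_kreg_frm_def internal_kreg_frame_iff[OF assms])

lemma Obj_internal_kreg_frm:
  "is_category C \<Longrightarrow> L \<in> Obj (internal_kreg_frm U C) \<longleftrightarrow> internal_kreg C U L"
  by (simp add: internal_kreg_frm_def internal_kreg_frame_iff)

lemma internal_kreg_frm_simps [simp]:
  "Dom (internal_kreg_frm U C) (L, \<alpha>, M) = L"
  "Cod (internal_kreg_frm U C) (L, \<alpha>, M) = M"
  "Idt (internal_kreg_frm U C) L = (L, Idt (presheaf_topos U C) (fst L), L)"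
  "Cmp (internal_kreg_frm U C) (M', \<beta>, N) (L, \<alpha>, M) = (L, Cmp (presheaf_topos U C) \<beta> \<alpha>, N)"
  by (simp_all add: internal_kreg_frm_def)

lemma Hom_internal_kreg_frm:
  assumes "is_category C"
  shows "t \<in> Hom (internal_kreg_frm U C) L M \<longleftrightarrow> (\<exists>\<alpha>. t = (L, \<alpha>, M) \<and>
    internal_kreg C U L \<and> internal_kreg C U M \<and> \<alpha> \<in> Hom (presheaf_topos U C) (fst L) (fst M) \<and>
    psh_relation2.preserves C L M (psh_map \<alpha>))"
  by (cases t) (auto simp: Hom_def[of "internal_kreg_frm U C"] Arr_internal_kreg_frm[OF assms])

lemma psh_map_comp:
  assumes "internal_kreg C U L" "internal_kreg C U M" "internal_kreg C U N"
    and \<alpha>: "\<alpha> \<in> Hom (presheaf_topos U C) (fst L) (fst M)" and \<beta>: "\<beta> \<in> Hom (presheaf_topos U C) (fst M) (fst N)"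
    and c: "c \<in> Obj C"
  shows "psh_map (Cmp (presheaf_topos U C) \<beta> \<alpha>) c = compose (FObj (fst L) c) (psh_map \<beta> c) (psh_map \<alpha> c)"
proof -
  interpret L: internal_kreg C U L by fact
  interpret M: internal_kreg C U M by fact
  interpret N: internal_kreg C U N by fact
  interpret A: internal_kreg2 C U L M ..
  interpret B: internal_kreg2 C U M N ..
  obtain \<eta> \<theta> where e: "\<alpha> = (fst L, \<eta>, fst M)" "\<beta> = (fst M, \<theta>, fst N)"
    "\<eta> c = (L.X c, psh_map \<alpha> c, M.X c)" "\<theta> c = (M.X c, psh_map \<beta> c, N.X c)"
    using A.Hom_presheaf_iff[THEN iffD1, OF \<alpha>, THEN conjunct1] B.Hom_presheaf_iff[THEN iffD1, OF \<beta>, THEN conjunct1] c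
    by (metis (no_types, lifting) restrict_apply')
  have "Cmp (presheaf_topos U C) \<beta> \<alpha> = (fst L, \<lambda>a\<in>Obj C. Cmp (set_cat U) (\<theta> a) (\<eta> a), fst N)"
    unfolding e(1,2) by (simp add: presheaf_topos_def)
  then have "psh_map (Cmp (presheaf_topos U C) \<beta> \<alpha>) c = set_arr_fun (Cmp (set_cat U) (\<theta> c) (\<eta> c))"
    using c by (simp add: psh_map_def)
  then show ?thesis by (simp add: e(3,4) set_arr_fun_def)
qed

lemma is_category_internal_kreg_frm:
  assumes C: "is_category C"
  shows "is_category (internal_kreg_frm U C)"
proof (rule is_categoryI)
  let ?T = "presheaf_topos U C" and ?I = "internal_kreg_frm U C"
  interpret T: cat ?T by standard (rule is_category_presheaf_topos[OF C])
  interpret C: cat C by standard (rule C)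
  show "Dom ?I f \<in> Obj ?I \<and> Cod ?I f \<in> Obj ?I" if "f \<in> Arr ?I" for f
    using that by (cases f) (auto simp: Arr_internal_kreg_frm[OF C] Obj_internal_kreg_frm[OF C])
  show "Idt ?I L \<in> Hom ?I L L" if "L \<in> Obj ?I" for L
  proof -
    interpret L: internal_kreg C U L using that by (simp add: Obj_internal_kreg_frm[OF C])
    interpret A: internal_kreg2 C U L L ..
    have "img C (psh_map (Idt ?T (fst L))) S = S" if "S \<in> L.Pw c" for S c
    proof -
      have "(f, y) \<in> img C (psh_map (Idt ?T (fst L))) S \<longleftrightarrow> (f, y) \<in> S" for f y
      proof -
        have "psh_map (Idt ?T (fst L)) (Dom C f) x = x" if "(f, x) \<in> S" for x
          using L.PwD(1,2)[OF \<open>S \<in> L.Pw c\<close> that] by (auto simp: psh_map_Idt C.into_dom)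
        then show ?thesis by (force simp: mem_img)
      qed
      then show ?thesis by auto
    qed
    then have "A.preserves (psh_map (Idt ?T (fst L)))"
      by (simp add: A.preserves_def psh_map_Idt)
    then show ?thesis
      using T.id_hom[OF L.psh] L.internal_kreg_axioms by (simp add: Hom_internal_kreg_frm[OF C])
  qed
  fix f assume f0: "f \<in> Arr ?I"
  obtain L \<alpha> M where fe: "f = (L, \<alpha>, M)" by (cases f)
  note f = f0[unfolded fe Arr_internal_kreg_frm[OF C]]
  interpret L: internal_kreg C U L using f by blast
  interpret M: internal_kreg C U M using f by blast
  have \<alpha>: "\<alpha> \<in> Hom ?T (fst L) (fst M)" using f by blast
  show "Cmp ?I f (Idt ?I (Dom ?I f)) = f \<and> Cmp ?I (Idt ?I (Cod ?I f)) f = f"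
    using HomD[OF \<alpha>] by (simp add: fe)
  fix g assume g0: "g \<in> Arr ?I" "Cod ?I f = Dom ?I g"
  obtain \<beta> N where ge: "g = (M, \<beta>, N)" using g0(2) by (cases g) (auto simp: fe)
  note g = g0(1)[unfolded ge Arr_internal_kreg_frm[OF C]]
  interpret N: internal_kreg C U N using g by blast
  have \<beta>: "\<beta> \<in> Hom ?T (fst M) (fst N)" using g by blast
  interpret A: internal_kreg2 C U L M ..
  interpret B: internal_kreg2 C U M N ..
  interpret AB: internal_kreg2 C U L N ..
  let ?\<gamma> = "Cmp ?T \<beta> \<alpha>"
  have \<gamma>: "psh_map ?\<gamma> c = compose (L.X c) (psh_map \<beta> c) (psh_map \<alpha> c)" if "c \<in> Obj C" for c
    by (rule psh_map_comp[OF L.internal_kreg_axioms M.internal_kreg_axioms N.internal_kreg_axioms \<alpha> \<beta> that])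
  have im: "img C (psh_map ?\<gamma>) S = img C (psh_map \<beta>) (img C (psh_map \<alpha>) S)" if "S \<in> L.Pw c" for S c
  proof -
    have e: "psh_map ?\<gamma> (Dom C f) x = psh_map \<beta> (Dom C f) (psh_map \<alpha> (Dom C f) x)" if "(f, x) \<in> S" for f x
      using L.PwD(1,2)[OF \<open>S \<in> L.Pw c\<close> that] by (simp add: \<gamma> C.into_dom compose_def)
    show ?thesis unfolding img_def image_image by (rule image_cong) (auto simp: e)
  qed
  have mok: "A.map_ok (psh_map \<alpha>)" "A.preserves (psh_map \<alpha>)" "B.preserves (psh_map \<beta>)"
    using A.map_ok_if_Hom[OF \<alpha>] f g by auto
  have "AB.preserves (psh_map ?\<gamma>)"
    unfolding AB.preserves_def
  proof (intro ballI conjI impI)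
    fix c assume c: "c \<in> Obj C"
    note pa = mok(2)[unfolded A.preserves_def, rule_format, OF c]
    note pb = mok(3)[unfolded B.preserves_def, rule_format, OF c]
    note aX = A.map_okD(1)[OF mok(1) c]
    show "N.itop c (psh_map ?\<gamma> c t)" if "t \<in> L.X c" "L.itop c t" for t
      using pa pb aX that by (simp add: \<gamma>[OF c] compose_def)
    show "N.imeet c (psh_map ?\<gamma> c x) (psh_map ?\<gamma> c y) (psh_map ?\<gamma> c m)"
      if "x \<in> L.X c" "y \<in> L.X c" "m \<in> L.X c" "L.imeet c x y m" for x y m
      using pa pb aX that by (simp add: \<gamma>[OF c] compose_def)
    show "N.iJoin c (img C (psh_map ?\<gamma>) S) (psh_map ?\<gamma> c s)"
      if "S \<in> L.Pw c" "s \<in> L.X c" "L.iJoin c S s" for S s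
      using pa pb aX that A.img_Pw[OF mok(1) that(1)] by (simp add: im[OF that(1)] \<gamma>[OF c] compose_def)
  qed
  then show "Cmp ?I g f \<in> Hom ?I (Dom ?I f) (Cod ?I g)"
    using T.comp_hom[OF \<alpha> \<beta>] L.internal_kreg_axioms N.internal_kreg_axioms
    by (simp add: fe ge Hom_internal_kreg_frm[OF C])
  fix h assume h0: "h \<in> Arr ?I" "Cod ?I g = Dom ?I h"
  obtain \<delta> N' where he: "h = (N, \<delta>, N')" using h0(2) by (cases h) (auto simp: ge)
  have "\<delta> \<in> Hom ?T (fst N) (fst N')" using h0(1) by (simp add: he Arr_internal_kreg_frm[OF C])
  then show "Cmp ?I h (Cmp ?I g f) = Cmp ?I (Cmp ?I h g) f"
    using T.comp_assoc_hom[OF \<alpha> \<beta>] by (simp add: fe ge he)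
qed

section \<open>The functor of regular elements\<close>

text \<open>Both components are cut off outside the objects and arrows of \<open>C\<close>, and each
  map outside the regular elements, as extensionality in the target categories demands.\<close>

definition reg_psh :: "('o, 'a) category \<Rightarrow> ('o, 'a, 'u) psh_rel \<Rightarrow>
    ('o, 'a, 'u gorder, 'u gorder \<times> ('u \<Rightarrow> 'u) \<times> 'u gorder) fctr" where
  "reg_psh C L = \<lparr>FObj = (\<lambda>c\<in>Obj C. reg_part (stage L c)),
     FArr = (\<lambda>f\<in>Arr C. (reg_part (stage L (Cod C f)),
       restrict (psh_restrict (fst L) f) (regs (stage L (Cod C f))), reg_part (stage L (Dom C f))))\<rparr>"

definition reg_nat :: "('o, 'a) category \<Rightarrow> ('o, 'a, 'u) psh_rel \<Rightarrow> ('o \<Rightarrow> 'u \<Rightarrow> 'u) \<Rightarrow> ('o, 'a, 'u) psh_rel \<Rightarrow>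
    'o \<Rightarrow> 'u gorder \<times> ('u \<Rightarrow> 'u) \<times> 'u gorder" where
  "reg_nat C L a M = (\<lambda>c\<in>Obj C. (reg_part (stage L c), restrict (a c) (regs (stage L c)), reg_part (stage M c)))"

definition reg_fctr where
  "reg_fctr C = \<lparr>FObj = reg_psh C, FArr = (\<lambda>(L, \<alpha>, M). (reg_psh C L, reg_nat C L (psh_map \<alpha>) M, reg_psh C M))\<rparr>"

lemma reg_psh_simps [simp]:
  "c \<in> Obj C \<Longrightarrow> FObj (reg_psh C L) c = reg_part (stage L c)"
  "f \<in> Arr C \<Longrightarrow> FArr (reg_psh C L) f = (reg_part (stage L (Cod C f)),
     restrict (psh_restrict (fst L) f) (regs (stage L (Cod C f))), reg_part (stage L (Dom C f)))"
  by (simp_all add: reg_psh_def)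

text \<open>The carrier is a subset of \<open>X c\<close>, and the universe is closed under subsets;
  the frame properties are those of the representing frames in \<open>lax_rep_regs\<close>.\<close>

lemma (in internal_kreg) reg_part_Obj:
  assumes U: "set_universe U" and c: "c \<in> Obj C"
  shows "reg_part (St c) \<in> Obj (kreg_frm U)"
proof -
  interpret R: lax_rep C U L "\<lambda>c. reg_part (St c)" res_reg "\<lambda>c. reg_interior (St c)" by (rule lax_rep_regs)
  have "regs (St c) \<in> U"
    using U X_in_U[OF c] regs_subset[of "St c"] by (auto simp: set_universe_def)
  then show ?thesis
    using R.K_frm[OF c] R.K_compact[OF c] R.K_regular[OF c] by (simp add: Obj_kreg_frm)
qed

lemma (in internal_kreg) reg_psh_Obj:
  assumes U: "set_universe U"
  shows "reg_psh C L \<in> Obj (functor_category (op_cat C) (kreg_frm U))"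
proof -
  have "is_functor (op_cat C) (kreg_frm U) (reg_psh C L)"
    unfolding is_functor_def
  proof (intro conjI ballI impI)
    fix c assume "c \<in> Obj (op_cat C)"
    then have c: "c \<in> Obj C" by simp
    show "FObj (reg_psh C L) c \<in> Obj (kreg_frm U)" using reg_part_Obj[OF U c] c by simp
    show "FArr (reg_psh C L) (Idt (op_cat C) c) = Idt (kreg_frm U) (FObj (reg_psh C L) c)"
      using c regs_carrier[of _ "St c"] by (auto intro!: restrict_ext)
  next
    fix f assume "f \<in> Arr (op_cat C)"
    then have fA: "f \<in> Arr C" by simp
    then have f: "f \<in> into C (Cod C f)" "Cod C f \<in> Obj C" "Dom C f \<in> Obj C" by (auto simp: into_def)
    interpret H: frm_hom "reg_part (St (Cod C f))" "reg_part (St (Dom C f))" "res_reg f"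
      by (rule frm_hom_res_reg[OF f(1)])
    show "FArr (reg_psh C L) f \<in>
        Hom (kreg_frm U) (FObj (reg_psh C L) (Dom (op_cat C) f)) (FObj (reg_psh C L) (Cod (op_cat C) f))"
      using f fA reg_part_Obj[OF U] H.frame_hom H.h by (auto simp: Hom_kreg_frm)
    fix g assume "g \<in> Arr (op_cat C)" "Cod (op_cat C) f = Dom (op_cat C) g"
    then have gA: "g \<in> Arr C" "Cod C g = Dom C f" by auto
    then have g: "g \<in> into C (Dom C f)" by (simp add: into_def)
    have "compose (regs (St (Cod C f))) (res_reg g) (res_reg f) = restrict (res (Cmp C f g)) (regs (St (Cod C f)))"
      using H.h res_comp[OF f(1) g] regs_carrier[of _ "St (Cod C f)"] gA by (auto simp: compose_def fun_eq_iff)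
    then show "FArr (reg_psh C L) (Cmp (op_cat C) g f) =
        Cmp (kreg_frm U) (FArr (reg_psh C L) g) (FArr (reg_psh C L) f)"
      using fA gA by simp
  qed
  then show ?thesis by (simp add: Obj_functor_category reg_psh_def)
qed

lemma reg_nat_Hom:
  assumes U: "set_universe U" and L: "internal_kreg C U L" and M: "internal_kreg C U M"
    and \<alpha>: "\<alpha> \<in> Hom (presheaf_topos U C) (fst L) (fst M)" "psh_relation2.preserves C L M (psh_map \<alpha>)"
  shows "(reg_psh C L, reg_nat C L (psh_map \<alpha>) M, reg_psh C M) \<in>
    Hom (functor_category (op_cat C) (kreg_frm U)) (reg_psh C L) (reg_psh C M)"
proof -
  interpret L: internal_kreg C U L by fact
  interpret M: internal_kreg C U M by fact
  interpret A: internal_kreg2 C U L M ..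
  note ok = A.map_ok_if_Hom[OF \<alpha>(1)]
  have hom: "frm_hom (L.St c) (M.St c) (psh_map \<alpha> c)" if "c \<in> Obj C" for c
    by (rule A.frm_hom_stage[OF ok \<alpha>(2) that])
  have "is_nat_trans (op_cat C) (kreg_frm U) (reg_psh C L) (reg_psh C M) (reg_nat C L (psh_map \<alpha>) M)"
    unfolding is_nat_trans_def
  proof (intro conjI ballI)
    fix c assume "c \<in> Obj (op_cat C)"
    then have c: "c \<in> Obj C" by simp
    interpret H: frm_hom "L.St c" "M.St c" "psh_map \<alpha> c" by (rule hom[OF c])
    show "reg_nat C L (psh_map \<alpha>) M c \<in> Hom (kreg_frm U) (FObj (reg_psh C L) c) (FObj (reg_psh C M) c)"
      using c L.reg_part_Obj[OF U c] M.reg_part_Obj[OF U c] H.frame_hom_reg_part H.h_regs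
      by (auto simp: reg_nat_def Hom_kreg_frm)
  next
    fix f assume "f \<in> Arr (op_cat C)"
    then have fA: "f \<in> Arr C" by simp
    then have f: "f \<in> into C (Cod C f)" "Cod C f \<in> Obj C" "Dom C f \<in> Obj C" by (auto simp: into_def)
    interpret H: frm_hom "L.St (Cod C f)" "M.St (Cod C f)" "psh_map \<alpha> (Cod C f)" by (rule hom[OF f(2)])
    interpret R: frm_hom "L.St (Cod C f)" "L.St (Dom C f)" "L.res f" by (rule L.frm_hom_res[OF f(1)])
    show "Cmp (kreg_frm U) (reg_nat C L (psh_map \<alpha>) M (Cod (op_cat C) f)) (FArr (reg_psh C L) f) =
        Cmp (kreg_frm U) (FArr (reg_psh C M) f) (reg_nat C L (psh_map \<alpha>) M (Dom (op_cat C) f))"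
      using f fA H.h_regs R.h_regs A.map_okD(2)[OF ok f(1)] regs_carrier[of _ "L.St (Cod C f)"]
      by (auto simp: reg_nat_def compose_def fun_eq_iff)
  qed
  then show ?thesis
    using L.reg_psh_Obj[OF U] M.reg_psh_Obj[OF U] by (auto simp: Hom_functor_category reg_nat_def)
qed

lemma is_functor_reg_fctr:
  assumes U: "set_universe U" and C: "is_category C"
  shows "is_functor (internal_kreg_frm U C) (functor_category (op_cat C) (kreg_frm U)) (reg_fctr C)"
  unfolding is_functor_def
proof (intro conjI ballI impI)
  let ?I = "internal_kreg_frm U C" and ?D = "functor_category (op_cat C) (kreg_frm U)"
  {
    fix L assume "L \<in> Obj ?I"
    then interpret L: internal_kreg C U L by (simp add: Obj_internal_kreg_frm[OF C])
    show "FObj (reg_fctr C) L \<in> Obj ?D" using L.reg_psh_Obj[OF U] by (simp add: reg_fctr_def)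
    show "FArr (reg_fctr C) (Idt ?I L) = Idt ?D (FObj (reg_fctr C) L)"
      using regs_carrier[of _ "L.St _"]
      by (auto simp: reg_fctr_def reg_nat_def psh_map_Idt fun_eq_iff)
  next
    fix f assume f0: "f \<in> Arr ?I"
    obtain L \<alpha> M where fe: "f = (L, \<alpha>, M)" by (cases f)
    note f = f0[unfolded fe Arr_internal_kreg_frm[OF C]]
    show "FArr (reg_fctr C) f \<in> Hom ?D (FObj (reg_fctr C) (Dom ?I f)) (FObj (reg_fctr C) (Cod ?I f))"
      using reg_nat_Hom[OF U, of C L M \<alpha>] f by (simp add: fe reg_fctr_def)
    fix g assume g0: "g \<in> Arr ?I" "Cod ?I f = Dom ?I g"
    obtain \<beta> N where ge: "g = (M, \<beta>, N)" using g0(2) by (cases g) (auto simp: fe)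
    note g = g0(1)[unfolded ge Arr_internal_kreg_frm[OF C]]
    interpret L: internal_kreg C U L using f by blast
    interpret M: internal_kreg C U M using f by blast
    interpret A: internal_kreg2 C U L M ..
    have \<gamma>: "psh_map (Cmp (presheaf_topos U C) \<beta> \<alpha>) c = compose (L.X c) (psh_map \<beta> c) (psh_map \<alpha> c)"
      if "c \<in> Obj C" for c
      using psh_map_comp[of C U L M N \<alpha> \<beta> c] f g that by blast
    have "compose (regs (L.St c)) (restrict (psh_map \<beta> c) (regs (M.St c))) (restrict (psh_map \<alpha> c) (regs (L.St c))) =
        restrict (compose (L.X c) (psh_map \<beta> c) (psh_map \<alpha> c)) (regs (L.St c))" if c: "c \<in> Obj C" for c
    proof -
      interpret H: frm_hom "L.St c" "M.St c" "psh_map \<alpha> c"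
        using A.frm_hom_stage[OF A.map_ok_if_Hom _ c] f by blast
      show ?thesis using H.h_regs regs_carrier[of _ "L.St c"] by (auto simp: compose_def fun_eq_iff)
    qed
    then show "FArr (reg_fctr C) (Cmp ?I g f) = Cmp ?D (FArr (reg_fctr C) g) (FArr (reg_fctr C) f)"
      by (auto simp: fe ge reg_fctr_def reg_nat_def \<gamma> intro!: restrict_ext)
  }
qed

lemma reg_fctr_faithful:
  assumes C: "is_category C" and f: "f \<in> Hom (internal_kreg_frm U C) L M" and g: "g \<in> Hom (internal_kreg_frm U C) L M"
    and eq: "FArr (reg_fctr C) f = FArr (reg_fctr C) g"
  shows "f = g"
proof -
  obtain \<alpha> \<beta> where fe: "f = (L, \<alpha>, M)" and ge: "g = (L, \<beta>, M)"
    and L: "internal_kreg C U L" and M: "internal_kreg C U M"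
    and \<alpha>: "\<alpha> \<in> Hom (presheaf_topos U C) (fst L) (fst M)" "psh_relation2.preserves C L M (psh_map \<alpha>)"
    and \<beta>: "\<beta> \<in> Hom (presheaf_topos U C) (fst L) (fst M)" "psh_relation2.preserves C L M (psh_map \<beta>)"
    using f g by (auto simp: Hom_internal_kreg_frm[OF C])
  interpret L: internal_kreg C U L by fact
  interpret M: internal_kreg C U M by fact
  interpret A: internal_kreg2 C U L M ..
  have n: "reg_nat C L (psh_map \<alpha>) M = reg_nat C L (psh_map \<beta>) M" using eq by (simp add: fe ge reg_fctr_def)
  have "psh_map \<alpha> c x = psh_map \<beta> c x" if c: "c \<in> Obj C" and x: "x \<in> regs (L.St c)" for c x
  proof -
    have "restrict (psh_map \<alpha> c) (regs (L.St c)) = restrict (psh_map \<beta> c) (regs (L.St c))"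
      using fun_cong[OF n, of c] c by (simp add: reg_nat_def)
    from fun_cong[OF this, of x] show ?thesis using x by simp
  qed
  then have "psh_map \<alpha> c x = psh_map \<beta> c x" if "c \<in> Obj C" "x \<in> L.X c" for c x
    using A.hom_eq_if_eq_on_regs[OF A.map_ok_if_Hom[OF \<alpha>(1)] \<alpha>(2) A.map_ok_if_Hom[OF \<beta>(1)] \<beta>(2)] that by blast
  then have "psh_map \<alpha> c = psh_map \<beta> c" if "c \<in> Obj C" for c
    using that \<alpha>(1) \<beta>(1) unfolding A.Hom_presheaf_iff
    by (intro extensionalityI[of _ "L.X c"]) (auto simp: PiE_def)
  then have "\<alpha> = \<beta>"
    using \<alpha>(1) \<beta>(1) unfolding A.Hom_presheaf_iff
    by (metis (mono_tags, lifting) restrict_ext)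
  then show ?thesis by (simp add: fe ge)
qed

lemma reg_fctr_full:
  assumes C: "is_category C" and L: "internal_kreg C U L" and M: "internal_kreg C U M"
    and h: "h \<in> Hom (functor_category (op_cat C) (kreg_frm U)) (reg_psh C L) (reg_psh C M)"
  shows "\<exists>f\<in>Hom (internal_kreg_frm U C) L M. FArr (reg_fctr C) f = h"
proof -
  interpret L: internal_kreg C U L by fact
  interpret M: internal_kreg C U M by fact
  interpret A: internal_kreg2 C U L M ..
  obtain \<eta> where he: "h = (reg_psh C L, \<eta>, reg_psh C M)"
    and nat: "is_nat_trans (op_cat C) (kreg_frm U) (reg_psh C L) (reg_psh C M) \<eta>" and ext: "\<eta> \<in> extensional (Obj C)"
    using h by (auto simp: Hom_functor_category)
  define b where "b c = fst (snd (\<eta> c))" for c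
  have \<eta>: "\<eta> c = (reg_part (L.St c), b c, reg_part (M.St c))" "b c \<in> regs (L.St c) \<rightarrow>\<^sub>E regs (M.St c)"
    "frm_hom (reg_part (L.St c)) (reg_part (M.St c)) (b c)" if c: "c \<in> Obj C" for c
  proof -
    have "\<eta> c \<in> Hom (kreg_frm U) (reg_part (L.St c)) (reg_part (M.St c))"
      using nat c by (auto simp: is_nat_trans_def)
    then obtain k where k: "\<eta> c = (reg_part (L.St c), k, reg_part (M.St c))" "frm (reg_part (L.St c))"
      "frm (reg_part (M.St c))" "k \<in> regs (L.St c) \<rightarrow>\<^sub>E regs (M.St c)"
      "frame_hom (reg_part (L.St c)) (reg_part (M.St c)) k"
      by (auto simp: Hom_kreg_frm Obj_kreg_frm)
    have "frm_hom (reg_part (L.St c)) (reg_part (M.St c)) k"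
      by (intro frm_hom.intro frm_hom_axioms.intro k) (use k in auto)
    then show "\<eta> c = (reg_part (L.St c), b c, reg_part (M.St c))" "b c \<in> regs (L.St c) \<rightarrow>\<^sub>E regs (M.St c)"
      "frm_hom (reg_part (L.St c)) (reg_part (M.St c)) (b c)"
      using k by (simp_all add: b_def)
  qed
  have bnat: "b (Dom C f) (L.res f x) = M.res f (b c x)" if f: "f \<in> into C c" and x: "x \<in> regs (L.St c)" for c f x
  proof -
    have fA: "f \<in> Arr C" "Cod C f = c" and o: "c \<in> Obj C" "Dom C f \<in> Obj C" using f by (auto simp: into_def)
    interpret R: frm_hom "L.St c" "L.St (Dom C f)" "L.res f" by (rule L.frm_hom_res[OF f])
    have "Cmp (kreg_frm U) (\<eta> (Dom C f)) (FArr (reg_psh C L) f) = Cmp (kreg_frm U) (FArr (reg_psh C M) f) (\<eta> c)"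
      using nat fA by (auto simp: is_nat_trans_def)
    then have "compose (regs (L.St c)) (b (Dom C f)) (L.res_reg f) = compose (regs (L.St c)) (M.res_reg f) (b c)"
      using fA o by (simp add: \<eta>(1))
    from fun_cong[OF this, of x] show ?thesis using x \<eta>(2)[OF o(1)] fA by (auto simp: compose_def)
  qed
  obtain a where a: "A.map_ok a" "A.preserves a" "\<And>c x. c \<in> Obj C \<Longrightarrow> x \<in> regs (L.St c) \<Longrightarrow> a c x = b c x"
    using A.hom_extends_from_regs[OF \<eta>(3) bnat] by blast
  \<comment> \<open>The extension \<open>a\<close> is controlled only on the stages of
    \<open>L\<close>; arrows of \<open>set_cat\<close> have to be extensional.\<close>
  define \<alpha> where "\<alpha> = (fst L, \<lambda>c\<in>Obj C. (L.X c, restrict (a c) (L.X c), M.X c), fst M)"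
  have pm: "psh_map \<alpha> c = restrict (a c) (L.X c)" if "c \<in> Obj C" for c
    using that by (simp add: \<alpha>_def psh_map_def set_arr_fun_def)
  have \<alpha>: "\<alpha> \<in> Hom (presheaf_topos U C) (fst L) (fst M)"
    unfolding A.Hom_presheaf_iff
  proof (intro conjI ballI)
    show "\<alpha> = (fst L, \<lambda>c\<in>Obj C. (L.X c, psh_map \<alpha> c, M.X c), fst M)"
    proof -
      have "(\<lambda>c\<in>Obj C. (L.X c, psh_map \<alpha> c, M.X c)) = (\<lambda>c\<in>Obj C. (L.X c, restrict (a c) (L.X c), M.X c))"
        by (rule restrict_ext) (simp add: pm)
      then show ?thesis by (simp only: \<alpha>_def[symmetric])
    qed
    fix c assume c: "c \<in> Obj C"
    show "psh_map \<alpha> c \<in> L.X c \<rightarrow>\<^sub>E M.X c" using A.map_okD(1)[OF a(1) c] c by (auto simp: pm)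
    fix f x assume f: "f \<in> into C c" and x: "x \<in> L.X c"
    show "psh_map \<alpha> (Dom C f) (L.res f x) = M.res f (psh_map \<alpha> c x)"
      using A.map_okD(2)[OF a(1) f x] c f x by (simp add: pm L.into_dom)
  qed
  have "img C (psh_map \<alpha>) S = img C a S" if S: "S \<in> L.Pw c" for S c
    unfolding img_def
  proof (rule image_cong[OF refl])
    fix p assume p: "p \<in> S"
    obtain f x where "p = (f, x)" by (cases p)
    then show "(case p of (f, x) \<Rightarrow> (f, psh_map \<alpha> (Dom C f) x)) = (case p of (f, x) \<Rightarrow> (f, a (Dom C f) x))"
      using L.PwD(1,2)[OF S, of f x] p by (simp add: pm L.into_dom)
  qed
  then have "A.preserves (psh_map \<alpha>)"
    using a(2) by (simp add: A.preserves_def pm)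
  then have "(L, \<alpha>, M) \<in> Hom (internal_kreg_frm U C) L M"
    using \<alpha> L M by (simp add: Hom_internal_kreg_frm[OF C])
  moreover have "reg_nat C L (psh_map \<alpha>) M = \<eta>"
  proof (rule extensionalityI[OF _ ext])
    show "reg_nat C L (psh_map \<alpha>) M \<in> extensional (Obj C)" by (simp add: reg_nat_def)
    fix c assume c: "c \<in> Obj C"
    have "restrict (restrict (a c) (L.X c)) (regs (L.St c)) = b c"
      using \<eta>(2)[OF c] a(3)[OF c] regs_carrier[of _ "L.St c"]
      by (intro extensionalityI[of _ "regs (L.St c)"]) (auto simp: PiE_def)
    then show "reg_nat C L (psh_map \<alpha>) M c = \<eta> c" using c by (simp add: reg_nat_def pm \<eta>(1))
  qed
  then have "FArr (reg_fctr C) (L, \<alpha>, M) = h" by (simp add: reg_fctr_def he)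
  ultimately show ?thesis by blast
qed

section \<open>Essential surjectivity\<close>

lemma set_universeD:
  assumes "set_universe U"
  shows "X \<in> U \<Longrightarrow> Y \<subseteq> X \<Longrightarrow> Y \<in> U"
    and "X \<in> U \<Longrightarrow> \<exists>Y\<in>U. Y \<approx> Pow X"
    and "I \<in> U \<Longrightarrow> (\<And>i. i \<in> I \<Longrightarrow> A i \<in> U) \<Longrightarrow> \<exists>Y\<in>U. Y \<approx> Sigma I A"
  using assms by (simp_all add: set_universe_def)

text \<open>A function is coded by its graph, a subset of a disjoint sum. The universe offers sums
  and power sets only up to bijection, hence the transports \<open>\<psi>\<close> and
  \<open>\<chi>\<close> and a conclusion that asks for an injection with image in
  \<open>U\<close>.\<close>

lemma set_universe_PiE:
  fixes U :: "'u set set" and A :: "'b \<Rightarrow> 'u set"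
  assumes U: "set_universe U" and I: "I \<in> U" "I \<approx> J" and A: "\<And>j. j \<in> J \<Longrightarrow> A j \<in> U"
  shows "\<exists>e. inj_on e (PiE J A) \<and> e ` PiE J A \<in> U"
proof -
  obtain \<phi> where \<phi>: "bij_betw \<phi> I J" using I(2) by (auto simp: eqpoll_def)
  have "A (\<phi> i) \<in> U" if "i \<in> I" for i using \<phi> A that by (auto simp: bij_betw_def)
  then obtain Y where Y: "Y \<in> U" "Y \<approx> Sigma I (\<lambda>i. A (\<phi> i))"
    using set_universeD(3)[OF U I(1), of "\<lambda>i. A (\<phi> i)"] by blast
  obtain Z where Z: "Z \<in> U" "Z \<approx> Pow Y" using set_universeD(2)[OF U Y(1)] by blast
  obtain \<psi> where \<psi>: "bij_betw \<psi> (Sigma I (\<lambda>i. A (\<phi> i))) Y"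
    using eqpoll_sym[OF Y(2)] by (auto simp: eqpoll_def)
  obtain \<chi> where \<chi>: "bij_betw \<chi> (Pow Y) Z" using eqpoll_sym[OF Z(2)] by (auto simp: eqpoll_def)
  \<comment> \<open>The graph of \<open>u\<close>, with \<open>J\<close> replaced by its copy
    \<open>I\<close>: sums in the universe are indexed by its own members, whereas \<open>J\<close>
    may live in another type.\<close>
  define g where "g u = (\<lambda>i. (i, u (\<phi> i))) ` I" for u :: "'b \<Rightarrow> 'u"
  have g: "g u \<subseteq> Sigma I (\<lambda>i. A (\<phi> i))" if "u \<in> PiE J A" for u
    using that \<phi> by (auto simp: g_def bij_betw_def)
  have \<psi>g: "\<psi> ` g u \<in> Pow Y" if "u \<in> PiE J A" for u
    using g[OF that] \<psi> by (auto simp: bij_betw_def)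
  have inj_g: "u = v" if "u \<in> PiE J A" "v \<in> PiE J A" "g u = g v" for u v
  proof (rule PiE_ext[OF that(1,2)])
    fix j assume "j \<in> J"
    then obtain i where i: "i \<in> I" "j = \<phi> i" using \<phi> by (auto simp: bij_betw_def)
    then have "(i, u j) \<in> g u" by (auto simp: g_def)
    then have "(i, u j) \<in> g v" using that(3) by simp
    then show "u j = v j" using i by (auto simp: g_def)
  qed
  let ?e = "\<lambda>u. \<chi> (\<psi> ` g u)"
  have "inj_on ?e (PiE J A)"
  proof (rule inj_onI)
    fix u v assume u: "u \<in> PiE J A" and v: "v \<in> PiE J A" and eq: "?e u = ?e v"
    have "\<psi> ` g u = \<psi> ` g v"
      by (rule inj_onD[OF bij_betw_imp_inj_on[OF \<chi>] eq \<psi>g[OF u] \<psi>g[OF v]])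
    then have "g u = g v"
      using inj_on_image_eq_iff[of \<psi> "Sigma I (\<lambda>i. A (\<phi> i))" "g u" "g v"] \<psi> g[OF u] g[OF v]
      by (simp add: bij_betw_def)
    then show "u = v" by (rule inj_g[OF u v])
  qed
  moreover have "?e ` PiE J A \<subseteq> Z"
    using bij_betwE[OF \<chi>] \<psi>g by blast
  then have "?e ` PiE J A \<in> U" by (rule set_universeD(1)[OF U Z(1)])
  ultimately show ?thesis by blast
qed

section \<open>The internal frame of lax families of a presheaf of compact regular frames\<close>

locale kreg_presheaf = cat C for C :: "('o, 'a) category" +
  fixes U :: "'u set set" and F :: "('o, 'a, 'u gorder, 'u gorder \<times> ('u \<Rightarrow> 'u) \<times> 'u gorder) fctr"
  assumes U: "set_universe U" and small: "small_category U C"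
    and F: "F \<in> Obj (functor_category (op_cat C) (kreg_frm U))"
begin

abbreviation K where "K \<equiv> FObj F"

definition kr :: "'a \<Rightarrow> 'u \<Rightarrow> 'u" where
  "kr f = fst (snd (FArr F f))"

lemma is_functor_F: "is_functor (op_cat C) (kreg_frm U) F"
  using F by (simp add: Obj_functor_category)

lemma K_Obj: "c \<in> Obj C \<Longrightarrow> K c \<in> Obj (kreg_frm U)"
  using is_functorD(1)[OF is_functor_F] by simp

lemma FArr_F:
  assumes "f \<in> Arr C"
  shows "FArr F f = (K (Cod C f), kr f, K (Dom C f))" "kr f \<in> carrier (K (Cod C f)) \<rightarrow>\<^sub>E carrier (K (Dom C f))"
    "frame_hom (K (Cod C f)) (K (Dom C f)) (kr f)"
proof -
  have "FArr F f \<in> Hom (kreg_frm U) (K (Cod C f)) (K (Dom C f))"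
    using is_functorD(2)[OF is_functor_F, of f] assms by (simp add: Hom_def)
  then show "FArr F f = (K (Cod C f), kr f, K (Dom C f))"
    "kr f \<in> carrier (K (Cod C f)) \<rightarrow>\<^sub>E carrier (K (Dom C f))"
    "frame_hom (K (Cod C f)) (K (Dom C f)) (kr f)"
    by (auto simp: Hom_kreg_frm kr_def)
qed

lemma kr_frm_hom: "f \<in> into C c \<Longrightarrow> frm_hom (K c) (K (Dom C f)) (kr f)"
  using FArr_F[of f] K_Obj[of c] K_Obj[of "Dom C f"]
  by (intro frm_hom.intro frm_hom_axioms.intro) (auto simp: into_def Obj_kreg_frm)

lemma kr_Idt: "c \<in> Obj C \<Longrightarrow> x \<in> carrier (K c) \<Longrightarrow> kr (Idt C c) x = x"
  using is_functorD(3)[OF is_functor_F, of c] by (simp add: kr_def)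

lemma kr_Cmp:
  assumes "f \<in> into C c" "g \<in> into C (Dom C f)" "x \<in> carrier (K c)"
  shows "kr (Cmp C f g) x = kr g (kr f x)"
proof -
  have f: "f \<in> Arr C" "Cod C f = c" "g \<in> Arr C" "Cod C g = Dom C f" using assms by (auto simp: into_def)
  have "FArr F (Cmp C f g) = Cmp (kreg_frm U) (FArr F g) (FArr F f)"
    using is_functorD(4)[OF is_functor_F, of f c "Dom C f" g "Dom C g"] f by (simp add: Hom_def)
  then show ?thesis
    unfolding FArr_F(1)[OF f(1)] FArr_F(1)[OF f(3)] using f assms by (simp add: kr_def[of "Cmp C f g"] compose_def)
qed

definition lax_families :: "'o \<Rightarrow> ('a \<Rightarrow> 'u) set" where
  "lax_families c = {u \<in> (\<Pi>\<^sub>E f\<in>into C c. carrier (K (Dom C f))).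
     \<forall>f\<in>into C c. \<forall>g\<in>into C (Dom C f). kr g (u f) \<sqsubseteq>\<^bsub>K (Dom C g)\<^esub> u (Cmp C f g)}"

lemma lax_families_extensional: "u \<in> lax_families c \<Longrightarrow> u \<in> extensional (into C c)"
  by (simp add: lax_families_def PiE_def)

text \<open>Restriction along \<open>f\<close> on the level of families: composition with
  \<open>f\<close> maps the arrows into \<open>Dom C f\<close> to arrows into
  \<open>c\<close>.\<close>

definition shift :: "'a \<Rightarrow> ('a \<Rightarrow> 'u) \<Rightarrow> 'a \<Rightarrow> 'u" where
  "shift f u = (\<lambda>g\<in>into C (Dom C f). u (Cmp C f g))"

lemma shift_lax_families:
  assumes "f \<in> into C c" "u \<in> lax_families c"
  shows "shift f u \<in> lax_families (Dom C f)"
proof -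
  have u: "u g \<in> carrier (K (Dom C g))" "\<And>h. h \<in> into C (Dom C g) \<Longrightarrow> kr h (u g) \<sqsubseteq>\<^bsub>K (Dom C h)\<^esub> u (Cmp C g h)"
    if "g \<in> into C c" for g
    using assms(2) that by (auto simp: lax_families_def)
  have "u (Cmp C f g) \<in> carrier (K (Dom C g))" if "g \<in> into C (Dom C f)" for g
    using u(1)[OF into_comp[OF assms(1) that]] that assms(1) by simp
  moreover have "kr h (u (Cmp C f g)) \<sqsubseteq>\<^bsub>K (Dom C h)\<^esub> u (Cmp C f (Cmp C g h))"
    if "g \<in> into C (Dom C f)" "h \<in> into C (Dom C g)" for g h
    using u(2)[OF into_comp[OF assms(1) that(1)], of h] that assms(1) comp_assoc_into[OF assms(1) that] by simp
  ultimately show ?thesis by (auto simp: lax_families_def shift_def)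
qed

lemma encoding_ex:
  assumes "c \<in> Obj C"
  shows "\<exists>e. inj_on e (lax_families c) \<and> e ` lax_families c \<in> U"
proof -
  obtain X0 \<phi> where X0: "X0 \<in> U" "bij_betw \<phi> X0 (Arr C)"
    using small by (auto simp: small_category_def eqpoll_def)
  \<comment> \<open>The arrows into \<open>c\<close>, as a subset of the copy of
    \<open>Arr C\<close> that smallness provides in the universe.\<close>
  let ?I = "{i \<in> X0. \<phi> i \<in> into C c}"
  have "?I \<in> U" by (rule set_universeD(1)[OF U X0(1)]) auto
  moreover have "?I \<approx> into C c"
  proof -
    have "into C c \<subseteq> \<phi> ` X0" using bij_betw_imp_surj_on[OF X0(2)] by (auto simp: into_def)
    then have "\<phi> ` ?I = into C c" by blast
    then have "bij_betw \<phi> ?I (into C c)" by (intro bij_betw_subset[OF X0(2)]) auto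
    then show ?thesis by (auto simp: eqpoll_def)
  qed
  moreover have "carrier (K (Dom C f)) \<in> U" if "f \<in> into C c" for f
    using K_Obj[OF into_dom[OF that]] by (simp add: Obj_kreg_frm)
  ultimately obtain e where e: "inj_on e (\<Pi>\<^sub>E f\<in>into C c. carrier (K (Dom C f)))"
    "e ` (\<Pi>\<^sub>E f\<in>into C c. carrier (K (Dom C f))) \<in> U"
    using set_universe_PiE[OF U, of ?I "into C c" "\<lambda>f. carrier (K (Dom C f))"] by blast
  have sub: "lax_families c \<subseteq> (\<Pi>\<^sub>E f\<in>into C c. carrier (K (Dom C f)))" by (auto simp: lax_families_def)
  have "e ` lax_families c \<in> U" by (rule set_universeD(1)[OF U e(2) image_mono[OF sub]])
  then show ?thesis using inj_on_subset[OF e(1) sub] by blast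
qed

text \<open>Lax families are functions on arrows, whereas presheaves take values in sets over
  \<open>'u\<close>. An injection with image in the universe, chosen once for each stage, transports
  them.\<close>

definition enc :: "'o \<Rightarrow> ('a \<Rightarrow> 'u) \<Rightarrow> 'u" where
  "enc c = (SOME e. inj_on e (lax_families c) \<and> e ` lax_families c \<in> U)"

definition dec :: "'o \<Rightarrow> 'u \<Rightarrow> 'a \<Rightarrow> 'u" where
  "dec c = inv_into (lax_families c) (enc c)"

abbreviation codes :: "'o \<Rightarrow> 'u set" where
  "codes c \<equiv> enc c ` lax_families c"

lemma enc:
  assumes "c \<in> Obj C"
  shows "inj_on (enc c) (lax_families c)" "codes c \<in> U"
  using someI_ex[OF encoding_ex[OF assms]] by (auto simp: enc_def)

lemma dec_enc: "c \<in> Obj C \<Longrightarrow> u \<in> lax_families c \<Longrightarrow> dec c (enc c u) = u"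
  using enc(1) by (simp add: dec_def)

lemma dec_lax: "x \<in> codes c \<Longrightarrow> dec c x \<in> lax_families c"
  unfolding dec_def by (rule inv_into_into)

lemma enc_dec: "x \<in> codes c \<Longrightarrow> enc c (dec c x) = x"
  using f_inv_into_f[of x "enc c" "lax_families c"] by (simp add: dec_def)

definition lax_psh :: "('o, 'a, 'u) presheaf" where
  "lax_psh = \<lparr>FObj = (\<lambda>c\<in>Obj C. codes c),
     FArr = (\<lambda>f\<in>Arr C. (codes (Cod C f), \<lambda>x\<in>codes (Cod C f). enc (Dom C f) (shift f (dec (Cod C f) x)),
       codes (Dom C f)))\<rparr>"

definition lax_rel :: "'o \<Rightarrow> ('u \<times> 'u) set" where
  "lax_rel c = {(x, y) \<in> codes c \<times> codes c.
     \<forall>f\<in>into C c. dec c x f \<sqsubseteq>\<^bsub>K (Dom C f)\<^esub> dec c y f}"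

abbreviation lax_frame :: "('o, 'a, 'u) psh_rel" where
  "lax_frame \<equiv> (lax_psh, lax_rel)"

lemma lax_psh_obj [simp]: "c \<in> Obj C \<Longrightarrow> FObj lax_psh c = codes c"
  by (simp add: lax_psh_def)

lemma lax_psh_res:
  assumes "f \<in> into C c" "x \<in> codes c"
  shows "psh_restrict lax_psh f x = enc (Dom C f) (shift f (dec c x))"
  using assms by (auto simp: psh_restrict_def lax_psh_def set_arr_fun_def into_def)

lemma dec_res:
  assumes "f \<in> into C c" "x \<in> codes c"
  shows "dec (Dom C f) (psh_restrict lax_psh f x) = shift f (dec c x)"
  using dec_enc[OF into_dom[OF assms(1)] shift_lax_families[OF assms(1) dec_lax[OF assms(2)]]]
  by (simp add: lax_psh_res[OF assms])

lemma shift_id: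
  assumes "c \<in> Obj C" "u \<in> lax_families c"
  shows "shift (Idt C c) u = u"
proof -
  have "u \<in> extensional (into C c)" by (rule lax_families_extensional[OF assms(2)])
  then show ?thesis using assms(1) by (auto simp: shift_def fun_eq_iff extensional_def intoD)
qed

lemma shift_comp:
  assumes "f \<in> into C c" "g \<in> into C (Dom C f)"
  shows "shift (Cmp C f g) u = shift g (shift f u)"
  using assms comp_assoc_into[OF assms] by (auto simp: shift_def fun_eq_iff)

lemma lax_psh_Obj: "lax_psh \<in> Obj (presheaf_topos U C)"
proof -
  have sc: "enc (Dom C f) (shift f (dec c x)) \<in> codes (Dom C f)" if "f \<in> into C c" "x \<in> codes c" for f c x
    using shift_lax_families[OF that(1) dec_lax[OF that(2)]] by blast
  have "is_functor (op_cat C) (set_cat U) lax_psh"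
    unfolding is_functor_def
  proof (intro conjI ballI impI)
    fix c assume "c \<in> Obj (op_cat C)"
    then have c: "c \<in> Obj C" by simp
    show "FObj lax_psh c \<in> Obj (set_cat U)" using enc(2)[OF c] c by (simp add: set_cat_def)
    have "enc c (shift (Idt C c) (dec c x)) = x" if "x \<in> codes c" for x
      using shift_id[OF c dec_lax[OF that]] enc_dec[OF that] by simp
    then show "FArr lax_psh (Idt (op_cat C) c) = Idt (set_cat U) (FObj lax_psh c)"
      using c by (auto simp: lax_psh_def fun_eq_iff)
  next
    fix f assume "f \<in> Arr (op_cat C)"
    then have fA: "f \<in> Arr C" by simp
    then have f: "f \<in> into C (Cod C f)" "Cod C f \<in> Obj C" "Dom C f \<in> Obj C" by (auto simp: into_def)
    show "FArr lax_psh f \<in> Hom (set_cat U) (FObj lax_psh (Dom (op_cat C) f)) (FObj lax_psh (Cod (op_cat C) f))"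
      using f fA enc(2) sc[OF f(1)] by (auto simp: Hom_set_cat) (auto simp: lax_psh_def)
    fix g assume "g \<in> Arr (op_cat C)" "Cod (op_cat C) f = Dom (op_cat C) g"
    then have gA: "g \<in> Arr C" "Cod C g = Dom C f" by auto
    then have g: "g \<in> into C (Dom C f)" by (simp add: into_def)
    have "enc (Dom C g) (shift (Cmp C f g) (dec (Cod C f) x)) =
        enc (Dom C g) (shift g (dec (Dom C f) (enc (Dom C f) (shift f (dec (Cod C f) x)))))"
      if "x \<in> codes (Cod C f)" for x
      using dec_enc[OF f(3) shift_lax_families[OF f(1) dec_lax[OF that]]] shift_comp[OF f(1) g] by simp
    then show "FArr lax_psh (Cmp (op_cat C) g f) = Cmp (set_cat U) (FArr lax_psh g) (FArr lax_psh f)"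
      using fA gA sc[OF f(1)] by (auto simp: lax_psh_def compose_def fun_eq_iff)
  qed
  then show ?thesis by (simp add: presheaf_topos_def Obj_functor_category lax_psh_def)
qed

text \<open>Evaluation at the identity after a shift along \<open>f\<close> returns the component at
  \<open>f\<close>. The family attached to a code is thus the coded family itself, and order,
  laxness and existence hold by construction.\<close>

lemma lax_rep_lax_frame: "lax_rep C U lax_frame K kr (\<lambda>c x. dec c x (Idt C c))"
proof -
  have at: "dec (Dom C f) (psh_restrict lax_psh f x) (Idt C (Dom C f)) = dec c x f"
    if "f \<in> into C c" "x \<in> codes c" for f c x
    using that dec_res[OF that] into_id[OF into_dom[OF that(1)]] by (simp add: shift_def intoD)
  have decK: "dec c x f \<in> carrier (K (Dom C f))" if "f \<in> into C c" "x \<in> codes c" for f c x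
    using dec_lax[OF that(2)] that(1) by (auto simp: lax_families_def)
  have rc: "psh_restrict lax_psh f x \<in> codes (Dom C f)" if "f \<in> into C c" "x \<in> codes c" for f c x
    using shift_lax_families[OF that(1) dec_lax[OF that(2)]] lax_psh_res[OF that] by auto
  have cI: "c \<in> Obj C" if "f \<in> into C c" for f c using that by (auto simp: into_def)
  have "psh_relation C U lax_frame"
  proof unfold_locales
    show "fst lax_frame \<in> Obj (presheaf_topos U C)" using lax_psh_Obj by simp
    show "snd lax_frame c \<subseteq> FObj (fst lax_frame) c \<times> FObj (fst lax_frame) c" if "c \<in> Obj C" for c
      using that by (auto simp: lax_rel_def)
    fix f x y assume fA: "f \<in> Arr C" and xy: "(x, y) \<in> snd lax_frame (Cod C f)"
    have f: "f \<in> into C (Cod C f)" using fA by (simp add: into_def)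
    have X: "x \<in> codes (Cod C f)" "y \<in> codes (Cod C f)" using xy by (auto simp: lax_rel_def)
    have "dec (Cod C f) x (Cmp C f g) \<sqsubseteq>\<^bsub>K (Dom C g)\<^esub> dec (Cod C f) y (Cmp C f g)"
      if "g \<in> into C (Dom C f)" for g
    proof -
      have "\<forall>h\<in>into C (Cod C f). dec (Cod C f) x h \<sqsubseteq>\<^bsub>K (Dom C h)\<^esub> dec (Cod C f) y h"
        using xy by (simp add: lax_rel_def)
      from bspec[OF this into_comp[OF f that]] show ?thesis using f that by simp
    qed
    then show "(psh_restrict (fst lax_frame) f x, psh_restrict (fst lax_frame) f y) \<in> snd lax_frame (Dom C f)"
      using rc[OF f] X by (auto simp: lax_rel_def dec_res[OF f] shift_def)
  qed
  then show ?thesis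
  proof (rule lax_rep.intro, intro lax_rep_axioms.intro)
    show "frm (K c)" "compact_frame (K c)" "regular_frame (K c)" if "c \<in> Obj C" for c
      using K_Obj[OF that] by (auto simp: Obj_kreg_frm)
    show "frm_hom (K c) (K (Dom C f)) (kr f)" if "f \<in> into C c" for f c by (rule kr_frm_hom[OF that])
    show "kr (Idt C c) x = x" if "c \<in> Obj C" "x \<in> carrier (K c)" for c x by (rule kr_Idt[OF that])
    show "kr (Cmp C f g) x = kr g (kr f x)"
      if "f \<in> into C c" "g \<in> into C (Dom C f)" "x \<in> carrier (K c)" for f c g x
      by (rule kr_Cmp[OF that])
    show "dec c x (Idt C c) \<in> carrier (K c)" if "c \<in> Obj C" "x \<in> FObj (fst lax_frame) c" for c x
      using decK[OF into_id[OF that(1)], of x] that by simp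
    fix c x y assume c: "c \<in> Obj C" and "x \<in> FObj (fst lax_frame) c" "y \<in> FObj (fst lax_frame) c"
    then have X: "x \<in> codes c" "y \<in> codes c" by auto
    show "(x, y) \<in> snd lax_frame c \<longleftrightarrow>
        (\<forall>f\<in>into C c. dec (Dom C f) (psh_restrict (fst lax_frame) f x) (Idt C (Dom C f))
           \<sqsubseteq>\<^bsub>K (Dom C f)\<^esub> dec (Dom C f) (psh_restrict (fst lax_frame) f y) (Idt C (Dom C f)))"
      using X by (simp add: lax_rel_def at)
    assume eq: "\<And>f. f \<in> into C c \<Longrightarrow> dec (Dom C f) (psh_restrict (fst lax_frame) f x) (Idt C (Dom C f)) =
        dec (Dom C f) (psh_restrict (fst lax_frame) f y) (Idt C (Dom C f))"
    have "dec c x = dec c y"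
      by (rule extensionalityI[of _ "into C c"])
        (use lax_families_extensional dec_lax X eq in \<open>simp_all add: at\<close>)
    then show "x = y" using enc_dec[OF X(1)] enc_dec[OF X(2)] by metis
  next
    fix f c x assume f: "f \<in> into C c" and "x \<in> FObj (fst lax_frame) c"
    then have x: "x \<in> codes c" using cI[OF f] by simp
    have "kr f (dec c x (Idt C c)) \<sqsubseteq>\<^bsub>K (Dom C f)\<^esub> dec c x (Cmp C (Idt C c) f)"
      using dec_lax[OF x] into_id[OF cI[OF f]] f cI[OF f] by (auto simp: lax_families_def)
    then show "kr f (dec c x (Idt C c)) \<sqsubseteq>\<^bsub>K (Dom C f)\<^esub>
        dec (Dom C f) (psh_restrict (fst lax_frame) f x) (Idt C (Dom C f))"
      using at[OF f x] f by (simp add: intoD)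
  next
    fix c u assume c: "c \<in> Obj C" and u: "\<And>f. f \<in> into C c \<Longrightarrow> u f \<in> carrier (K (Dom C f))"
      and lax: "\<And>f g. f \<in> into C c \<Longrightarrow> g \<in> into C (Dom C f) \<Longrightarrow> kr g (u f) \<sqsubseteq>\<^bsub>K (Dom C g)\<^esub> u (Cmp C f g)"
    let ?u = "restrict u (into C c)"
    have ul: "?u \<in> lax_families c" using u lax by (auto simp: lax_families_def into_comp)
    show "\<exists>x\<in>FObj (fst lax_frame) c. \<forall>f\<in>into C c.
        dec (Dom C f) (psh_restrict (fst lax_frame) f x) (Idt C (Dom C f)) = u f"
      using ul c at[of _ c "enc c ?u"] dec_enc[OF c ul] by (intro bexI[of _ "enc c ?u"]) auto
  qed
qed

text \<open>Regular elements of the frame of lax families are the strict families, so evaluation at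
  the identity identifies them with the elements of \<open>K c\<close>. Naturality of this
  identification is \<open>r_res_regs\<close>.\<close>

lemma reg_fctr_dense:
  "\<exists>L. internal_kreg C U L \<and> (\<exists>h\<in>Hom (functor_category (op_cat C) (kreg_frm U)) (reg_psh C L) F.
     is_iso (functor_category (op_cat C) (kreg_frm U)) h)"
proof -
  interpret R: lax_rep C U lax_frame K kr "\<lambda>c x. dec c x (Idt C c)" by (rule lax_rep_lax_frame)
  let ?L = lax_frame
  let ?r = "\<lambda>c. restrict (\<lambda>x. dec c x (Idt C c)) (regs (R.St c))"
  let ?\<eta> = "\<lambda>c\<in>Obj C. (reg_part (R.St c), ?r c, K c)"
  have iso: "(reg_part (R.St c), ?r c, K c) \<in> Hom (kreg_frm U) (reg_part (R.St c)) (K c)"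
    "is_iso (kreg_frm U) (reg_part (R.St c), ?r c, K c)" if c: "c \<in> Obj C" for c
  proof -
    have b: "bij_betw (?r c) (carrier (reg_part (R.St c))) (carrier (K c))"
      using R.r_bij[OF c] by simp
    have l: "?r c x \<sqsubseteq>\<^bsub>K c\<^esub> ?r c y \<longleftrightarrow> x \<sqsubseteq>\<^bsub>reg_part (R.St c)\<^esub> y"
      if "x \<in> carrier (reg_part (R.St c))" "y \<in> carrier (reg_part (R.St c))" for x y
      using R.r_le_regs[OF c, of x y] that by simp
    have e: "?r c \<in> extensional (carrier (reg_part (R.St c)))"
      by (simp only: reg_part_simps restrict_extensional)
    show "(reg_part (R.St c), ?r c, K c) \<in> Hom (kreg_frm U) (reg_part (R.St c)) (K c)"
      "is_iso (kreg_frm U) (reg_part (R.St c), ?r c, K c)"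
      by (rule is_iso_kreg_frmI[OF R.reg_part_Obj[OF U c] K_Obj[OF c] e b l]; assumption)+
  qed
  have nat: "is_nat_trans (op_cat C) (kreg_frm U) (reg_psh C ?L) F ?\<eta>"
    unfolding is_nat_trans_def
  proof (intro conjI ballI)
    fix c assume "c \<in> Obj (op_cat C)"
    then show "?\<eta> c \<in> Hom (kreg_frm U) (FObj (reg_psh C ?L) c) (K c)" using iso(1) by simp
  next
    fix f assume "f \<in> Arr (op_cat C)"
    then have fA: "f \<in> Arr C" by simp
    then have f: "f \<in> into C (Cod C f)" "Cod C f \<in> Obj C" "Dom C f \<in> Obj C" by (auto simp: into_def)
    interpret H: frm_hom "R.St (Cod C f)" "R.St (Dom C f)" "R.res f" by (rule R.frm_hom_res[OF f(1)])
    have "compose (regs (R.St (Cod C f))) (?r (Dom C f)) (R.res_reg f) = compose (regs (R.St (Cod C f))) (kr f) (?r (Cod C f))"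
      using R.r_res_regs[OF f(1)] H.h_regs by (auto simp: compose_def fun_eq_iff)
    then show "Cmp (kreg_frm U) (?\<eta> (Cod (op_cat C) f)) (FArr (reg_psh C ?L) f) =
        Cmp (kreg_frm U) (FArr F f) (?\<eta> (Dom (op_cat C) f))"
      using f fA FArr_F(1)[OF fA] by simp
  qed
  then have "(reg_psh C ?L, ?\<eta>, F) \<in> Arr (functor_category (op_cat C) (kreg_frm U))"
    using R.reg_psh_Obj[OF U] F by (simp add: Arr_functor_category)
  moreover from this have "is_iso (functor_category (op_cat C) (kreg_frm U)) (reg_psh C ?L, ?\<eta>, F)"
    by (rule is_iso_functor_categoryI[OF is_category_op_cat[OF is_category] is_category_kreg_frm]) (simp add: iso(2))
  ultimately show ?thesis using R.internal_kreg by (auto simp: Hom_def intro!: exI[of _ ?L])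
qed

end

theorem theorem5p1:
  fixes U :: "'u set set" and C :: "('o, 'a) category"
  assumes "set_universe U"
    and "small_category U C"
  shows "equivalent_categories (internal_kreg_frm U C) (functor_category (op_cat C) (kreg_frm U))"
proof -
  have C: "is_category C" using assms(2) by (simp add: small_category_def)
  have D: "is_category (functor_category (op_cat C) (kreg_frm U))"
    by (intro is_category_functor_category is_category_op_cat C is_category_kreg_frm)
  show ?thesis
  proof (rule equivalent_categoriesI[OF is_category_internal_kreg_frm[OF C] D is_functor_reg_fctr[OF assms(1) C]])
    show "f = g" if "f \<in> Hom (internal_kreg_frm U C) L M" "g \<in> Hom (internal_kreg_frm U C) L M"
      "FArr (reg_fctr C) f = FArr (reg_fctr C) g" for L M f g
      by (rule reg_fctr_faithful[OF C that])
    show "\<exists>f\<in>Hom (internal_kreg_frm U C) L M. FArr (reg_fctr C) f = h"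
      if "L \<in> Obj (internal_kreg_frm U C)" "M \<in> Obj (internal_kreg_frm U C)"
        "h \<in> Hom (functor_category (op_cat C) (kreg_frm U)) (FObj (reg_fctr C) L) (FObj (reg_fctr C) M)" for L M h
      using reg_fctr_full[OF C, of U L M h] that by (simp add: Obj_internal_kreg_frm[OF C] reg_fctr_def)
    show "\<exists>L\<in>Obj (internal_kreg_frm U C).
        \<exists>h\<in>Hom (functor_category (op_cat C) (kreg_frm U)) (FObj (reg_fctr C) L) F.
          is_iso (functor_category (op_cat C) (kreg_frm U)) h"
      if "F \<in> Obj (functor_category (op_cat C) (kreg_frm U))" for F
    proof -
      interpret kreg_presheaf C U F by unfold_locales (fact C assms that)+
      show ?thesis using reg_fctr_dense by (auto simp: Obj_internal_kreg_frm[OF C] reg_fctr_def)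
    qed
  qed
qed

end
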